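(* Let $\Omega\subset\mathbb{R}^2$ be a bounded domain and let $u$ be a (nonzero, real-valued) Dirichlet eigenfunction, $-\Delta u=\lambda u$ in $\Omega$, $u|_{\partial\Omega}=0$, that extends real-analytically to an open neighbourhood of $\overline\Omega$. Let $\Omega_i$ be a Neumann domain of $u$, and let $x_1,x_2\in\overline{\Omega}_i$ be distinct local maxima of $u$. Then there exists a curve of local maxima $\theta$ of $u$ such that $x_1,x_2\in\theta$.
   Context: Put $\Gamma^D=\partial\Omega$. Local maxima/minima are understood in the non-strict sense; for points of $\partial\Omega$ they are understood for the analytic extension of $u$. Put $\mathcal{C}=\{x\in\overline\Omega:\operatorname{grad}u(x)=0\}$; let $\mathcal{M}_+$, $\mathcal{M}_-$ be the sets of points of $\mathcal{C}$ that are local maxima, resp. local minima, of $u$, and let $\mathcal{S}=\mathcal{C}\setminus(\mathcal{M}_+\cup\mathcal{M}_-)$ be the set of saddle points (possibly degenerate). For $x\in\overline\Omega$ let $\gamma_x(t)$ be the integral curve of the vector field $-\operatorname{grad}u$ with $\gamma_x(0)=x$, followed forward and backward as long as it stays in $\overline\Omega$. It is known that in each time direction, for $x\in\Omega$, the curve either reaches $\Gamma^D$ in finite time or tends to a point of $\mathcal{C}$ as $t\to\pm\infty$; in the latter case the limit is denoted $\gamma_x(\pm\infty)$. For $x_0\in\mathcal{C}$ put $W^s(x_0)=\{x\in\overline\Omega:\gamma_x(+\infty)=x_0\}$, $W^u(x_0)=\{x\in\overline\Omega:\gamma_x(-\infty)=x_0\}$, and for $r\in\mathcal{S}$ put $L(r)=W^s(r)\cup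 W^u(r)$. The Neumann line set is $$\mathcal{N}(u)=\overline{\bigcup_{r\in\mathcal{S}}\partial L(r)\setminus\Gamma^D}\,\cup\,\mathcal{C},$$ with boundary and closure taken in $\mathbb{R}^2$. The Neumann domains of $u$ are the connected components of $\Omega\setminus\mathcal{N}(u)$. It is known that $\mathcal{M}_+$ is a disjoint union of isolated points (isolated local maxima) and simple closed curves, each of them isolated in $\mathcal{C}$; a curve of local maxima is one of these simple closed curves, i.e. a connected component of $\mathcal{M}_+$ which is a simple closed curve. *)

theory Defs
  imports "HOL-Analysis.Analysis"
begin

definition real_analytic_on :: "(real^2 \<Rightarrow> real) \<Rightarrow> (real^2) set \<Rightarrow> bool"
    (infixl "real'_analytic'_on" 50) where
  "f real_analytic_on U \<longleftrightarrow>
     (\<forall>p\<in>U. \<exists>(a :: nat \<Rightarrow> nat \<Rightarrow> real) r. r > 0 \<and>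
        (\<forall>x\<in>ball p r.
           ((\<lambda>(i, j). a i j * (x$1 - p$1) ^ i * (x$2 - p$2) ^ j) has_sum f x) UNIV))"

definition grad :: "(real^2 \<Rightarrow> real) \<Rightarrow> real^2 \<Rightarrow> real^2" where
  "grad f x = (THE D. GDERIV f x :> D)"

definition laplacian :: "(real^2 \<Rightarrow> real) \<Rightarrow> real^2 \<Rightarrow> real" where
  "laplacian f x = (\<Sum>i\<in>UNIV. (deriv ^^ 2) (\<lambda>t. f (x + t *\<^sub>R axis i 1)) 0)"

definition local_max :: "(real^2 \<Rightarrow> real) \<Rightarrow> real^2 \<Rightarrow> bool" where
  "local_max f x \<longleftrightarrow> (\<forall>\<^sub>F y in nhds x. f y \<le> f x)"

definition local_min :: "(real^2 \<Rightarrow> real) \<Rightarrow> real^2 \<Rightarrow> bool" where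
  "local_min f x \<longleftrightarrow> (\<forall>\<^sub>F y in nhds x. f x \<le> f y)"

text \<open>Throughout, \<open>u\<close> is the real-analytic function on a neighbourhood of \<open>closure \<Omega>\<close> that
  extends the eigenfunction, so at a point of \<open>frontier \<Omega>\<close> its gradient and its local extrema
  are those of the extension.\<close>

definition critical_set :: "(real^2) set \<Rightarrow> (real^2 \<Rightarrow> real) \<Rightarrow> (real^2) set" where
  "critical_set \<Omega> u = {x \<in> closure \<Omega>. grad u x = 0}"

definition maxima :: "(real^2) set \<Rightarrow> (real^2 \<Rightarrow> real) \<Rightarrow> (real^2) set" where
  "maxima \<Omega> u = {x \<in> critical_set \<Omega> u. local_max u x}"

definition minima :: "(real^2) set \<Rightarrow> (real^2 \<Rightarrow> real) \<Rightarrow> (real^2) set" where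
  "minima \<Omega> u = {x \<in> critical_set \<Omega> u. local_min u x}"

definition saddles :: "(real^2) set \<Rightarrow> (real^2 \<Rightarrow> real) \<Rightarrow> (real^2) set" where
  "saddles \<Omega> u = critical_set \<Omega> u - (maxima \<Omega> u \<union> minima \<Omega> u)"

definition integral_curve_in ::
    "(real^2) set \<Rightarrow> (real^2 \<Rightarrow> real^2) \<Rightarrow> real set \<Rightarrow> (real \<Rightarrow> real^2) \<Rightarrow> bool" where
  "integral_curve_in K v I \<gamma> \<longleftrightarrow>
     (\<forall>t\<in>I. \<gamma> t \<in> K \<and> (\<gamma> has_vector_derivative v (\<gamma> t)) (at t within I))"

text \<open>The integral curve through \<open>x\<close> is unique because \<open>grad u\<close> is locally Lipschitz near
  \<open>closure \<Omega>\<close>. It has a limit in infinite time only if it stays in \<open>closure \<Omega>\<close> for that whole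
  half-line; meeting \<open>frontier \<Omega>\<close> does not by itself stop the curve.\<close>

definition stable_set :: "(real^2) set \<Rightarrow> (real^2 \<Rightarrow> real) \<Rightarrow> real^2 \<Rightarrow> (real^2) set" where
  "stable_set \<Omega> u x0 =
     {x \<in> closure \<Omega>. \<exists>\<gamma>. integral_curve_in (closure \<Omega>) (\<lambda>y. - grad u y) {0..} \<gamma> \<and>
                         \<gamma> 0 = x \<and> (\<gamma> \<longlongrightarrow> x0) at_top}"

definition unstable_set :: "(real^2) set \<Rightarrow> (real^2 \<Rightarrow> real) \<Rightarrow> real^2 \<Rightarrow> (real^2) set" where
  "unstable_set \<Omega> u x0 =
     {x \<in> closure \<Omega>. \<exists>\<gamma>. integral_curve_in (closure \<Omega>) (\<lambda>y. - grad u y) {..0} \<gamma> \<and>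
                         \<gamma> 0 = x \<and> (\<gamma> \<longlongrightarrow> x0) at_bot}"

definition flow_set :: "(real^2) set \<Rightarrow> (real^2 \<Rightarrow> real) \<Rightarrow> real^2 \<Rightarrow> (real^2) set" where
  "flow_set \<Omega> u r = stable_set \<Omega> u r \<union> unstable_set \<Omega> u r"

definition neumann_line_set :: "(real^2) set \<Rightarrow> (real^2 \<Rightarrow> real) \<Rightarrow> (real^2) set" where
  "neumann_line_set \<Omega> u =
     closure (\<Union>r\<in>saddles \<Omega> u. frontier (flow_set \<Omega> u r) - frontier \<Omega>) \<union> critical_set \<Omega> u"

definition neumann_domains :: "(real^2) set \<Rightarrow> (real^2 \<Rightarrow> real) \<Rightarrow> (real^2) set set" where
  "neumann_domains \<Omega> u = components (\<Omega> - neumann_line_set \<Omega> u)"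

definition simple_closed_curve :: "(real^2) set \<Rightarrow> bool" where
  "simple_closed_curve \<theta> \<longleftrightarrow>
     (\<exists>g. simple_path g \<and> pathfinish g = pathstart g \<and> path_image g = \<theta>)"

definition curve_of_local_maxima ::
    "(real^2) set \<Rightarrow> (real^2 \<Rightarrow> real) \<Rightarrow> (real^2) set \<Rightarrow> bool" where
  "curve_of_local_maxima \<Omega> u \<theta> \<longleftrightarrow>
     \<theta> \<in> components (maxima \<Omega> u) \<and> simple_closed_curve \<theta>"

end

theory Submission
  imports Defs "HOL-Complex_Analysis.Conformal_Mappings"
begin

text \<open>The Hessian argument breaks down where \<open>u = 0\<close>, so critical zeros are
  treated apart and shown to be isolated. This settles two cases: a local maximum with value 0, and
  a critical point that is not isolated, where \<open>u\<close> is therefore nonzero. Nothing is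
  assumed about the shape of \<open>frontier \<Omega>\<close>, and critical points on it count.
  Hence the equation is continued to a full neighbourhood of each point of
  \<open>closure \<Omega>\<close>, and the only control over trajectories near the frontier is that
  \<open>u = 0\<close> there while \<open>u\<close> strictly increases along a nonconstant
  trajectory. Convergence of gradient trajectories to single points usually rests on the Lojasiewicz
  inequality. It is avoided: a basin only asks that the distance to \<open>C\<close> tends to 0, and
  convergence to a point is needed only for the saddle \<open>q\<close>, which is isolated. The flow
  used is the ascending one, so a point of \<open>unstable_set\<close>, defined by
  \<open>- grad u\<close> and time tending to minus infinity, is a point with a forward
  limit.\<close>

text \<open>The maximum principle gives \<open>u > 0\<close> at every local maximum, and there the Hessian of
  \<open>u\<close> is nonzero because its trace is \<open>- lam * u\<close>. By the analytic implicit function theorem a local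
  maximum is then either an isolated critical point or lies on an arc of critical points on which
  \<open>u\<close> is constant. Hence each component \<open>C\<close> of the set of maxima is a point or a simple closed
  curve, and the points that flow into \<open>C\<close> under \<open>grad u\<close> form an open basin.

  A Neumann domain \<open>D\<close> whose closure meets \<open>C\<close> lies in the basin of \<open>C\<close>. Otherwise take \<open>x\<close> in
  \<open>D\<close> on the boundary of the basin. The ascending trajectory of \<open>x\<close> cannot leave \<open>closure \<Omega>\<close>, since
  nearby points of the basin would leave it too, and no limit point of it is a local maximum, since
  basins of different components are disjoint open sets. So it tends to a saddle \<open>q\<close>, because a
  critical point that is not isolated is an extremum. As \<open>x\<close> is not in the Neumann line set, it is
  interior to \<open>flow_set \<Omega> u q\<close>. Points of the basin near \<open>x\<close> do not ascend to \<open>q\<close>, so they lie in the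
  stable set of \<open>q\<close>, where \<open>u \<ge> u q\<close>; but near \<open>x\<close> we have \<open>u < u q\<close>.

  Two local maxima in \<open>closure D\<close> thus have a common basin, hence a common component.\<close>

section \<open>Simple closed curves as compact one-manifolds\<close>

text \<open>If every \<open>q \<noteq> b\<close> cuts \<open>X\<close>, then each component of \<open>X - {q}\<close> that misses \<open>b\<close> contains a strictly
  smaller one, namely for a point \<open>r\<close> in it; this contradicts the existence of a minimal one.\<close>

lemma exists_noncut_point:
  fixes X :: "'a::heine_borel set"
  assumes X: "compact X" "connected X" and b: "b \<in> X" "X \<noteq> {b}"
  shows "\<exists>q\<in>X. q \<noteq> b \<and> connected (X - {q})"
proof (rule ccontr)
  assume "\<not> (\<exists>q\<in>X. q \<noteq> b \<and> connected (X - {q}))"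
  then have cut: "\<not> connected (X - {q})" if "q \<in> X" "q \<noteq> b" for q
    using that by blast
  define P where "P q S \<longleftrightarrow> q \<in> X \<and> q \<noteq> b \<and> S \<in> components (X - {q}) \<and> b \<notin> S" for q S
  have ex: "\<exists>S. P q S" if q: "q \<in> X" "q \<noteq> b" for q
  proof -
    obtain x y where xy: "x \<in> X - {q}" "y \<in> X - {q}" "\<not> connected_component (X - {q}) x y"
      using cut[OF q] connected_iff_connected_component by blast
    then obtain z where z: "z \<in> X - {q}" "\<not> connected_component (X - {q}) z b"
      by (meson connected_component_sym connected_component_trans)
    have "connected_component_set (X - {q}) z \<in> components (X - {q})"
      using z by (auto simp: components_def)
    then show ?thesis using z q unfolding P_def by blast
  qed
  have con: "connected (X - S)" if "P q S" for q S
    by (rule component_diff_connected[of "{q}" X]) (use that X in \<open>auto simp: P_def\<close>)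
  have cl: "closure S \<subseteq> insert q S" if "P q S" for q S
  proof -
    have S: "S \<subseteq> X" using that in_components_subset unfolding P_def by blast
    then have "closure S \<subseteq> X"
      using X(1) compact_imp_closed closure_minimal by blast
    moreover have "closedin (top_of_set (X - {q})) S"
      using that closedin_component unfolding P_def by blast
    then obtain K where "closed K" "S = (X - {q}) \<inter> K"
      unfolding closedin_closed by blast
    then have "closure S \<subseteq> K" by (simp add: closure_minimal)
    then have "(X - {q}) \<inter> closure S \<subseteq> S" using \<open>S = _\<close> by blast
    ultimately show ?thesis by blast
  qed
  \<comment> \<open>\<open>X - S\<close> is connected, contains \<open>b\<close> and avoids
    \<open>r\<close>. If the component \<open>T\<close> of \<open>X - {r}\<close> met it,
    \<open>T\<close> would contain \<open>b\<close>.\<close>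
  have sub: "insert r T \<subseteq> S" if PS: "P q S" and r: "r \<in> S" and PT: "P r T" for q S r T
  proof -
    have SX: "S \<subseteq> X" using PS in_components_subset unfolding P_def by blast
    have "X - S \<subseteq> X - {r}" using r by blast
    moreover have "b \<in> X - S" using PS b unfolding P_def by blast
    ultimately have "T \<inter> (X - S) = {}"
      using con[OF PS] PT b unfolding P_def
      by (metis components_maximal disjoint_iff in_mono)
    moreover have "T \<subseteq> X" using PT in_components_subset unfolding P_def by blast
    ultimately show ?thesis using r by blast
  qed
  \<comment> \<open>Complements, because Zorn's lemma in this form yields maximal sets and a minimal
    \<open>S\<close> is wanted.\<close>
  define A where "A = {X - S |S q. P q S}"
  have "\<exists>M\<in>A. \<forall>Y\<in>A. M \<subseteq> Y \<longrightarrow> Y = M"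
  proof (rule subset_Zorn)
    fix C assume C: "subset.chain A C"
    have SX: "S \<subseteq> X" if "P q S" for q S using that in_components_subset unfolding P_def by blast
    define F where "F = {S. S \<subseteq> X \<and> X - S \<in> C}"
    have FP: "\<exists>q. P q S" if "S \<in> F" for S
    proof -
      have "X - S \<in> A" using that C unfolding F_def subset_chain_def by blast
      then obtain T q where "P q T" "X - S = X - T" unfolding A_def by blast
      then have "S = T" using that SX unfolding F_def by blast
      then show ?thesis using \<open>P q T\<close> by blast
    qed
    have chF: "S \<subseteq> T \<or> T \<subseteq> S" if "S \<in> F" "T \<in> F" for S T
    proof -
      have "X - S \<in> C" "X - T \<in> C" and ST: "S \<subseteq> X" "T \<subseteq> X" using that unfolding F_def by auto
      then have "X - S \<subseteq> X - T \<or> X - T \<subseteq> X - S"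
        using C unfolding subset_chain_def by metis
      then show ?thesis using ST by (metis Diff_mono double_diff order_refl)
    qed
    have CF: "\<exists>S\<in>F. Y = X - S" if "Y \<in> C" for Y
    proof -
      have "Y \<in> A" using C that unfolding subset_chain_def by blast
      then obtain S q where "P q S" "Y = X - S" unfolding A_def by blast
      then show ?thesis using that SX unfolding F_def by blast
    qed
    obtain q0 where q0: "q0 \<in> X" "q0 \<noteq> b" using b by blast
    obtain S0 where "P q0 S0" using ex[OF q0] by blast
    have "\<exists>T q. P q T \<and> (\<forall>S\<in>F. T \<subseteq> S)"
    proof (cases "\<exists>S\<in>F. \<forall>T\<in>F. S \<subseteq> T")
      case True
      then show ?thesis using FP by meson
    next
      case False
      show ?thesis
      proof (cases "F = {}")
        case True then show ?thesis using \<open>P q0 S0\<close> by blast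
      next
        case F: False
        \<comment> \<open>Without a least member, each \<open>S\<close> in \<open>F\<close> contains
          some \<open>T\<close> in \<open>F\<close> strictly. Its cut point \<open>r\<close> lies in
          \<open>S\<close>, since otherwise the connected set \<open>S\<close> would stay inside one
          component of \<open>X - {r}\<close>, namely \<open>T\<close>. As \<open>closure T\<close>
          adds at most \<open>r\<close>, it stays in \<open>S\<close>.\<close>
        have smaller: "\<exists>T\<in>F. closure T \<subseteq> S" if S: "S \<in> F" for S
        proof -
          obtain T where T: "T \<in> F" "\<not> S \<subseteq> T" using False S by blast
          then have TS: "T \<subset> S" using chF S by blast
          obtain q r where P: "P q S" "P r T" using FP S T by meson
          have "r \<in> S"
          proof (rule ccontr)
            assume "r \<notin> S"
            obtain z where "z \<in> T" using P(2) in_components_nonempty unfolding P_def by blast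
            have "S \<subseteq> X - {r}" using SX[OF P(1)] \<open>r \<notin> S\<close> by blast
            moreover have "connected S" using P(1) in_components_connected unfolding P_def by blast
            ultimately have "S \<subseteq> T"
              using P(2) TS \<open>z \<in> T\<close> unfolding P_def
              by (meson components_maximal disjoint_iff psubsetD)
            then show False using T by blast
          qed
          then have "closure T \<subseteq> S" using cl[OF P(2)] TS by blast
          then show ?thesis using T by blast
        qed
        have "\<Inter>(closure ` F) \<noteq> {}"
        proof (rule compact_chain)
          show "compact Y" if "Y \<in> closure ` F" for Y
          proof -
            obtain S where S: "S \<in> F" "Y = closure S" using \<open>Y \<in> closure ` F\<close> by blast
            then have "bounded S" using X(1) unfolding F_def
              by (auto intro: bounded_subset compact_imp_bounded)
            then show ?thesis using S by (simp add: compact_closure)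
          qed
          show "{} \<notin> closure ` F"
          proof
            assume "{} \<in> closure ` F"
            then have "{} \<in> F" by (metis closure_eq_empty imageE)
            then obtain q where "P q {}" using FP by blast
            then show False using in_components_nonempty unfolding P_def by blast
          qed
          show "S \<subseteq> T \<or> T \<subseteq> S" if "S \<in> closure ` F \<and> T \<in> closure ` F" for S T
            using that chF closure_mono by (metis imageE)
        qed
        then obtain z where z: "\<And>S. S \<in> F \<Longrightarrow> z \<in> closure S" by blast
        \<comment> \<open>Compactness provides the common point \<open>z\<close>. A component of
          \<open>X - {z}\<close> that misses \<open>b\<close> then lies below the whole chain, by
          \<open>sub\<close>.\<close>
        have zS: "z \<in> S" if "S \<in> F" for S using smaller[OF that] z by blast
        obtain S1 q1 where S1: "S1 \<in> F" "P q1 S1" using F FP by blast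
        have "z \<in> X" "z \<noteq> b" using zS[OF S1(1)] SX[OF S1(2)] S1(2) unfolding P_def by blast+
        then obtain T where T: "P z T" using ex by blast
        have "T \<subseteq> S" if "S \<in> F" for S using FP[OF that] sub[OF _ zS[OF that] T] by blast
        then show ?thesis using T by blast
      qed
    qed
    then obtain T q where T: "P q T" "\<And>S. S \<in> F \<Longrightarrow> T \<subseteq> S" by blast
    show "\<exists>U\<in>A. \<forall>Y\<in>C. Y \<subseteq> U"
    proof (intro bexI ballI)
      show "X - T \<in> A" unfolding A_def using T by blast
      show "Y \<subseteq> X - T" if "Y \<in> C" for Y using CF[OF that] T by blast
    qed
  qed
  then obtain M where M: "M \<in> A" "\<And>Y. Y \<in> A \<Longrightarrow> M \<subseteq> Y \<Longrightarrow> Y = M" by blast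
  then obtain S q where S: "P q S" "M = X - S" unfolding A_def by blast
  have SX: "S \<subseteq> X" using S in_components_subset unfolding P_def by blast
  obtain r where r: "r \<in> S" using S in_components_nonempty unfolding P_def by blast
  then have "r \<in> X" "r \<noteq> b" using SX S unfolding P_def by blast+
  then obtain T where T: "P r T" using ex by blast
  have *: "insert r T \<subseteq> S" using sub[OF S(1) r T] .
  have "r \<notin> T" using T in_components_subset unfolding P_def by blast
  have "X - T = M" using M(2)[of "X - T"] * T S unfolding A_def by blast
  then show False using * \<open>r \<notin> T\<close> S \<open>r \<in> X\<close> by blast
qed

text \<open>Read in a chart, the open part of the path is a continuous injection of an open set of
  reals into the reals, and invariance of domain makes its image open. Simplicity gives injectivity
  away from the end parameters, hence the restriction to \<open>0 < t < 1\<close>.\<close>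

lemma simple_path_interior_openin:
  fixes X :: "'a::real_normed_vector set"
  assumes charts: "\<And>p. p \<in> X \<Longrightarrow> \<exists>W. openin (top_of_set X) W \<and> p \<in> W \<and> W homeomorphic (UNIV :: real set)"
    and g: "simple_path g" "path_image g \<subseteq> X" and t: "0 < t" "t < 1"
  shows "\<exists>V. openin (top_of_set X) V \<and> g t \<in> V \<and> V \<subseteq> path_image g"
proof -
  have "g t \<in> X" using g t unfolding path_image_def by auto
  then obtain W where W: "openin (top_of_set X) W" "g t \<in> W" "W homeomorphic (UNIV :: real set)"
    using charts by blast
  then obtain \<psi> \<phi> where h: "homeomorphism W (UNIV :: real set) \<psi> \<phi>"
    unfolding homeomorphic_def by blast
  obtain O' where O': "open O'" "W = X \<inter> O'" using W(1) openin_open by blast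
  define S where "S = {0<..<1} \<inter> g -` O'"
  have gc: "continuous_on {0<..<1} g"
    using g(1) unfolding simple_path_def path_def
    by (meson continuous_on_subset greaterThanLessThan_subseteq_atLeastAtMost_iff order_refl)
  have "open S" unfolding S_def
    by (rule continuous_open_preimage[OF gc _ O'(1)]) simp
  have gS: "g ` S \<subseteq> W"
    using g(2) O'(2) unfolding S_def path_image_def by auto
  have inj: "inj_on g S"
    using g(1) unfolding simple_path_def loop_free_def S_def inj_on_def by force
  have "open ((\<psi> \<circ> g) ` S)"
  proof (rule invariance_of_domain[OF _ \<open>open S\<close>])
    show "continuous_on S (\<psi> \<circ> g)"
    proof (rule continuous_on_compose)
      show "continuous_on S g" using gc continuous_on_subset unfolding S_def by blast
      show "continuous_on (g ` S) \<psi>" using h gS continuous_on_subset unfolding homeomorphism_def by blast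
    qed
    show "inj_on (\<psi> \<circ> g) S"
      by (rule comp_inj_on[OF inj])
        (use gS homeomorphism_apply1[OF h] in \<open>metis inj_on_def subsetD\<close>)
  qed
  then have "openin (top_of_set W) (\<phi> ` ((\<psi> \<circ> g) ` S))"
    using homeomorphism_imp_open_map[OF homeomorphism_symD[OF h], of "(\<psi> \<circ> g) ` S"]
    by (metis open_openin subtopology_UNIV)
  moreover have "\<phi> ` ((\<psi> \<circ> g) ` S) = g ` S"
    proof -
    have "\<phi> ((\<psi> \<circ> g) s) = g s" if "s \<in> S" for s
      using gS homeomorphism_apply1[OF h] that by (metis comp_apply imageI subsetD)
    then show ?thesis by (simp add: image_image)
  qed
  ultimately have "openin (top_of_set X) (g ` S)"
    using W(1) openin_trans by metis
  moreover have "g t \<in> g ` S" using t W(2) O'(2) unfolding S_def by auto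
  moreover have "g ` S \<subseteq> path_image g" unfolding S_def path_image_def by auto
  ultimately show ?thesis by blast
qed

text \<open>Remove a noncut point \<open>q\<close>. The rest is path connected, so the two sides of
  \<open>q\<close> in a chart are joined by an arc avoiding \<open>q\<close>. A piece of this arc,
  closed up by the chart segment through \<open>q\<close>, is a simple loop. Its image is compact,
  and open in \<open>X\<close> by \<open>simple_path_interior_openin\<close>, so it is all of
  \<open>X\<close>.\<close>

lemma compact_connected_one_manifold_simple_closed_curve:
  fixes X :: "'a::euclidean_space set"
  assumes X: "compact X" "connected X" "X \<noteq> {}"
    and charts: "\<And>p. p \<in> X \<Longrightarrow> \<exists>W. openin (top_of_set X) W \<and> p \<in> W \<and> W homeomorphic (UNIV :: real set)"
  shows "\<exists>g. simple_path g \<and> pathfinish g = pathstart g \<and> path_image g = X"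
proof -
  obtain b where b: "b \<in> X" using X by blast
  have "X \<noteq> {b}"
  proof
    assume "X = {b}"
    then obtain W where W: "W \<subseteq> {b}" "b \<in> W" "W homeomorphic (UNIV :: real set)"
      using charts[OF b] openin_imp_subset by blast
    then have "finite W" by (meson finite.emptyI finite_insert finite_subset)
    moreover obtain f :: "'a \<Rightarrow> real" where "f ` W = UNIV"
      using W(3) unfolding homeomorphic_def homeomorphism_def by blast
    ultimately show False using infinite_UNIV_char_0 finite_imageI by metis
  qed
  then obtain q where q: "q \<in> X" "connected (X - {q})"
    using exists_noncut_point[OF X(1,2) b] by metis
  have lpc: "locally path_connected X"
  proof (rule locallyI)
    fix w x assume w: "openin (top_of_set X) w" "x \<in> w"
    then obtain W where W: "openin (top_of_set X) W" "x \<in> W" "W homeomorphic (UNIV :: real set)"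
      using charts openin_imp_subset by blast
    have "locally path_connected W"
      using homeomorphic_locally[OF W(3), of path_connected path_connected]
        homeomorphic_path_connectedness convex_imp_locally_path_connected by blast
    moreover have "openin (top_of_set W) (W \<inter> w)"
      using w W by (metis Int_commute openin_Int openin_imp_subset inf_le1 openin_subset_trans)
    ultimately obtain u v where "openin (top_of_set W) u" "path_connected v" "x \<in> u" "u \<subseteq> v" "v \<subseteq> W \<inter> w"
      using w W by (meson IntI locallyE)
    then show "\<exists>u v. openin (top_of_set X) u \<and> path_connected v \<and> x \<in> u \<and> u \<subseteq> v \<and> v \<subseteq> w"
      using W openin_trans by (metis le_inf_iff)
  qed
  have "openin (top_of_set X) (X - {q})" using openin_delete[of X X q] by simp
  then have "locally path_connected (X - {q})" using lpc locally_open_subset by blast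
  then have pc: "path_connected (X - {q})"
    using q(2) by (simp add: path_connected_component connected_iff_connected_component
        path_component_eq_connected_component)
  obtain W where W: "openin (top_of_set X) W" "q \<in> W" "W homeomorphic (UNIV :: real set)"
    using charts q by blast
  then obtain \<psi> \<phi> where h: "homeomorphism W (UNIV :: real set) \<psi> \<phi>"
    unfolding homeomorphic_def by blast
  define c where "c = \<psi> q"
  have \<phi>c: "\<phi> c = q" unfolding c_def using homeomorphism_apply1[OF h W(2)] .
  have \<psi>\<phi>: "\<psi> (\<phi> s) = s" for s using homeomorphism_apply2[OF h] by simp
  have inj: "\<phi> s = \<phi> s' \<longleftrightarrow> s = s'" for s s' using \<psi>\<phi> by metis
  have \<phi>cont: "continuous_on S \<phi>" for S
    using homeomorphism_cont2[OF h] continuous_on_subset by blast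
  have \<phi>W: "\<phi> s \<in> W" for s using homeomorphism_image2[OF h] by blast
  have WX: "W \<subseteq> X" using W(1) openin_imp_subset by blast
  have "\<phi> (c - 1) \<in> X - {q}" "\<phi> (c + 1) \<in> X - {q}" "\<phi> (c - 1) \<noteq> \<phi> (c + 1)"
    using \<phi>W WX \<phi>c inj by (auto simp flip: \<phi>c)
  then obtain \<alpha> where \<alpha>: "arc \<alpha>" "path_image \<alpha> \<subseteq> X - {q}" "pathstart \<alpha> = \<phi> (c - 1)" "pathfinish \<alpha> = \<phi> (c + 1)"
    using pc unfolding path_connected_arcwise by meson
  have \<alpha>cont: "continuous_on {0..1} \<alpha>" using \<alpha>(1) unfolding arc_def path_def by blast
  have \<alpha>q: "\<alpha> t \<noteq> q" if "t \<in> {0..1}" for t using \<alpha>(2) that unfolding path_image_def by blast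
  have clos: "compact ({s..1} \<inter> \<alpha> -` (\<phi> ` {a..b}))" if "0 \<le> s" for s a b
  proof -
    have "closed (\<phi> ` {a..b})"
      using \<phi>cont compact_continuous_image compact_imp_closed compact_Icc by blast
    moreover have "continuous_on {s..1} \<alpha>" using \<alpha>cont that continuous_on_subset
      by (metis atLeastatMost_subset_iff order_refl)
    ultimately have "closed ({s..1} \<inter> \<alpha> -` (\<phi> ` {a..b}))"
      by (simp add: continuous_closed_preimage)
    then show ?thesis by (metis compact_Icc compact_Int_closed inf.left_idem)
  qed
  \<comment> \<open>\<open>t0\<close> is the last visit of the arc to the left half of the chart
    segment and \<open>t1\<close> the first later visit to the right half. Between them the arc
    avoids the segment, which makes the loop simple.\<close>
  obtain t0 where t0: "t0 \<in> {0..1} \<inter> \<alpha> -` (\<phi> ` {c-1..c})"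
    and t0max: "\<And>t. t \<in> {0..1} \<inter> \<alpha> -` (\<phi> ` {c-1..c}) \<Longrightarrow> t \<le> t0"
  proof -
    have "0 \<in> {0..1} \<inter> \<alpha> -` (\<phi> ` {c-1..c})"
      using \<alpha>(3) unfolding pathstart_def by auto
    then show ?thesis using compact_attains_sup[OF clos[of 0 "c-1" c]] that by blast
  qed
  obtain t1 where t1: "t1 \<in> {t0..1} \<inter> \<alpha> -` (\<phi> ` {c..c+1})"
    and t1min: "\<And>t. t \<in> {t0..1} \<inter> \<alpha> -` (\<phi> ` {c..c+1}) \<Longrightarrow> t1 \<le> t"
  proof -
    have "1 \<in> {t0..1} \<inter> \<alpha> -` (\<phi> ` {c..c+1})"
      using \<alpha>(4) t0 unfolding pathfinish_def by auto
    moreover have "compact ({t0..1} \<inter> \<alpha> -` (\<phi> ` {c..c+1}))" using clos[of t0 c "c+1"] t0 by simp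
    ultimately obtain t where "t \<in> {t0..1} \<inter> \<alpha> -` (\<phi> ` {c..c+1})"
      "\<forall>s\<in>{t0..1} \<inter> \<alpha> -` (\<phi> ` {c..c+1}). t \<le> s"
      using compact_attains_inf[of "{t0..1} \<inter> \<alpha> -` (\<phi> ` {c..c+1})"] by (metis empty_iff)
    then show ?thesis using that by metis
  qed
  obtain a0 where a0: "a0 \<in> {c-1..c}" "\<alpha> t0 = \<phi> a0" using t0 by blast
  obtain a1 where a1: "a1 \<in> {c..c+1}" "\<alpha> t1 = \<phi> a1" using t1 by blast
  have "a0 \<noteq> c" using a0 \<alpha>q t0 \<phi>c by auto
  then have a0c: "a0 < c" using a0 by auto
  have "a1 \<noteq> c" using a1 \<alpha>q[of t1] t0 t1 \<phi>c by auto
  then have a1c: "c < a1" using a1 by auto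
  have "t0 \<noteq> t1" using a0 a1 a0c a1c inj by force
  then have t01: "t0 < t1" using t1 by auto
  define g1 where "g1 = subpath t0 t1 \<alpha>"
  define g2 where "g2 = \<phi> \<circ> (linepath a1 a0)"
  have g1: "arc g1" unfolding g1_def using \<alpha>(1) t0 t1 t01
    by (simp add: arc_subpath_arc)
  have g2: "arc g2" unfolding g2_def arc_def path_def
  proof (intro conjI continuous_on_compose \<phi>cont)
    show "inj_on (\<phi> \<circ> linepath a1 a0) {0..1}"
    proof (rule inj_onI)
      fix s t assume "(\<phi> \<circ> linepath a1 a0) s = (\<phi> \<circ> linepath a1 a0) t"
      then have "linepath a1 a0 s = linepath a1 a0 t" using inj by simp
      then have "(s - t) * (a0 - a1) = 0" by (simp add: linepath_def algebra_simps)
      then show "s = t" using a0c a1c by simp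
    qed
  qed auto
  have im1: "path_image g1 = \<alpha> ` {t0..t1}"
    unfolding g1_def using t01 by (simp add: path_image_subpath)
  have im2: "path_image g2 = \<phi> ` {a0..a1}"
    unfolding g2_def using a0c a1c
    by (simp add: path_image_compose closed_segment_eq_real_ivl)
  have ends: "pathstart g1 = \<alpha> t0" "pathfinish g1 = \<alpha> t1" "pathstart g2 = \<phi> a1" "pathfinish g2 = \<phi> a0"
    unfolding g1_def g2_def by (auto simp: pathstart_compose pathfinish_compose)
  define g where "g = g1 +++ g2"
  have "simple_path g" unfolding g_def
  proof (rule simple_path_join_loop[OF g1 g2])
    show "path_image g1 \<inter> path_image g2 \<subseteq> {pathstart g1, pathstart g2}"
    proof
      fix x assume x: "x \<in> path_image g1 \<inter> path_image g2"
      then obtain t where t: "t \<in> {t0..t1}" "x = \<alpha> t" using im1 by blast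
      obtain s where s: "s \<in> {a0..a1}" "x = \<phi> s" using x im2 by blast
      have t': "t \<in> {0..1}" "t \<in> {t0..1}" using t t0 t1 by auto
      have "t = t0 \<or> t = t1"
      proof (cases "s \<le> c")
        case True
        then have "s \<in> {c-1..c}" using s a0 by auto
        then have "\<alpha> t \<in> \<phi> ` {c-1..c}" using t s by (metis imageI)
        then have "t \<le> t0" using t0max[of t] t' by blast
        then show ?thesis using t by auto
      next
        case False
        then have "s \<in> {c..c+1}" using s a1 by auto
        then have "\<alpha> t \<in> \<phi> ` {c..c+1}" using t s by (metis imageI)
        then have "t1 \<le> t" using t1min[of t] t' by blast
        then show ?thesis using t by auto
      qed
      then show "x \<in> {pathstart g1, pathstart g2}" using t ends a1 by auto
    qed
  qed (use ends a0 a1 in auto)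
  have closed: "pathfinish g = pathstart g" unfolding g_def using ends a0 by simp
  have gX: "path_image g \<subseteq> X"
  proof -
    have "{t0..t1} \<subseteq> {0..1}" using t0 t1 by auto
    then have "path_image g1 \<subseteq> path_image \<alpha>" unfolding im1 unfolding path_image_def by (rule image_mono)
    moreover have "path_image g2 \<subseteq> W" unfolding im2 using \<phi>W by blast
    ultimately show ?thesis unfolding g_def
      using path_image_join_subset[of g1 g2] \<alpha>(2) WX by blast
  qed
  \<comment> \<open>Shifting the parameter by \<open>1/2\<close> turns the base point of the loop
    into an interior parameter.\<close>
  have sp: "simple_path (shiftpath (1/2) g)" "path_image (shiftpath (1/2) g) = path_image g"
    using \<open>simple_path g\<close> closed by (simp_all add: simple_path_shiftpath path_image_shiftpath)
  have "openin (top_of_set X) (path_image g)"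
    unfolding openin_subopen[of _ "path_image g"]
  proof
    fix z assume "z \<in> path_image g"
    then obtain t where t: "t \<in> {0..1}" "z = g t" unfolding path_image_def by blast
    show "\<exists>T. openin (top_of_set X) T \<and> z \<in> T \<and> T \<subseteq> path_image g"
    proof (cases "0 < t \<and> t < 1")
      case True
      then show ?thesis using simple_path_interior_openin[OF charts \<open>simple_path g\<close> gX] t by blast
    next
      case False
      then have "t = 0 \<or> t = 1" using t by auto
      then have "z = g 1" using t closed unfolding pathstart_def pathfinish_def by auto
      then have "z = shiftpath (1/2) g (1/2)" unfolding shiftpath_def by simp
      then show ?thesis
        using simple_path_interior_openin[OF charts sp(1), of "1/2"] sp(2) gX by auto
    qed
  qed
  moreover have "closedin (top_of_set X) (path_image g)"
    using gX \<open>simple_path g\<close> closed_path_image closed_subset simple_path_imp_path by blast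
  moreover have "path_image g \<noteq> {}" by simp
  ultimately have "path_image g = X" using X(2) connected_clopen by blast
  then show ?thesis using \<open>simple_path g\<close> closed by blast
qed

section \<open>The flow of a Lipschitz vector field\<close>

text \<open>Only forward time is considered. That trajectories never merge, which reversibility
  would give, comes instead from the lower bound in
  \<open>forward_solution_gronwall\<close>.\<close>

definition forward_solution :: "('a::real_normed_vector \<Rightarrow> 'a) \<Rightarrow> (real \<Rightarrow> 'a) \<Rightarrow> bool" where
  "forward_solution V y \<longleftrightarrow> (\<forall>t\<ge>0. (y has_vector_derivative V (y t)) (at t within {0..}))"

lemma forward_solution_at:
  assumes "forward_solution V y" "0 < t"
  shows "(y has_vector_derivative V (y t)) (at t)"
proof -
  have "at t within {0..} = at t"
    by (rule at_within_open_subset[of _ "{0<..}"]) (use assms in auto)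
  then show ?thesis using assms unfolding forward_solution_def by (metis less_imp_le)
qed

lemma forward_solution_continuous:
  assumes "forward_solution V y"
  shows "continuous_on {0..} y"
  using assms unfolding forward_solution_def continuous_on_eq_continuous_within
  by (auto intro: has_vector_derivative_continuous)

text \<open>The squared distance \<open>w\<close> satisfies
  \<open>\<bar>w'\<bar> \<le> 2 * L * w\<close>. Hence \<open>exp (2 * L * s) * w s\<close>
  increases and \<open>exp (- (2 * L) * s) * w s\<close> decreases. The square keeps
  \<open>w\<close> differentiable even where the solutions meet.\<close>

lemma forward_solution_gronwall:
  fixes V :: "'a::real_inner \<Rightarrow> 'a"
  assumes V: "L-lipschitz_on UNIV V" and y: "forward_solution V y" and z: "forward_solution V z" and t: "0 \<le> t"
  shows "dist (y t) (z t) \<le> exp (L * t) * dist (y 0) (z 0)"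
    and "exp (- L * t) * dist (y 0) (z 0) \<le> dist (y t) (z t)"
proof -
  define w where "w s = (y s - z s) \<bullet> (y s - z s)" for s
  define w' where "w' s = 2 * ((y s - z s) \<bullet> (V (y s) - V (z s)))" for s
  have w': "(w has_real_derivative w' s) (at s)" if "0 < s" for s
    using forward_solution_at[OF y that] forward_solution_at[OF z that]
    unfolding w_def w'_def has_real_derivative_iff_has_vector_derivative has_vector_derivative_def
    by (auto intro!: derivative_eq_intros simp: algebra_simps inner_commute)
  have bound: "\<bar>w' s\<bar> \<le> 2 * L * w s" for s
  proof -
    have "norm (V (y s) - V (z s)) \<le> L * norm (y s - z s)"
      using lipschitz_onD[OF V, of "y s" "z s"] by (simp add: dist_norm)
    then have "norm (y s - z s) * norm (V (y s) - V (z s)) \<le> norm (y s - z s) * (L * norm (y s - z s))"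
      by (rule mult_left_mono) simp
    then have "\<bar>(y s - z s) \<bullet> (V (y s) - V (z s))\<bar> \<le> L * (norm (y s - z s) * norm (y s - z s))"
      using Cauchy_Schwarz_ineq2[of "y s - z s" "V (y s) - V (z s)"] by (simp add: mult.left_commute)
    then show ?thesis
      unfolding w_def w'_def by (simp add: abs_mult power2_norm_eq_inner[symmetric] power2_eq_square)
  qed
  have wc: "continuous_on {0..t} w"
    unfolding w_def using forward_solution_continuous[OF y] forward_solution_continuous[OF z]
    by (intro continuous_intros) (auto elim: continuous_on_subset)
  have mono: "w 0 \<le> exp (2 * L * t) * w t"
  proof -
    have "exp (2 * L * 0) * w 0 \<le> exp (2 * L * t) * w t"
    proof (rule DERIV_nonneg_imp_increasing_open[OF t])
      fix s assume s: "0 < s" "s < t"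
      have "((\<lambda>s. exp (2 * L * s) * w s) has_real_derivative
          exp (2 * L * s) * (2 * L) * w s + exp (2 * L * s) * w' s) (at s)"
        using w'[OF s(1)] by (auto intro!: derivative_eq_intros)
      moreover have "0 \<le> exp (2 * L * s) * (2 * L * w s + w' s)"
        using bound[of s] by (intro mult_nonneg_nonneg) (auto simp: abs_le_iff)
      ultimately show "\<exists>D. ((\<lambda>s. exp (2 * L * s) * w s) has_real_derivative D) (at s) \<and> 0 \<le> D"
        by (auto simp: algebra_simps)
    qed (intro continuous_intros wc)
    then show ?thesis by simp
  qed
  have anti: "exp (- (2 * L) * t) * w t \<le> w 0"
  proof -
    have "exp (- (2 * L) * t) * w t \<le> exp (- (2 * L) * 0) * w 0"
    proof (rule DERIV_nonpos_imp_decreasing_open[OF t])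
      fix s assume s: "0 < s" "s < t"
      have "((\<lambda>s. exp (- (2 * L) * s) * w s) has_real_derivative
          exp (- (2 * L) * s) * (- (2 * L)) * w s + exp (- (2 * L) * s) * w' s) (at s)"
        using w'[OF s(1)] by (auto intro!: derivative_eq_intros)
      moreover have "0 \<le> exp (- (2 * L) * s) * (2 * L * w s - w' s)"
        using bound[of s] by (intro mult_nonneg_nonneg) (auto simp: abs_le_iff)
      ultimately show "\<exists>D. ((\<lambda>s. exp (- (2 * L) * s) * w s) has_real_derivative D) (at s) \<and> D \<le> 0"
        by (auto simp: algebra_simps)
    qed (intro continuous_intros wc)
    then show ?thesis by simp
  qed
  have e2: "exp (2 * L * t) = (exp (L * t))\<^sup>2" by (simp add: exp_double[symmetric] mult.assoc)
  have d: "w s = (dist (y s) (z s))\<^sup>2" for s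
    unfolding w_def by (simp add: dist_norm power2_norm_eq_inner)
  have "w t \<le> exp (2 * L * t) * w 0"
    using anti by (simp add: exp_minus field_simps)
  then have "(dist (y t) (z t))\<^sup>2 \<le> (exp (L * t) * dist (y 0) (z 0))\<^sup>2"
    unfolding d e2 by (simp add: power_mult_distrib)
  then show "dist (y t) (z t) \<le> exp (L * t) * dist (y 0) (z 0)"
    by (rule power2_le_imp_le) simp
  have "(dist (y 0) (z 0))\<^sup>2 \<le> (exp (L * t) * dist (y t) (z t))\<^sup>2"
    using mono unfolding d e2 by (simp add: power_mult_distrib)
  then have "dist (y 0) (z 0) \<le> exp (L * t) * dist (y t) (z t)"
    by (rule power2_le_imp_le) simp
  then show "exp (- L * t) * dist (y 0) (z 0) \<le> dist (y t) (z t)"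
    by (simp add: exp_minus field_simps)
qed

text \<open>Picard iteration. The factorial bound on successive differences is summable on every
  interval \<open>{0..T}\<close>, so the limit is a solution for all forward time at once and no
  local solutions have to be glued.\<close>

lemma forward_solution_exists:
  fixes V :: "'a::euclidean_space \<Rightarrow> 'a"
  assumes "L0-lipschitz_on UNIV V"
  shows "\<exists>y. y 0 = x \<and> forward_solution V y"
proof -
  \<comment> \<open>Enlarged so that division by \<open>L\<close> is possible.\<close>
  define L where "L = max L0 1"
  have V: "L-lipschitz_on UNIV V" and L: "L > 0"
    unfolding L_def using lipschitz_on_mono[OF assms order_refl, of "max L0 1"] by auto
  have Vc: "continuous_on S V" for S
    using lipschitz_on_continuous_on[OF V] continuous_on_subset by blast
  have Vd: "norm (V a - V b) \<le> L * norm (a - b)" for a b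
    using lipschitz_onD[OF V, of a b] by (simp add: dist_norm)
  define Y where "Y = rec_nat (\<lambda>t::real. x) (\<lambda>n f t. x + integral {0..t} (\<lambda>s. V (f s)))"
  have Y0: "Y 0 t = x" and YS: "Y (Suc n) t = x + integral {0..t} (\<lambda>s. V (Y n s))" for n t
    unfolding Y_def by simp_all
  have Yc: "continuous_on {0..T} (Y n)" for T n
  proof (induction n)
    case 0 then show ?case unfolding Y_def by simp
  next
    case (Suc n)
    have "continuous_on {0..T} (\<lambda>s. V (Y n s))"
      using continuous_on_compose2[OF Vc[of UNIV] Suc] by simp
    then have "(\<lambda>s. V (Y n s)) integrable_on {0..T}" by (rule integrable_continuous_real)
    then show ?case unfolding YS[abs_def]
      by (intro continuous_intros indefinite_integral_continuous_1)
  qed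
  have VYc: "continuous_on {0..T} (\<lambda>s. V (Y n s))" for T n
    using continuous_on_compose2[OF Vc[of UNIV] Yc] by auto
  define M where "M = norm (V x) / L"
  \<comment> \<open>Chosen so that integrating \<open>L * b n\<close> from 0 gives exactly
    \<open>b (Suc n)\<close>, while \<open>b 0 t = norm (V x) * t\<close> is the size of the first
    Picard step.\<close>
  define b where "b n t = M * (L * t) ^ Suc n / fact (Suc n)" for n t
  have M: "0 \<le> M" unfolding M_def using L by simp
  have bint: "((\<lambda>s. L * b n s) has_integral b (Suc n) t) {0..t}" if "0 \<le> t" for n t
  proof -
    have "((\<lambda>s. L * b n s) has_integral b (Suc n) t - b (Suc n) 0) {0..t}"
    proof (rule fundamental_theorem_of_calculus[OF that])
      fix s :: real
      have "(b (Suc n) has_real_derivative (L * b n s)) (at s within {0..t})"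
      proof -
        have "((\<lambda>s. (L * s) ^ Suc (Suc n)) has_real_derivative real (Suc (Suc n)) * (L * s) ^ Suc n * L)
            (at s within {0..t})"
          by (auto intro!: derivative_eq_intros simp del: power_Suc of_nat_Suc)
        then have "((\<lambda>s. M / fact (Suc (Suc n)) * (L * s) ^ Suc (Suc n)) has_real_derivative
            M / fact (Suc (Suc n)) * (real (Suc (Suc n)) * (L * s) ^ Suc n * L)) (at s within {0..t})"
          by (rule DERIV_cmult)
        moreover have "fact (Suc (Suc n)) = real (Suc (Suc n)) * fact (Suc n)" by (rule fact_Suc)
        then have "M / fact (Suc (Suc n)) * (real (Suc (Suc n)) * (L * s) ^ Suc n * L) = L * b n s"
          unfolding b_def by (simp del: fact_Suc power_Suc of_nat_Suc)
        moreover have "b (Suc n) = (\<lambda>s. M / fact (Suc (Suc n)) * (L * s) ^ Suc (Suc n))"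
          unfolding b_def by (simp add: fun_eq_iff)
        ultimately show ?thesis by simp
      qed
      then show "(b (Suc n) has_vector_derivative L * b n s) (at s within {0..t})"
        by (simp add: has_real_derivative_iff_has_vector_derivative)
    qed
    then show ?thesis by (simp add: b_def)
  qed
  have step: "norm (Y (Suc n) t - Y n t) \<le> b n t" if "0 \<le> t" for n t
    using that
  proof (induction n arbitrary: t)
    case 0
    then show ?case using L by (simp add: YS Y0 b_def M_def)
  next
    case (Suc n)
    have "Y (Suc (Suc n)) t - Y (Suc n) t
        = integral {0..t} (\<lambda>s. V (Y (Suc n) s) - V (Y n s))"
      unfolding YS[of "Suc n" t] YS[of n t] add_diff_cancel_left
      by (rule integral_diff[symmetric]; intro integrable_continuous_real VYc)
    also have "norm \<dots> \<le> integral {0..t} (\<lambda>s. L * b n s)"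
    proof (rule integral_norm_bound_integral)
      show "(\<lambda>s. V (Y (Suc n) s) - V (Y n s)) integrable_on {0..t}"
        by (intro integrable_continuous_real continuous_intros VYc)
      show "(\<lambda>s. L * b n s) integrable_on {0..t}" using bint[OF Suc.prems] by blast
      fix s assume "s \<in> {0..t}"
      then have "norm (Y (Suc n) s - Y n s) \<le> b n s" using Suc.IH by simp
      then show "norm (V (Y (Suc n) s) - V (Y n s)) \<le> L * b n s"
        using Vd[of "Y (Suc n) s" "Y n s"] L
        by (meson mult_left_mono order_trans less_imp_le)
    qed
    also have "\<dots> = b (Suc n) t" using bint[OF Suc.prems] by blast
    finally show ?case .
  qed
  define y where "y t = x + (\<Sum>n. Y (Suc n) t - Y n t)" for t
  have unif: "uniform_limit {0..T} Y y sequentially" for T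
  proof -
    have *: "uniform_limit {0..T} (\<lambda>n t. \<Sum>i<n. Y (Suc i) t - Y i t) (\<lambda>t. \<Sum>i. Y (Suc i) t - Y i t) sequentially"
    proof (rule Weierstrass_m_test)
      fix n t assume t: "t \<in> {0..T}"
      have "(L * t) ^ Suc n \<le> (L * T) ^ Suc n"
        using t L by (intro power_mono) auto
      then have "b n t \<le> b n T" unfolding b_def
        using M by (intro divide_right_mono mult_left_mono) auto
      then show "norm (Y (Suc n) t - Y n t) \<le> b n T"
        using step[of t n] t by auto
    next
      have "summable (\<lambda>n. inverse (fact n) * (L * T) ^ n)" by (rule summable_exp)
      then have "summable (\<lambda>n. inverse (fact (Suc n)) * (L * T) ^ Suc n)"
        by (subst summable_Suc_iff[of "\<lambda>n. inverse (fact n) * (L * T) ^ n"])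
      then have "summable (\<lambda>n. M * (inverse (fact (Suc n)) * (L * T) ^ Suc n))"
        by (rule summable_mult)
      then show "summable (\<lambda>n. b n T)"
        unfolding b_def divide_inverse by (simp only: mult.assoc mult.commute mult.left_commute)
    qed
    have "(\<Sum>i<n. Y (Suc i) t - Y i t) = Y n t - x" for n t
      using sum_lessThan_telescope[of "\<lambda>i. Y i t" n] Y0 by simp
    then have "uniform_limit {0..T} (\<lambda>n t. x + (Y n t - x)) (\<lambda>t. x + (\<Sum>i. Y (Suc i) t - Y i t)) sequentially"
      using uniform_limit_add[OF uniform_limit_const[of "\<lambda>_. x" "{0..T}"] *] by simp
    then show ?thesis unfolding y_def[abs_def] by simp
  qed
  have yc: "continuous_on {0..T} y" for T
    by (rule uniform_limit_theorem[OF _ unif]) (auto intro!: always_eventually Yc)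
  have yeq: "y t = x + integral {0..t} (\<lambda>s. V (y s))" if "0 \<le> t" for t
  proof -
    have "uniform_limit {0..t} (\<lambda>n s. V (Y n s)) (\<lambda>s. V (y s)) sequentially"
    proof (rule uniform_limitI)
      fix e :: real assume "e > 0"
      then have "\<forall>\<^sub>F n in sequentially. \<forall>s\<in>{0..t}. dist (Y n s) (y s) < e / L"
        using uniform_limitD[OF unif] L by simp
      then show "\<forall>\<^sub>F n in sequentially. \<forall>s\<in>{0..t}. dist (V (Y n s)) (V (y s)) < e"
      proof eventually_elim
        case (elim n)
        show ?case
        proof
          fix s assume "s \<in> {0..t}"
          then have "L * dist (Y n s) (y s) < e" using elim L by (simp add: field_simps)
          then show "dist (V (Y n s)) (V (y s)) < e"
            using lipschitz_onD[OF V, of "Y n s" "y s"] by simp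
        qed
      qed
    qed
    then obtain I J where I: "\<And>n. ((\<lambda>s. V (Y n s)) has_integral I n) {0..t}"
      and J: "((\<lambda>s. V (y s)) has_integral J) {0..t}" and IJ: "I \<longlonglongrightarrow> J"
      using uniform_limit_integral[where f = "\<lambda>n s. V (Y n s)" and F = sequentially] VYc
      by (metis trivial_limit_sequentially)
    have "Y (Suc n) t = x + I n" for n using I YS by (metis integral_unique)
    then have "(\<lambda>n. Y (Suc n) t) \<longlonglongrightarrow> x + J" using IJ by (auto intro: tendsto_intros)
    moreover have "(\<lambda>n. Y (Suc n) t) \<longlonglongrightarrow> y t"
      using tendsto_uniform_limitI[OF unif, of t t] that LIMSEQ_Suc by fastforce
    ultimately show ?thesis using J LIMSEQ_unique by (metis integral_unique)
  qed
  have "forward_solution V y" unfolding forward_solution_def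
  proof (intro allI impI)
    fix t :: real assume t: "0 \<le> t"
    have Vyc: "continuous_on {0..t+1} (\<lambda>s. V (y s))"
      using continuous_on_compose2[OF Vc[of UNIV] yc] by auto
    have "((\<lambda>r. x + integral {0..r} (\<lambda>s. V (y s))) has_vector_derivative V (y t)) (at t within {0..t+1})"
      using integral_has_vector_derivative[OF Vyc, of t] t
      by (auto intro!: derivative_eq_intros)
    then have "(y has_vector_derivative V (y t)) (at t within {0..t+1})"
      by (rule has_vector_derivative_transform[rotated 2]) (use t yeq in auto)
    moreover have "at t within {0..t+1} = at t within {0..}"
      by (rule at_within_nhd[of t "{..<t+1}"]) (use t in auto)
    ultimately show "(y has_vector_derivative V (y t)) (at t within {0..})" by simp
  qed
  moreover have "y 0 = x" using yeq[of 0] by simp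
  ultimately show ?thesis by blast
qed

section \<open>The semiflow of a globally Lipschitz field\<close>

definition flow :: "('a::real_normed_vector \<Rightarrow> 'a) \<Rightarrow> 'a \<Rightarrow> real \<Rightarrow> 'a" where
  "flow V x = (SOME y. y 0 = x \<and> forward_solution V y)"

locale lipschitz_flow =
  fixes V :: "'a::euclidean_space \<Rightarrow> 'a" and L :: real
  assumes lipschitz: "L-lipschitz_on UNIV V"
begin

lemma flow_0 [simp]: "flow V x 0 = x"
  and flow_solution: "forward_solution V (flow V x)"
  using someI_ex[OF forward_solution_exists[OF lipschitz, of x]] unfolding flow_def by auto

lemma flow_unique:
  assumes "forward_solution V y" "0 \<le> t"
  shows "y t = flow V (y 0) t"
  using forward_solution_gronwall(1)[OF lipschitz assms(1) flow_solution assms(2), of "y 0"] by simp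

lemma flow_continuous_time: "continuous_on {0..} (flow V x)"
  using forward_solution_continuous[OF flow_solution] .

lemma flow_dist_le: "0 \<le> t \<Longrightarrow> dist (flow V x t) (flow V y t) \<le> exp (L * t) * dist x y"
  using forward_solution_gronwall(1)[OF lipschitz flow_solution flow_solution] by simp

lemma flow_dist_ge: "0 \<le> t \<Longrightarrow> exp (- L * t) * dist x y \<le> dist (flow V x t) (flow V y t)"
  using forward_solution_gronwall(2)[OF lipschitz flow_solution flow_solution] by (metis flow_0)

lemma flow_continuous:
  assumes "0 \<le> t"
  shows "continuous_on UNIV (\<lambda>x. flow V x t)"
proof -
  have "(exp (L * t))-lipschitz_on UNIV (\<lambda>x. flow V x t)"
    by (rule lipschitz_onI) (use flow_dist_le[OF assms] in auto)
  then show ?thesis by (rule lipschitz_on_continuous_on)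
qed

lemma flow_add:
  assumes "0 \<le> s" "0 \<le> t"
  shows "flow V x (s + t) = flow V (flow V x s) t"
proof -
  have "forward_solution V (\<lambda>r. flow V x (s + r))"
    unfolding forward_solution_def
  proof (intro allI impI)
    fix r :: real assume r: "0 \<le> r"
    have "(flow V x has_vector_derivative V (flow V x (s + r))) (at (s + r) within (+) s ` {0..})"
      using flow_solution[of x] r assms(1) unfolding forward_solution_def
      by (meson add_nonneg_nonneg has_vector_derivative_within_subset image_subsetI atLeast_iff)
    moreover have "((+) s has_vector_derivative 1) (at r within {0..})"
      by (auto intro!: derivative_eq_intros)
    ultimately have "((flow V x \<circ> (+) s) has_vector_derivative 1 *\<^sub>R V (flow V x (s + r))) (at r within {0..})"
      by (rule vector_diff_chain_within[rotated])
    then show "((\<lambda>r. flow V x (s + r)) has_vector_derivative V (flow V x (s + r))) (at r within {0..})"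
      by (simp add: o_def)
  qed
  from flow_unique[OF this assms(2)] show ?thesis by simp
qed

lemma flow_stationary:
  assumes "V x = 0" "0 \<le> t"
  shows "flow V x t = x"
proof -
  have "forward_solution V (\<lambda>t. x)" unfolding forward_solution_def using assms by simp
  from flow_unique[OF this assms(2)] show ?thesis by simp
qed

end

section \<open>Double power series\<close>

abbreviation abs_summable :: "('a \<Rightarrow> 'b::real_normed_vector) \<Rightarrow> bool" where
  "abs_summable f \<equiv> (\<lambda>x. norm (f x)) summable_on UNIV"

text \<open>The tails of \<open>B\<close> make the series of derivatives converge uniformly as
  linear maps, which justifies differentiation term by term. Double series enter it after
  enumeration by \<open>prod_decode\<close>.\<close>

lemma has_derivative_sums_M_test:
  fixes f :: "nat \<Rightarrow> 'a::real_normed_vector \<Rightarrow> 'b::banach"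
    and f' :: "nat \<Rightarrow> 'a \<Rightarrow> 'a \<Rightarrow> 'b" and g :: "'a \<Rightarrow> 'b" and g' :: "'a \<Rightarrow> 'a \<Rightarrow> 'b"
    and S :: "'a set" and x :: 'a and B :: "nat \<Rightarrow> real"
  assumes S: "convex S" "x \<in> S"
    and f: "\<And>n (x::'a). x \<in> S \<Longrightarrow> (f n has_derivative f' n x) (at x within S)"
    and B: "summable B" "\<And>n x h. x \<in> S \<Longrightarrow> norm (f' n x h) \<le> B n * norm h"
    and g: "\<And>x. x \<in> S \<Longrightarrow> (\<lambda>n. f n x) sums g x"
    and g': "\<And>x (h::'a). x \<in> S \<Longrightarrow> (\<lambda>n. f' n x h) sums g' x h"
  shows "(g has_derivative g' x) (at x within S)"
proof -
  have "\<exists>G. \<forall>x\<in>S. (\<lambda>n. f n x) sums G x \<and> (G has_derivative g' x) (at x within S)"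
  proof (rule has_derivative_series[OF S(1) f _ S(2) g[OF S(2)]])
    fix e :: real assume "e > 0"
    then obtain N where N: "\<And>n. n \<ge> N \<Longrightarrow> norm (\<Sum>i. B (i + n)) < e"
      using suminf_exist_split[OF _ B(1)] by blast
    show "\<forall>\<^sub>F n in sequentially. \<forall>x\<in>S. \<forall>h. norm (sum (\<lambda>i. f' i x h) {..<n} - g' x h) \<le> e * norm h"
      unfolding eventually_sequentially
    proof (intro exI allI impI ballI)
      fix n x and h :: 'a assume n: "N \<le> n" and x: "x \<in> S"
      have Bn: "summable (\<lambda>i. B (i + n) * norm h)"
        using summable_ignore_initial_segment[OF B(1)] by (rule summable_mult2)
      have "g' x h - sum (\<lambda>i. f' i x h) {..<n} = (\<Sum>i. f' (i + n) x h)"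
        using suminf_minus_initial_segment[of "\<lambda>i. f' i x h" n] g'[OF x, of h]
        by (simp add: sums_iff)
      also have "norm \<dots> \<le> (\<Sum>i. B (i + n) * norm h)"
        by (rule norm_suminf_le[OF B(2)[OF x] Bn])
      also have "\<dots> = (\<Sum>i. B (i + n)) * norm h"
        by (rule suminf_mult2[symmetric]) (rule summable_ignore_initial_segment[OF B(1)])
      also have "\<dots> \<le> e * norm h"
        using N[OF n] by (intro mult_right_mono) auto
      finally show "norm (sum (\<lambda>i. f' i x h) {..<n} - g' x h) \<le> e * norm h"
        by (simp add: norm_minus_commute)
    qed
  qed
  then obtain G where G: "\<And>x. x \<in> S \<Longrightarrow> (\<lambda>n. f n x) sums G x"
    "\<And>x. x \<in> S \<Longrightarrow> (G has_derivative g' x) (at x within S)" by blast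
  have "g y = G y" if "y \<in> S" for y using G(1)[OF that] g[OF that] sums_unique2 by blast
  then show ?thesis using G(2)[OF S(2)] S(2) by (rule has_derivative_transform[rotated])
qed

text \<open>The coefficients are complex so that a real-analytic function extends to complex arguments.\<close>

definition dps_converges :: "(nat \<Rightarrow> nat \<Rightarrow> complex) \<Rightarrow> real \<Rightarrow> bool" where
  "dps_converges c R \<longleftrightarrow> R > 0 \<and> (\<lambda>(i, j). norm (c i j) * R ^ i * R ^ j) summable_on UNIV"

definition dps :: "(nat \<Rightarrow> nat \<Rightarrow> complex) \<Rightarrow> complex \<Rightarrow> complex \<Rightarrow> complex" where
  "dps c z w = (\<Sum>\<^sub>\<infinity>(i, j). c i j * z ^ i * w ^ j)"

definition d1 :: "(nat \<Rightarrow> nat \<Rightarrow> complex) \<Rightarrow> nat \<Rightarrow> nat \<Rightarrow> complex" where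
  "d1 c i j = of_nat (Suc i) * c (Suc i) j"

definition d2 :: "(nat \<Rightarrow> nat \<Rightarrow> complex) \<Rightarrow> nat \<Rightarrow> nat \<Rightarrow> complex" where
  "d2 c i j = of_nat (Suc j) * c i (Suc j)"

text \<open>Exchanging the variables reduces statements about \<open>d2\<close> to those about
  \<open>d1\<close>.\<close>

definition dps_swap :: "(nat \<Rightarrow> nat \<Rightarrow> complex) \<Rightarrow> nat \<Rightarrow> nat \<Rightarrow> complex" where
  "dps_swap c i j = c j i"

lemma dps_swap_swap [simp]: "dps_swap (dps_swap c) = c"
  and dps_swap_d2: "dps_swap (d2 c) = d1 (dps_swap c)"
  by (simp_all add: dps_swap_def d1_def d2_def fun_eq_iff)

lemma bij_swap_UNIV: "bij_betw prod.swap UNIV (UNIV :: (nat \<times> nat) set)"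
  by simp

lemma dps_converges_swap [simp]: "dps_converges (dps_swap c) R = dps_converges c R"
  unfolding dps_converges_def dps_swap_def
  using summable_on_reindex_bij_betw[OF bij_swap_UNIV, of "\<lambda>(i, j). norm (c i j) * R ^ i * R ^ j"]
  by (simp add: case_prod_unfold mult_ac)

lemma dps_dps_swap: "dps (dps_swap c) w z = dps c z w"
  unfolding dps_def dps_swap_def
  using infsum_reindex_bij_betw[OF bij_swap_UNIV, of "\<lambda>(i, j). c i j * z ^ i * w ^ j"]
  by (simp add: case_prod_unfold mult_ac)

lemma dps_converges_comparison:
  assumes "dps_converges c R" and r: "0 < r" and
    le: "\<And>i j. norm (b i j) * r ^ i * r ^ j \<le> K * (norm (c i j) * R ^ i * R ^ j)"
  shows "dps_converges b r"
proof -
  have s: "(\<lambda>(i, j). norm (c i j) * R ^ i * R ^ j) summable_on UNIV"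
    using assms unfolding dps_converges_def by auto
  have "abs_summable (\<lambda>p. K * (case p of (i, j) \<Rightarrow> norm (c i j) * R ^ i * R ^ j))"
    by (rule summable_on_cmult_right[OF s, THEN summable_on_iff_abs_summable_on_real[THEN iffD1]])
  then have "abs_summable (\<lambda>(i, j). norm (b i j) * r ^ i * r ^ j)"
  proof (rule Infinite_Sum.abs_summable_on_comparison_test)
    fix p :: "nat \<times> nat"
    obtain i j where p: "p = (i, j)" by (cases p)
    show "norm (case p of (i, j) \<Rightarrow> norm (b i j) * r ^ i * r ^ j)
        \<le> norm (K * (case p of (i, j) \<Rightarrow> norm (c i j) * R ^ i * R ^ j))"
      using le[of i j] r unfolding p by (simp add: abs_le_iff) 
  qed
  then have "(\<lambda>(i, j). norm (b i j) * r ^ i * r ^ j) summable_on UNIV"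
    by (rule summable_on_iff_abs_summable_on_real[THEN iffD2])
  then show ?thesis using r unfolding dps_converges_def by blast
qed

lemma dps_converges_mono:
  assumes "dps_converges c R" "0 < r" "r \<le> R"
  shows "dps_converges c r"
proof (rule dps_converges_comparison[OF assms(1,2), of _ 1])
  fix i j
  have "r ^ i * r ^ j \<le> R ^ i * R ^ j"
    using assms by (intro mult_mono power_mono) auto
  then show "norm (c i j) * r ^ i * r ^ j \<le> 1 * (norm (c i j) * R ^ i * R ^ j)"
    by (simp add: mult.assoc mult_left_mono)
qed

lemma dps_converges_shift:
  assumes "dps_converges c R"
  shows "dps_converges (\<lambda>i j. c (Suc i) j) R"
proof -
  have R: "R > 0" and s: "(\<lambda>(i, j). norm (c i j) * R ^ i * R ^ j) summable_on UNIV"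
    using assms unfolding dps_converges_def by auto
  have inj: "inj (\<lambda>(i :: nat, j :: nat). (Suc i, j))" by (auto simp: inj_on_def)
  have "((\<lambda>(i, j). norm (c i j) * R ^ i * R ^ j) \<circ> (\<lambda>(i, j). (Suc i, j))) summable_on UNIV"
    using summable_on_reindex[OF inj] summable_on_subset_banach[OF s] by blast
  then have "(\<lambda>(i, j). norm (c (Suc i) j) * R ^ Suc i * R ^ j) summable_on UNIV"
    by (simp add: o_def case_prod_unfold)
  then have "(\<lambda>p. inverse R * (case p of (i, j) \<Rightarrow> norm (c (Suc i) j) * R ^ Suc i * R ^ j)) summable_on UNIV"
    by (rule summable_on_cmult_right)
  then show ?thesis unfolding dps_converges_def using R
    by (simp add: case_prod_unfold field_simps)
qed

text \<open>Shrinking the radius pays for the factor \<open>Suc i\<close>: with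
  \<open>R = r * (1 + \<delta>)\<close>, Bernoulli's inequality makes
  \<open>(1 + \<delta>) ^ i\<close> grow at least linearly in \<open>i\<close>.\<close>

lemma dps_converges_d1:
  assumes c: "dps_converges c R" and r: "0 < r" "r < R"
  shows "dps_converges (d1 c) r"
proof -
  define \<delta> where "\<delta> = R / r - 1"
  \<comment> \<open>With this \<open>K\<close> both the constant and the linear part of
    \<open>Suc i\<close> are dominated by \<open>K * (1 + i * \<delta>)\<close>.\<close>
  define K where "K = max 1 (1 / \<delta>)"
  have \<delta>: "\<delta> > 0" "R = r * (1 + \<delta>)" unfolding \<delta>_def using r by (auto simp: field_simps)
  have K: "K \<ge> 1" "K * \<delta> \<ge> 1" unfolding K_def using \<delta> by (auto simp: max_def field_simps)
  have bound: "real (Suc i) * r ^ i \<le> K * R ^ i" for i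
  proof -
    have "real i * 1 \<le> real i * (K * \<delta>)" using K by (intro mult_left_mono) auto
    then have "real (Suc i) \<le> K * (1 + real i * \<delta>)"
      using K by (simp add: algebra_simps)
    also have "\<dots> \<le> K * (1 + \<delta>) ^ i"
      using K \<delta> Bernoulli_inequality[of \<delta> i] by (intro mult_left_mono) auto
    finally have "real (Suc i) * r ^ i \<le> K * (1 + \<delta>) ^ i * r ^ i"
      using r by (intro mult_right_mono) auto
    then show ?thesis unfolding \<delta>(2) by (simp add: power_mult_distrib mult_ac)
  qed
  show ?thesis
  proof (rule dps_converges_comparison[OF dps_converges_shift[OF c] r(1)])
    fix i j
    have "(real (Suc i) * r ^ i) * r ^ j \<le> (K * R ^ i) * R ^ j"
      by (intro mult_mono bound power_mono) (use r K in auto)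
    then have "norm (c (Suc i) j) * ((real (Suc i) * r ^ i) * r ^ j) \<le> norm (c (Suc i) j) * ((K * R ^ i) * R ^ j)"
      by (rule mult_left_mono) simp
    moreover have "norm (d1 c i j) * r ^ i * r ^ j = norm (c (Suc i) j) * ((real (Suc i) * r ^ i) * r ^ j)"
      unfolding d1_def by (simp only: norm_mult norm_of_nat mult_ac)
    ultimately show "norm (d1 c i j) * r ^ i * r ^ j \<le> K * (norm (c (Suc i) j) * R ^ i * R ^ j)"
      by (simp only: mult_ac)
  qed
qed

lemma dps_converges_d2:
  assumes "dps_converges c R" "0 < r" "r < R"
  shows "dps_converges (d2 c) r"
  using dps_converges_d1[of "dps_swap c" R r] assms
  by (metis dps_converges_swap dps_swap_d2)

lemma dps_abs_summable:
  assumes "dps_converges c R" "norm z \<le> R" "norm w \<le> R"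
  shows "abs_summable (\<lambda>(i, j). c i j * z ^ i * w ^ j)"
proof -
  have "abs_summable (\<lambda>(i, j). norm (c i j) * R ^ i * R ^ j)"
    by (rule summable_on_iff_abs_summable_on_real[THEN iffD1])
      (use assms(1) in \<open>simp add: dps_converges_def\<close>)
  then show ?thesis
  proof (rule Infinite_Sum.abs_summable_on_comparison_test)
    fix p :: "nat \<times> nat"
    obtain i j where p: "p = (i, j)" by (cases p)
    have "norm (c i j) * norm z ^ i * norm w ^ j \<le> norm (c i j) * R ^ i * R ^ j"
      using assms(2,3) order_trans[OF norm_ge_zero assms(2)] by (intro mult_mono power_mono) auto
    also have "\<dots> \<le> norm (norm (c i j) * R ^ i * R ^ j)" by simp
    finally show "norm (case p of (i, j) \<Rightarrow> c i j * z ^ i * w ^ j)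
        \<le> norm (case p of (i, j) \<Rightarrow> norm (c i j) * R ^ i * R ^ j)"
      unfolding p by (simp add: norm_mult norm_power)
  qed
qed

lemma dps_has_sum:
  assumes "dps_converges c R" "norm z \<le> R" "norm w \<le> R"
  shows "((\<lambda>(i, j). c i j * z ^ i * w ^ j) has_sum dps c z w) UNIV"
  unfolding dps_def using abs_summable_summable[OF dps_abs_summable[OF assms]] by simp

lemma dps_0_0 [simp]: "dps c 0 0 = c 0 0"
proof -
  have "dps c 0 0 = (\<Sum>\<^sub>\<infinity>(i, j)\<in>{(0, 0)}. c i j * 0 ^ i * 0 ^ j)"
    unfolding dps_def by (rule infsum_cong_neutral) auto
  then show ?thesis by simp
qed

text \<open>The derived series in the indexing of the original one, as term-by-term differentiation
  produces it. The truncated exponent \<open>i - 1\<close> does no harm at \<open>i = 0\<close>,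
  where the factor \<open>of_nat i\<close> vanishes.\<close>

lemma dps_d1_has_sum:
  assumes "dps_converges (d1 c) r" "norm z \<le> r" "norm w \<le> r"
  shows "((\<lambda>(i, j). c i j * (of_nat i * z ^ (i - 1)) * w ^ j) has_sum dps (d1 c) z w) UNIV"
proof -
  let ?h = "\<lambda>(i :: nat, j :: nat). (Suc i, j)"
  let ?g = "\<lambda>(i, j). c i j * (of_nat i * z ^ (i - 1)) * w ^ j"
  have inj: "inj ?h" by (auto simp: inj_on_def)
  have "(?g \<circ> ?h) = (\<lambda>(i, j). d1 c i j * z ^ i * w ^ j)"
    by (auto simp: fun_eq_iff d1_def)
  then have "((?g \<circ> ?h) has_sum dps (d1 c) z w) UNIV"
    using dps_has_sum[OF assms] by (simp only:)
  then have "(?g has_sum dps (d1 c) z w) (range ?h)"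
    by (rule has_sum_reindex[OF inj, THEN iffD2])
  moreover have "?g p = 0" if "p \<notin> range ?h" for p
  proof (cases p)
    case (Pair i j)
    then have "i = 0" using that by (cases i) (auto simp: image_iff)
    then show ?thesis using Pair by simp
  qed
  ultimately show ?thesis by (subst has_sum_cong_neutral[of "range ?h" _ ?g ?g]) auto
qed

lemma dps_d2_has_sum:
  assumes "dps_converges (d2 c) r" "norm z \<le> r" "norm w \<le> r"
  shows "((\<lambda>(i, j). c i j * z ^ i * (of_nat j * w ^ (j - 1))) has_sum dps (d2 c) z w) UNIV"
proof -
  have "((\<lambda>(i, j). dps_swap c i j * (of_nat i * w ^ (i - 1)) * z ^ j) has_sum dps (d1 (dps_swap c)) w z) UNIV"
    by (rule dps_d1_has_sum[OF _ assms(3,2)])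
      (use assms(1) in \<open>simp only: dps_swap_d2[symmetric] dps_converges_swap\<close>)
  then have "((\<lambda>p. case prod.swap p of (i, j) \<Rightarrow> dps_swap c i j * (of_nat i * w ^ (i - 1)) * z ^ j)
      has_sum dps (d2 c) z w) UNIV"
    unfolding has_sum_reindex_bij_betw[OF bij_swap_UNIV] dps_swap_d2[symmetric] dps_dps_swap .
  then show ?thesis by (simp add: case_prod_unfold dps_swap_def mult_ac)
qed

text \<open>Term-by-term differentiation on a bidisc whose radius \<open>r\<close> lies strictly
  between the given point and \<open>R\<close>, so that the derived series still converge absolutely
  at radius \<open>r\<close>.\<close>

lemma dps_has_derivative:
  assumes c: "dps_converges c R" and z: "norm z < R" and w: "norm w < R"
  shows "((\<lambda>(z, w). dps c z w) has_derivative (\<lambda>(h, k). dps (d1 c) z w * h + dps (d2 c) z w * k)) (at (z, w))"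
proof -
  define r where "r = (max (norm z) (norm w) + R) / 2"
  have r: "norm z < r" "norm w < r" "r < R" unfolding r_def using z w by auto
  then have r0: "r > 0" using norm_ge_zero[of z] by linarith
  define S where "S = ball (0::complex) r \<times> ball (0::complex) r"
  have S: "convex S" "open S" "(z, w) \<in> S"
    unfolding S_def using r by (auto intro: convex_Times open_Times)
  have S': "norm (fst x) \<le> r" "norm (snd x) \<le> r" if "x \<in> S" for x
    using that unfolding S_def by (auto simp: mem_Times_iff)
  note c1 = dps_converges_d1[OF c r0 r(3)] and c2 = dps_converges_d2[OF c r0 r(3)]
  note cr = dps_converges_mono[OF c r0 less_imp_le[OF r(3)]]
  define t where "t p x = (case p of (i, j) \<Rightarrow> c i j * fst x ^ i * snd x ^ j)" for p and x :: "complex \<times> complex"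
  define t' where "t' p x h = (case p of (i, j) \<Rightarrow> c i j * (of_nat i * fst x ^ (i - 1)) * snd x ^ j * fst h
      + c i j * fst x ^ i * (of_nat j * snd x ^ (j - 1)) * snd h)" for p and x h :: "complex \<times> complex"
  \<comment> \<open>The norms of the derived terms at the corner \<open>(r, r)\<close> dominate
    those on the whole bidisc.\<close>
  define B where "B p = (case p of (i, j) \<Rightarrow> norm (c i j * (of_nat i * of_real r ^ (i - 1)) * of_real r ^ j)
      + norm (c i j * of_real r ^ i * (of_nat j * of_real r ^ (j - 1))))" for p
  have "(t p has_derivative t' p x) (at x within S)" for p x
    unfolding t_def t'_def
  proof (cases p)
    case (Pair i j)
    have "((\<lambda>x. c i j * (fst x ^ i * snd x ^ j)) has_derivative
        (\<lambda>h. c i j * (fst x ^ i * (of_nat j * snd h * snd x ^ (j - 1)) + (of_nat i * fst h * fst x ^ (i - 1)) * snd x ^ j)))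
        (at x within S)"
      by (intro has_derivative_mult_right has_derivative_mult has_derivative_power has_derivative_fst
          has_derivative_snd has_derivative_ident)
    then show "((\<lambda>x. case p of (i, j) \<Rightarrow> c i j * fst x ^ i * snd x ^ j) has_derivative
        (\<lambda>h. case p of (i, j) \<Rightarrow> c i j * (of_nat i * fst x ^ (i - 1)) * snd x ^ j * fst h
          + c i j * fst x ^ i * (of_nat j * snd x ^ (j - 1)) * snd h)) (at x within S)"
      unfolding Pair by (simp add: algebra_simps)
  qed
  moreover have "norm (t' p x h) \<le> B p * norm h" if "x \<in> S" for p x h
  proof (cases p)
    case (Pair i j)
    have n: "norm (fst h) \<le> norm h" "norm (snd h) \<le> norm h"
      using norm_fst_le[of "fst h" "snd h"] norm_snd_le[of "snd h" "fst h"] by simp_all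
    have "norm (fst x) ^ k \<le> r ^ k" "norm (snd x) ^ k \<le> r ^ k" for k
      using S'[OF that] by (auto intro: power_mono)
    then have "norm (c i j) * (of_nat i * norm (fst x) ^ (i - 1)) * norm (snd x) ^ j * norm (fst h)
        \<le> norm (c i j) * (of_nat i * r ^ (i - 1)) * r ^ j * norm h"
      "norm (c i j) * norm (fst x) ^ i * (of_nat j * norm (snd x) ^ (j - 1)) * norm (snd h)
        \<le> norm (c i j) * r ^ i * (of_nat j * r ^ (j - 1)) * norm h"
      using n r0 by (auto intro!: mult_mono)
    moreover have "norm (t' p x h) \<le> norm (c i j * (of_nat i * fst x ^ (i - 1)) * snd x ^ j * fst h)
      + norm (c i j * fst x ^ i * (of_nat j * snd x ^ (j - 1)) * snd h)"
      unfolding t'_def Pair by (simp add: norm_triangle_ineq)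
    ultimately show ?thesis unfolding B_def Pair using r0
      by (simp add: norm_mult norm_power distrib_right)
  qed
  moreover have "summable (\<lambda>n. B (prod_decode n))"
  proof -
    have rr: "norm (of_real r :: complex) \<le> r" using r0 by simp
    have "abs_summable (\<lambda>(i, j). c i j * (of_nat i * of_real r ^ (i - 1)) * of_real r ^ j)"
      using dps_d1_has_sum[OF c1 rr rr] summable_on_iff_abs_summable_on_complex
      unfolding summable_on_def by blast
    moreover have "abs_summable (\<lambda>(i, j). c i j * of_real r ^ i * (of_nat j * of_real r ^ (j - 1)))"
      using dps_d2_has_sum[OF c2 rr rr] summable_on_iff_abs_summable_on_complex
      unfolding summable_on_def by blast
    ultimately have "B summable_on UNIV"
      unfolding B_def[abs_def] case_prod_unfold by (rule summable_on_add)
    then have "(\<lambda>n. B (prod_decode n)) summable_on UNIV"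
      using summable_on_reindex_bij_betw[OF bij_prod_decode] by blast
    then show ?thesis using has_sum_imp_sums summable_on_def sums_summable by blast
  qed
  moreover have "(\<lambda>n. t (prod_decode n) x) sums dps c (fst x) (snd x)" if "x \<in> S" for x
  proof -
    have "((\<lambda>p. t p x) has_sum dps c (fst x) (snd x)) UNIV"
      using dps_has_sum[OF cr S'[OF that]] unfolding t_def .
    then show ?thesis
      using has_sum_reindex_bij_betw[OF bij_prod_decode] has_sum_imp_sums by blast
  qed
  moreover have "(\<lambda>n. t' (prod_decode n) x h) sums
      (dps (d1 c) (fst x) (snd x) * fst h + dps (d2 c) (fst x) (snd x) * snd h)" if "x \<in> S" for x h
  proof -
    have "((\<lambda>p. (case p of (i, j) \<Rightarrow> c i j * (of_nat i * fst x ^ (i - 1)) * snd x ^ j) * fst h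
      + (case p of (i, j) \<Rightarrow> c i j * fst x ^ i * (of_nat j * snd x ^ (j - 1))) * snd h) has_sum
      (dps (d1 c) (fst x) (snd x) * fst h + dps (d2 c) (fst x) (snd x) * snd h)) UNIV"
      by (intro has_sum_add has_sum_cmult_left dps_d1_has_sum[OF c1 S'[OF that]] dps_d2_has_sum[OF c2 S'[OF that]])
    then have "((\<lambda>p. t' p x h) has_sum
      (dps (d1 c) (fst x) (snd x) * fst h + dps (d2 c) (fst x) (snd x) * snd h)) UNIV"
      unfolding t'_def case_prod_unfold .
    then show ?thesis
      using has_sum_reindex_bij_betw[OF bij_prod_decode] has_sum_imp_sums by blast
  qed
  ultimately have "((\<lambda>x. dps c (fst x) (snd x)) has_derivative
      (\<lambda>h. dps (d1 c) z w * fst h + dps (d2 c) z w * snd h)) (at (z, w) within S)"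
    using has_derivative_sums_M_test[OF S(1,3), of "\<lambda>n. t (prod_decode n)" "\<lambda>n. t' (prod_decode n)"
        "\<lambda>n. B (prod_decode n)" "\<lambda>x. dps c (fst x) (snd x)"
        "\<lambda>x h. dps (d1 c) (fst x) (snd x) * fst h + dps (d2 c) (fst x) (snd x) * snd h"]
    by simp
  then show ?thesis
    using at_within_open[OF S(3,2)] by (simp add: case_prod_unfold)
qed

text \<open>Serves to make a series holomorphic in one variable: along a complex line for the
  identity theorem, and along the graph of a holomorphic function for arcs of critical
  points.\<close>

lemma dps_compose_has_field_derivative:
  assumes c: "dps_converges c R" and n: "norm (a t) < R" "norm (b t) < R"
    and a: "(a has_field_derivative a') (at t)" and b: "(b has_field_derivative b') (at t)"
  shows "((\<lambda>t. dps c (a t) (b t)) has_field_derivative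
    (dps (d1 c) (a t) (b t) * a' + dps (d2 c) (a t) (b t) * b')) (at t)"
proof -
  have lin: "((\<lambda>t. (a t, b t)) has_derivative (\<lambda>h. (a' * h, b' * h))) (at t)"
    using a b unfolding has_field_derivative_def by (rule has_derivative_Pair)
  have "(((\<lambda>(z, w). dps c z w) \<circ> (\<lambda>t. (a t, b t))) has_derivative
    ((\<lambda>(h, k). dps (d1 c) (a t) (b t) * h + dps (d2 c) (a t) (b t) * k) \<circ> (\<lambda>h. (a' * h, b' * h)))) (at t)"
    by (rule diff_chain_at[OF lin]) (rule dps_has_derivative[OF c n])
  then show ?thesis unfolding has_field_derivative_def o_def prod.case
    by (rule has_derivative_eq_rhs) (simp add: fun_eq_iff algebra_simps)
qed

section \<open>Real-analytic functions of two variables\<close>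

text \<open>Symmetry under conjugation is how real values are recovered after passing to complex
  arguments, for the series itself and for the solution of an implicit equation.\<close>

lemma cnj_dps:
  fixes c :: "nat \<Rightarrow> nat \<Rightarrow> complex"
  assumes "\<And>i j. c i j \<in> \<real>"
  shows "cnj (dps c z w) = dps c (cnj z) (cnj w)"
proof -
  have "cnj (c i j) = c i j" for i j using assms by (simp add: Reals_cnj_iff)
  then have "(\<lambda>p. cnj (case p of (i, j) \<Rightarrow> c i j * z ^ i * w ^ j)) = (\<lambda>(i, j). c i j * cnj z ^ i * cnj w ^ j)"
    by (auto simp: fun_eq_iff)
  then show ?thesis
    unfolding dps_def by (simp only: infsum_cnj[symmetric])
qed

lemma dps_real:
  fixes c :: "nat \<Rightarrow> nat \<Rightarrow> complex"
  assumes "\<And>i j. c i j \<in> \<real>"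
  shows "dps c (of_real s) (of_real t) \<in> \<real>"
  using cnj_dps[where c = c and z = "of_real s" and w = "of_real t"] assms by (simp add: Reals_cnj_iff)

text \<open>The disc of radius \<open>R\<close> sits inside the bidisc of absolute convergence, so
  one radius serves both. Reality of the coefficients is recorded because \<open>dps\<close> admits
  complex ones.\<close>

definition has_dps :: "(real^2 \<Rightarrow> real) \<Rightarrow> real^2 \<Rightarrow> (nat \<Rightarrow> nat \<Rightarrow> complex) \<Rightarrow> real \<Rightarrow> bool" where
  "has_dps f p c R \<longleftrightarrow> dps_converges c R \<and> (\<forall>i j. c i j \<in> \<real>) \<and>
     (\<forall>x\<in>ball p R. complex_of_real (f x) = dps c (of_real (x$1 - p$1)) (of_real (x$2 - p$2)))"

lemma has_dps_pos: "has_dps f p c R \<Longrightarrow> R > 0"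
  unfolding has_dps_def dps_converges_def by blast

lemma has_dps_real_coeffs: "has_dps f p c R \<Longrightarrow> c i j \<in> \<real>"
  unfolding has_dps_def by blast

lemma has_dps_mono:
  assumes "has_dps f p c R" "0 < r" "r \<le> R"
  shows "has_dps f p c r"
  using assms dps_converges_mono unfolding has_dps_def by (auto simp: mem_ball)

lemma ball_component_norm:
  fixes x p :: "real^2"
  assumes "x \<in> ball p R"
  shows "norm (complex_of_real (x$i - p$i)) < R"
proof -
  have "\<bar>(x - p)$i\<bar> \<le> norm (x - p)" by (rule component_le_norm_cart)
  also have "\<dots> < R" using assms by (simp add: dist_norm norm_minus_commute)
  finally show ?thesis unfolding norm_of_real by simp
qed

text \<open>For a real family summability is absolute, so the given expansion at the single point
  \<open>p + (R, R)\<close> already yields absolute convergence on the bidisc of radius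
  \<open>R\<close>.\<close>

lemma real_analytic_on_has_dps:
  assumes f: "f real_analytic_on U" and p: "p \<in> U"
  shows "\<exists>c R. has_dps f p c R"
proof -
  obtain a r where r: "r > 0" and a: "\<And>x. x \<in> ball p r \<Longrightarrow>
      ((\<lambda>(i, j). a i j * (x$1 - p$1) ^ i * (x$2 - p$2) ^ j) has_sum f x) UNIV"
    using f p unfolding real_analytic_on_def by blast
  define R where "R = r / 3"
  \<comment> \<open>The corner of the square of half-side \<open>R = r / 3\<close>; its distance
    from \<open>p\<close> is at most \<open>2 * R < r\<close>.\<close>
  define q :: "real^2" where "q = (\<chi> i. p$i + R)"
  have "norm (q - p) \<le> (\<Sum>i\<in>UNIV. \<bar>(q - p)$i\<bar>)" by (rule norm_le_l1_cart)
  also have "\<dots> = 2 * R" unfolding q_def R_def using r by (simp add: sum_2)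
  also have "\<dots> < r" unfolding R_def using r by simp
  finally have "q \<in> ball p r" by (simp add: dist_norm norm_minus_commute)
  from a[OF this] have "(\<lambda>(i, j). a i j * R ^ i * R ^ j) summable_on UNIV"
    unfolding q_def by (auto simp: summable_on_def)
  then have "(\<lambda>x. norm (case x of (i, j) \<Rightarrow> a i j * R ^ i * R ^ j)) summable_on UNIV"
    by (rule summable_on_iff_abs_summable_on_real[THEN iffD1])
  then have "dps_converges (\<lambda>i j. of_real (a i j)) R"
    unfolding dps_converges_def using r
    by (simp add: case_prod_unfold abs_mult power_abs R_def)
  moreover have "complex_of_real (f x) = dps (\<lambda>i j. of_real (a i j)) (of_real (x$1 - p$1)) (of_real (x$2 - p$2))"
    if "x \<in> ball p R" for x
  proof -
    have "x \<in> ball p r" using that r unfolding R_def by auto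
    from has_sum_of_real[OF a[OF this]]
    have "((\<lambda>(i, j). of_real (a i j) * of_real (x$1 - p$1) ^ i * of_real (x$2 - p$2) ^ j) has_sum
        complex_of_real (f x)) UNIV"
      by (simp add: case_prod_unfold)
    then show ?thesis unfolding dps_def by (rule infsumI[symmetric])
  qed
  ultimately have "has_dps f p (\<lambda>i j. of_real (a i j)) R" unfolding has_dps_def by simp
  then show ?thesis by blast
qed

text \<open>A total function on the plane, so that it can be iterated; its value means something
  only where \<open>f\<close> is differentiable.\<close>

definition pd :: "2 \<Rightarrow> (real^2 \<Rightarrow> real) \<Rightarrow> real^2 \<Rightarrow> real" where
  "pd k f x = frechet_derivative f (at x) (axis k 1)"

lemma has_dps_has_derivative:
  assumes f: "has_dps f p c R" and x: "x \<in> ball p R"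
  shows "(f has_derivative (\<lambda>h. Re (dps (d1 c) (of_real (x$1 - p$1)) (of_real (x$2 - p$2))) * h$1
      + Re (dps (d2 c) (of_real (x$1 - p$1)) (of_real (x$2 - p$2))) * h$2)) (at x)"
proof -
  let ?z = "\<lambda>x. complex_of_real (x$1 - p$1)" and ?w = "\<lambda>x. complex_of_real (x$2 - p$2)"
  have c: "dps_converges c R" using f unfolding has_dps_def by blast
  have lin: "((\<lambda>y. (?z y, ?w y)) has_derivative (\<lambda>h. (of_real (h$1), of_real (h$2)))) (at x)"
    by (auto intro!: derivative_eq_intros bounded_linear_imp_has_derivative bounded_linear_vec_nth)
  have "(((\<lambda>(z, w). dps c z w) \<circ> (\<lambda>y. (?z y, ?w y))) has_derivative
      ((\<lambda>(h, k). dps (d1 c) (?z x) (?w x) * h + dps (d2 c) (?z x) (?w x) * k) \<circ> (\<lambda>h. (of_real (h$1), of_real (h$2)))))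
      (at x)"
    by (rule diff_chain_at[OF lin])
      (rule dps_has_derivative[OF c ball_component_norm[OF x] ball_component_norm[OF x]])
  then have "((\<lambda>y. Re (dps c (?z y) (?w y))) has_derivative
      (\<lambda>h. Re (dps (d1 c) (?z x) (?w x) * of_real (h$1) + dps (d2 c) (?z x) (?w x) * of_real (h$2)))) (at x)"
    unfolding o_def prod.case by (rule bounded_linear.has_derivative[OF bounded_linear_Re])
  moreover have "Re (dps c (?z y) (?w y)) = f y" if "y \<in> ball p R" for y
    using f that unfolding has_dps_def by (metis Re_complex_of_real)
  ultimately have "(f has_derivative
      (\<lambda>h. Re (dps (d1 c) (?z x) (?w x) * of_real (h$1) + dps (d2 c) (?z x) (?w x) * of_real (h$2)))) (at x)"
    using has_derivative_transform_within_open[OF _ open_ball x] by blast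
  then show ?thesis by simp
qed

lemma axis_2_nth [simp]:
  "(axis 1 1 :: real^2) $ 1 = 1" "(axis 1 1 :: real^2) $ 2 = 0"
  "(axis 2 1 :: real^2) $ 1 = 0" "(axis 2 1 :: real^2) $ 2 = 1"
  by (simp_all add: axis_def)

lemma has_dps_pd:
  assumes f: "has_dps f p c R" and x: "x \<in> ball p R"
  shows "pd 1 f x = Re (dps (d1 c) (of_real (x$1 - p$1)) (of_real (x$2 - p$2)))"
    and "pd 2 f x = Re (dps (d2 c) (of_real (x$1 - p$1)) (of_real (x$2 - p$2)))"
  unfolding pd_def frechet_derivative_at[OF has_dps_has_derivative[OF assms], symmetric] by simp_all

lemma has_dps_pd1:
  assumes f: "has_dps f p c R" and r: "0 < r" "r < R"
  shows "has_dps (pd 1 f) p (d1 c) r"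
proof -
  have real: "d1 c i j \<in> \<real>" for i j
    using f unfolding has_dps_def d1_def by auto
  have "complex_of_real (pd 1 f x) = dps (d1 c) (of_real (x$1 - p$1)) (of_real (x$2 - p$2))"
    if "x \<in> ball p r" for x
    using has_dps_pd(1)[OF f, of x] that r dps_real[where c = "d1 c", OF real]
    by (simp add: of_real_Re del: of_real_diff)
  then show ?thesis using dps_converges_d1[OF _ r] f real unfolding has_dps_def by blast
qed

lemma has_dps_pd2:
  assumes f: "has_dps f p c R" and r: "0 < r" "r < R"
  shows "has_dps (pd 2 f) p (d2 c) r"
proof -
  have real: "d2 c i j \<in> \<real>" for i j
    using f unfolding has_dps_def d2_def by auto
  have "complex_of_real (pd 2 f x) = dps (d2 c) (of_real (x$1 - p$1)) (of_real (x$2 - p$2))"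
    if "x \<in> ball p r" for x
    using has_dps_pd(2)[OF f, of x] that r dps_real[where c = "d2 c", OF real]
    by (simp add: of_real_Re del: of_real_diff)
  then show ?thesis using dps_converges_d2[OF _ r] f real unfolding has_dps_def by blast
qed

definition analytic2_on :: "(real^2 \<Rightarrow> real) \<Rightarrow> (real^2) set \<Rightarrow> bool" (infixl "analytic2'_on" 50) where
  "f analytic2_on U \<longleftrightarrow> (\<forall>p\<in>U. \<exists>c R. has_dps f p c R)"

lemma analytic2_on_pd:
  assumes "f analytic2_on U"
  shows "pd k f analytic2_on U"
  unfolding analytic2_on_def
proof
  fix p assume "p \<in> U"
  then obtain c R where f: "has_dps f p c R" using assms unfolding analytic2_on_def by blast
  then have "0 < R / 2" "R / 2 < R" using has_dps_pos by auto
  then show "\<exists>c R. has_dps (pd k f) p c R"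
    using has_dps_pd1[OF f] has_dps_pd2[OF f] exhaust_2[of k] by metis
qed

lemma analytic2_on_has_derivative:
  assumes "f analytic2_on U" "x \<in> U"
  shows "(f has_derivative (\<lambda>h. pd 1 f x * h$1 + pd 2 f x * h$2)) (at x)"
proof -
  obtain c R where f: "has_dps f x c R" using assms unfolding analytic2_on_def by blast
  then have "x \<in> ball x R" using has_dps_pos by auto
  from has_dps_has_derivative[OF f this] show ?thesis
    unfolding has_dps_pd[OF f \<open>x \<in> ball x R\<close>] .
qed

lemma analytic2_on_continuous_on: "f analytic2_on U \<Longrightarrow> continuous_on U f"
  by (meson analytic2_on_has_derivative has_derivative_continuous continuous_at_imp_continuous_on)

section \<open>Linear combinations of expansions\<close>

lemma has_dps_add:
  assumes "has_dps f p a R" "has_dps g p b S"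
  shows "has_dps (\<lambda>x. f x + g x) p (\<lambda>i j. a i j + b i j) (min R S)"
proof -
  define r where "r = min R S"
  have r: "r > 0" "r \<le> R" "r \<le> S" using has_dps_pos assms unfolding r_def by auto
  have fr: "has_dps f p a r" and gr: "has_dps g p b r"
    using has_dps_mono assms r by blast+
  have "dps_converges (\<lambda>i j. a i j + b i j) r"
  proof -
    have "(\<lambda>p. (case p of (i, j) \<Rightarrow> norm (a i j) * r ^ i * r ^ j) + (case p of (i, j) \<Rightarrow> norm (b i j) * r ^ i * r ^ j))
        summable_on UNIV"
      using fr gr unfolding has_dps_def dps_converges_def by (intro summable_on_add) auto
    then have "dps_converges (\<lambda>i j. of_real (norm (a i j) + norm (b i j))) r"
      unfolding dps_converges_def using r
      by (simp add: case_prod_unfold distrib_right flip: of_real_add)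
    then show ?thesis
    proof (rule dps_converges_comparison[OF _ r(1), of _ _ _ 1])
      fix i j
      have "norm (a i j + b i j) \<le> norm (complex_of_real (norm (a i j) + norm (b i j)))"
        by (simp add: norm_triangle_ineq flip: of_real_add)
      then show "norm (a i j + b i j) * r ^ i * r ^ j
          \<le> 1 * (norm (complex_of_real (norm (a i j) + norm (b i j))) * r ^ i * r ^ j)"
        using r unfolding mult_1 by (intro mult_right_mono) auto
    qed
  qed
  moreover have "complex_of_real (f x + g x)
      = dps (\<lambda>i j. a i j + b i j) (of_real (x$1 - p$1)) (of_real (x$2 - p$2))" if x: "x \<in> ball p r" for x
  proof -
    let ?z = "complex_of_real (x$1 - p$1)" and ?w = "complex_of_real (x$2 - p$2)"
    have n: "norm ?z \<le> r" "norm ?w \<le> r" using ball_component_norm[OF x] less_imp_le by blast+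
    have "((\<lambda>p. (case p of (i, j) \<Rightarrow> a i j * ?z ^ i * ?w ^ j) + (case p of (i, j) \<Rightarrow> b i j * ?z ^ i * ?w ^ j))
        has_sum (dps a ?z ?w + dps b ?z ?w)) UNIV"
      using dps_has_sum[of a r, OF _ n] dps_has_sum[of b r, OF _ n] fr gr unfolding has_dps_def
      by (intro has_sum_add) auto
    then have "((\<lambda>(i, j). (a i j + b i j) * ?z ^ i * ?w ^ j) has_sum (dps a ?z ?w + dps b ?z ?w)) UNIV"
      by (simp add: case_prod_unfold distrib_right)
    then have "dps (\<lambda>i j. a i j + b i j) ?z ?w = dps a ?z ?w + dps b ?z ?w"
      unfolding dps_def[of "\<lambda>i j. a i j + b i j"] by (rule infsumI)
    then show ?thesis using fr gr x unfolding has_dps_def by simp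
  qed
  ultimately show ?thesis using assms unfolding has_dps_def r_def[symmetric] by auto
qed

lemma has_dps_cmult:
  assumes f: "has_dps f p a R"
  shows "has_dps (\<lambda>x. k * f x) p (\<lambda>i j. of_real k * a i j) R"
proof -
  have a: "dps_converges a R" using f unfolding has_dps_def by blast
  have "dps_converges (\<lambda>i j. of_real k * a i j) R"
    by (rule dps_converges_comparison[OF a has_dps_pos[OF f], of _ "\<bar>k\<bar>"])
      (simp add: norm_mult mult.assoc)
  moreover have "dps (\<lambda>i j. of_real k * a i j) z w = of_real k * dps a z w" if "norm z \<le> R" "norm w \<le> R" for z w
  proof -
    have "((\<lambda>p. of_real k * (case p of (i, j) \<Rightarrow> a i j * z ^ i * w ^ j)) has_sum (of_real k * dps a z w)) UNIV"
      by (rule has_sum_cmult_right[OF dps_has_sum[OF a that]])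
    then have "((\<lambda>(i, j). of_real k * a i j * z ^ i * w ^ j) has_sum (of_real k * dps a z w)) UNIV"
      by (simp add: case_prod_unfold mult.assoc)
    then show ?thesis
      unfolding dps_def[of "\<lambda>i j. of_real k * a i j"] by (rule infsumI)
  qed
  moreover have "norm (complex_of_real (x$i - p$i)) \<le> R" if "x \<in> ball p R" for x i
    using ball_component_norm[OF that] by (rule less_imp_le)
  ultimately show ?thesis
    using f unfolding has_dps_def by (simp del: of_real_diff norm_of_real)
qed

text \<open>The power series is restricted to the complex line through \<open>q\<close> and \<open>x\<close>.\<close>

lemma has_dps_identity:
  assumes f: "has_dps f p c R" and S: "open S" "q \<in> S" "S \<subseteq> ball p R" "\<And>y. y \<in> S \<Longrightarrow> f y = 0"
    and x: "x \<in> ball p R"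
  shows "f x = 0"
proof -
  let ?z = "\<lambda>t::complex. of_real (q$1 - p$1) + t * of_real (x$1 - q$1)"
  let ?w = "\<lambda>t::complex. of_real (q$2 - p$2) + t * of_real (x$2 - q$2)"
  have c: "dps_converges c R" using f unfolding has_dps_def by blast
  \<comment> \<open>The parameters for which the complex line stays in the bidisc. \<open>T\<close>
    is convex, hence connected, and contains 0 and 1, the parameters of \<open>q\<close> and
    \<open>x\<close>.\<close>
  define T where "T = {t. ?z t \<in> ball 0 R} \<inter> {t. ?w t \<in> ball 0 R}"
  have T: "norm (?z t) < R" "norm (?w t) < R" if "t \<in> T" for t using that unfolding T_def by auto
  have "open T" unfolding T_def
    by (intro open_Int open_Collect_less continuous_intros | simp add: dist_norm)+
  have cv: "convex {t :: complex. a + t * b \<in> ball 0 R}" for a b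
  proof (rule convexI)
    fix s t :: complex and u v :: real
    assume st: "s \<in> {t. a + t * b \<in> ball 0 R}" "t \<in> {t. a + t * b \<in> ball 0 R}" and uv: "0 \<le> u" "0 \<le> v" "u + v = 1"
    have "u *\<^sub>R (a + s * b) + v *\<^sub>R (a + t * b) \<in> ball 0 R"
      using st uv convexD[OF convex_ball] by blast
    moreover have "a = u *\<^sub>R a + v *\<^sub>R a" using uv(3) by (simp flip: scaleR_add_left)
    then have "u *\<^sub>R (a + s * b) + v *\<^sub>R (a + t * b) = a + (u *\<^sub>R s + v *\<^sub>R t) * b"
      by (simp add: algebra_simps)
    ultimately show "u *\<^sub>R s + v *\<^sub>R t \<in> {t. a + t * b \<in> ball 0 R}" by simp
  qed
  then have "connected T" unfolding T_def by (intro convex_connected convex_Int cv)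
  have q: "q \<in> ball p R" using S by blast
  have T01: "0 \<in> T" "1 \<in> T"
    using ball_component_norm[OF q] ball_component_norm[OF x] unfolding T_def by auto
  have hol: "(\<lambda>t. dps c (?z t) (?w t)) holomorphic_on T"
  proof -
    have "((\<lambda>t. dps c (?z t) (?w t)) has_field_derivative
        (dps (d1 c) (?z t) (?w t) * of_real (x$1 - q$1) + dps (d2 c) (?z t) (?w t) * of_real (x$2 - q$2))) (at t)"
      if t: "t \<in> T" for t
      by (rule dps_compose_has_field_derivative[of c R ?z t ?w, OF c T[OF t]]) (auto intro!: derivative_eq_intros)
    then show ?thesis
      by (meson field_differentiable_at_within field_differentiable_def holomorphic_onI)
  qed
  have val: "dps c (?z (of_real t)) (?w (of_real t)) = of_real (f (q + t *\<^sub>R (x - q)))"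
    if "q + t *\<^sub>R (x - q) \<in> ball p R" for t
  proof -
    have "?z (of_real t) = of_real ((q + t *\<^sub>R (x - q))$1 - p$1)" "?w (of_real t) = of_real ((q + t *\<^sub>R (x - q))$2 - p$2)"
      by simp_all
    then show ?thesis using f that unfolding has_dps_def by metis
  qed
  have "isCont (\<lambda>t::real. q + t *\<^sub>R (x - q)) 0" by (intro continuous_intros)
  then have "\<forall>\<^sub>F t in at 0. q + t *\<^sub>R (x - q) \<in> S"
    using S(1,2) unfolding isCont_def by (auto dest!: topological_tendstoD)
  then obtain d where d: "d > 0" "\<And>t::real. t \<noteq> 0 \<Longrightarrow> \<bar>t\<bar> < d \<Longrightarrow> q + t *\<^sub>R (x - q) \<in> S"
    unfolding eventually_at by auto
  define Z where "Z = {t \<in> T. dps c (?z t) (?w t) = 0}"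
  \<comment> \<open>Small positive real parameters lead to points of \<open>S\<close>, where
    \<open>f\<close> vanishes.\<close>
  have "0 islimpt Z"
    unfolding islimpt_approachable
  proof (intro allI impI)
    fix e :: real assume "e > 0"
    obtain e' where e': "e' > 0" "ball 0 e' \<subseteq> T" using \<open>open T\<close> T01(1) openE by blast
    define t where "t = min (min d e) e' / 2"
    have t: "0 < t" "t < d" "t < e" "t < e'" unfolding t_def using d(1) e'(1) \<open>e > 0\<close> by auto
    have tS: "q + t *\<^sub>R (x - q) \<in> S" using d(2)[of t] t by simp
    then have "dps c (?z (of_real t)) (?w (of_real t)) = 0"
      using val[of t] S(3,4) by auto
    moreover have "of_real t \<in> T" using e'(2) t by auto
    ultimately have "of_real t \<in> Z" unfolding Z_def by blast
    moreover have "of_real t \<noteq> (0::complex)" "dist (of_real t) (0::complex) < e" using t by auto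
    ultimately show "\<exists>y\<in>Z. y \<noteq> 0 \<and> dist y 0 < e" by blast
  qed
  then have "dps c (?z 1) (?w 1) = 0"
    using analytic_continuation[OF hol \<open>open T\<close> \<open>connected T\<close>, of Z 0 1] T01 unfolding Z_def by auto
  then show ?thesis using val[of 1] x by simp
qed

text \<open>Induction on the total degree: up to a positive integer factor, a coefficient of
  positive degree is a coefficient of one degree less of a partial derivative, and the partial
  derivatives vanish near \<open>p\<close> as well.\<close>

lemma has_dps_zero_coeffs:
  assumes "has_dps f p c R" "\<forall>\<^sub>F y in nhds p. f y = 0"
  shows "c i j = 0"
  using assms
proof (induction "i + j" arbitrary: f c R i j)
  case 0
  have "p \<in> ball p R" using has_dps_pos[OF 0(2)] by simp
  then have "complex_of_real (f p) = dps c (of_real (p$1 - p$1)) (of_real (p$2 - p$2))"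
    using 0(2) unfolding has_dps_def by blast
  moreover have "f p = 0" using eventually_nhds_x_imp_x[OF 0(3)] .
  ultimately show ?case using 0(1) by simp
next
  case (Suc n)
  have R: "0 < R / 2" "R / 2 < R" using has_dps_pos[OF Suc.prems(1)] by auto
  have "pd k f y = 0" if y: "\<forall>\<^sub>F z in nhds y. f z = 0" for y k
  proof -
    obtain S where S: "open S" "y \<in> S" "\<And>z. z \<in> S \<Longrightarrow> f z = 0"
      using y unfolding eventually_nhds by blast
    have "(f has_derivative (\<lambda>_. 0)) (at y)"
      by (rule has_derivative_transform_within_open[OF has_derivative_const S(1,2)]) (simp add: S(3))
    from frechet_derivative_at[OF this, symmetric] show ?thesis unfolding pd_def by simp
  qed
  moreover have "\<forall>\<^sub>F y in nhds p. \<forall>\<^sub>F z in nhds y. f z = 0"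
    using Suc.prems(2) by (simp add: eventually_eventually)
  ultimately have pd: "\<forall>\<^sub>F y in nhds p. pd k f y = 0" for k
    by (rule eventually_mono[rotated])
  show ?case
  proof (cases i)
    case (Suc i')
    have "d1 c i' j = 0"
      using Suc.hyps(1)[OF _ has_dps_pd1[OF Suc.prems(1) R] pd] Suc Suc.hyps(2) by simp
    then show ?thesis unfolding d1_def Suc by (simp del: of_nat_Suc)
  next
    case 0
    then obtain j' where j': "j = Suc j'" using Suc.hyps(2) by (cases j) auto
    have "d2 c i j' = 0"
      using Suc.hyps(1)[OF _ has_dps_pd2[OF Suc.prems(1) R] pd] j' Suc.hyps(2) by simp
    then show ?thesis unfolding d2_def j' by (simp del: of_nat_Suc)
  qed
qed

section \<open>Critical zeros of Helmholtz solutions\<close>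

text \<open>A term of degree \<open>n > m\<close> is at most
  \<open>(\<rho> / r) ^ n \<le> (\<rho> / r) ^ Suc m\<close> times its size at radius
  \<open>r\<close>. So \<open>K = M / r ^ Suc m\<close> works, where \<open>M\<close> is the sum of
  all sizes at radius \<open>r\<close>.\<close>

lemma dps_leading_terms:
  assumes b: "dps_converges b r" and low: "\<And>i j. i + j < m \<Longrightarrow> b i j = 0"
  shows "\<exists>K\<ge>0. \<forall>z w \<rho>. norm z \<le> \<rho> \<longrightarrow> norm w \<le> \<rho> \<longrightarrow> \<rho> \<le> r \<longrightarrow>
    norm (dps b z w - (\<Sum>k\<le>m. b (m - k) k * z ^ (m - k) * w ^ k)) \<le> K * \<rho> ^ Suc m"
proof -
  define M where "M = (\<Sum>\<^sub>\<infinity>(i, j). norm (b i j) * r ^ i * r ^ j)"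
  have r: "r > 0" and M: "((\<lambda>(i, j). norm (b i j) * r ^ i * r ^ j) has_sum M) UNIV"
    using b unfolding dps_converges_def M_def by auto
  have "M \<ge> 0" unfolding M_def using r by (intro infsum_nonneg) auto
  have "norm (dps b z w - (\<Sum>k\<le>m. b (m - k) k * z ^ (m - k) * w ^ k)) \<le> M / r ^ Suc m * \<rho> ^ Suc m"
    if z: "norm z \<le> \<rho>" and w: "norm w \<le> \<rho>" and \<rho>: "\<rho> \<le> r" for z w \<rho>
  proof -
    have \<rho>0: "0 \<le> \<rho>" using z norm_ge_zero order_trans by blast
    define D where "D = (\<lambda>k. (m - k, k)) ` {..m}"
    have finD: "finite D" unfolding D_def by simp
    have D: "p \<in> D \<longleftrightarrow> fst p + snd p = m" for p
    proof
      assume "fst p + snd p = m"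
      then have "p = (\<lambda>k. (m - k, k)) (snd p)" "snd p \<in> {..m}" by (auto simp: prod_eq_iff)
      then show "p \<in> D" unfolding D_def by blast
    qed (auto simp: D_def)
    let ?t = "\<lambda>(i, j). b i j * z ^ i * w ^ j"
    have "(?t has_sum dps b z w) UNIV"
      using dps_has_sum[OF b order_trans[OF z \<rho>] order_trans[OF w \<rho>]] .
    moreover have "(?t has_sum sum ?t D) D" using finD by (rule has_sum_finite)
    ultimately have rest: "(?t has_sum (dps b z w - sum ?t D)) (UNIV - D)"
      by (rule has_sum_Diff) simp
    have h1: "((\<lambda>p. (case p of (i, j) \<Rightarrow> norm (b i j) * r ^ i * r ^ j) * (\<rho> / r) ^ Suc m) has_sum M * (\<rho> / r) ^ Suc m) UNIV"
      using M by (rule has_sum_cmult_left)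
    have h2: "((\<lambda>p. if p \<in> D then 0 else ?t p) has_sum (dps b z w - sum ?t D)) UNIV"
    proof -
      have "(?t has_sum (dps b z w - sum ?t D)) (UNIV - D) \<longleftrightarrow>
          ((\<lambda>p. if p \<in> D then 0 else ?t p) has_sum (dps b z w - sum ?t D)) UNIV"
        by (rule has_sum_cong_neutral) auto
      then show ?thesis using rest by blast
    qed
    have "norm (dps b z w - sum ?t D) \<le> M * (\<rho> / r) ^ Suc m"
    proof (rule norm_infsum_le[OF h2 h1])
      fix p :: "nat \<times> nat"
      obtain i j where p: "p = (i, j)" by (cases p)
      have R0: "0 \<le> norm (b i j) * r ^ i * r ^ j * (\<rho> / r) ^ Suc m" using r \<rho>0 by simp
      show "norm (if p \<in> D then 0 else ?t p)
          \<le> (case p of (i, j) \<Rightarrow> norm (b i j) * r ^ i * r ^ j) * (\<rho> / r) ^ Suc m"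
      proof (cases "i + j \<le> m")
        case True
        then have "p \<in> D \<or> b i j = 0" using low D p by fastforce
        then show ?thesis using R0 p by auto
      next
        case False
        have "norm z ^ i * norm w ^ j \<le> \<rho> ^ i * \<rho> ^ j"
          using z w \<rho>0 by (intro mult_mono power_mono) auto
        also have "\<dots> = (\<rho> / r) ^ (i + j) * (r ^ i * r ^ j)"
          using r by (simp add: power_add power_divide)
        also have "\<dots> \<le> (\<rho> / r) ^ Suc m * (r ^ i * r ^ j)"
          using False r \<rho> \<rho>0 by (intro mult_right_mono power_decreasing) auto
        finally have "norm (b i j) * (norm z ^ i * norm w ^ j) \<le> norm (b i j) * ((\<rho> / r) ^ Suc m * (r ^ i * r ^ j))"
          by (rule mult_left_mono) simp
        moreover have "p \<notin> D" using False D p by simp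
        ultimately show ?thesis unfolding p by (simp add: norm_mult norm_power mult_ac)
      qed
    qed
    moreover have "sum ?t D = (\<Sum>k\<le>m. b (m - k) k * z ^ (m - k) * w ^ k)"
      unfolding D_def by (subst sum.reindex) (auto simp: inj_on_def)
    ultimately show ?thesis by (simp add: power_divide)
  qed
  moreover have "M / r ^ Suc m \<ge> 0" using \<open>M \<ge> 0\<close> r by simp
  ultimately show ?thesis by blast
qed

text \<open>For the homogeneous polynomial \<open>Q(z, w)\<close> of degree \<open>m\<close> with
  coefficients \<open>q\<close>, the hypothesis says that the \<open>z\<close>-derivative plus
  \<open>\<i>\<close> times the \<open>w\<close>-derivative of \<open>Q\<close> vanishes. The
  solutions are the multiples of \<open>(z + \<i> * w) ^ m\<close>, whose binomial coefficients
  appear in the conclusion.\<close>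

lemma cauchy_riemann_coefficients:
  fixes q :: "nat \<Rightarrow> nat \<Rightarrow> complex"
  assumes CR: "\<And>i j. Suc (i + j) = m \<Longrightarrow> of_nat (Suc i) * q (Suc i) j = - \<i> * of_nat (Suc j) * q i (Suc j)"
    and k: "k \<le> m"
  shows "q (m - k) k = q m 0 * of_nat (m choose k) * \<i> ^ k"
  using k
proof (induction k)
  case (Suc k)
  define i where "i = m - Suc k"
  have i: "Suc (i + k) = m" "m - k = Suc i" unfolding i_def using Suc.prems by auto
  have b: "of_nat (Suc k) * of_nat (m choose Suc k) = (of_nat (Suc i) * of_nat (m choose k) :: complex)"
    using binomial_absorption[of k m] binomial_absorb_comp[of m k] i(2) by (metis of_nat_mult)
  have "of_nat (Suc k) * q i (Suc k) = \<i> * (of_nat (Suc i) * q (Suc i) k)"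
    unfolding CR[OF i(1)] by (simp add: algebra_simps)
  also have "\<dots> = q m 0 * (of_nat (Suc i) * of_nat (m choose k)) * \<i> ^ Suc k"
    using Suc.IH Suc.prems i(2) by (simp add: mult_ac)
  also have "\<dots> = of_nat (Suc k) * (q m 0 * of_nat (m choose Suc k) * \<i> ^ Suc k)"
    unfolding b[symmetric] by (simp only: mult_ac)
  finally show ?case unfolding i_def[symmetric] by (simp del: of_nat_Suc power_Suc)
qed simp

text \<open>The lowest-order homogeneous part of \<open>u_x - \<i> u_y\<close> is a multiple of \<open>(x + \<i> y) ^ m\<close>: since \<open>u\<close>
  vanishes at \<open>p\<close>, the term \<open>lam * u\<close> is of higher order and the Cauchy-Riemann relations hold.\<close>

lemma critical_zero_isolated:
  assumes u: "has_dps u p c R"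
    and eq: "\<forall>\<^sub>F y in nhds p. pd 1 (pd 1 u) y + pd 2 (pd 2 u) y + lam * u y = 0"
    and p: "u p = 0" "pd 1 u p = 0" "pd 2 u p = 0"
    and nz: "\<not> (\<forall>\<^sub>F y in nhds p. u y = 0)"
  shows "\<forall>\<^sub>F y in at p. \<not> (pd 1 u y = 0 \<and> pd 2 u y = 0)"
proof -
  have R: "R > 0" using has_dps_pos[OF u] .
  then have R': "0 < R / 2" "R / 2 < R" "0 < R / 4" "R / 4 < R / 2" by auto
  note u1 = has_dps_pd1[OF u R'(1,2)] and u2 = has_dps_pd2[OF u R'(1,2)]
  have "has_dps (\<lambda>y. (pd 1 (pd 1 u) y + pd 2 (pd 2 u) y) + lam * u y) p
      (\<lambda>i j. (d1 (d1 c) i j + d2 (d2 c) i j) + of_real lam * c i j) (min (min (R / 4) (R / 4)) R)"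
    by (intro has_dps_add has_dps_cmult u has_dps_pd1[OF u1 R'(3,4)] has_dps_pd2[OF u2 R'(3,4)])
  from has_dps_zero_coeffs[OF this eq]
  have rec: "d1 (d1 c) i j + d2 (d2 c) i j + of_real lam * c i j = 0" for i j .
  have cr: "c i j \<in> \<real>" for i j using has_dps_real_coeffs[OF u] .
  have c00: "c 0 0 = 0"
  proof -
    have "complex_of_real (u p) = dps c (of_real (p$1 - p$1)) (of_real (p$2 - p$2))"
      using u R unfolding has_dps_def by auto
    then show ?thesis using p by simp
  qed
  \<comment> \<open>The coefficients of \<open>u_x - \<i> u_y\<close>. As those of
    \<open>u_x\<close> and \<open>u_y\<close> are real, \<open>q i j = 0\<close> annihilates
    both.\<close>
  define q where "q i j = d1 c i j - \<i> * d2 c i j" for i j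
  have q0: "d1 c i j = 0 \<and> d2 c i j = 0" if "q i j = 0" for i j
  proof -
    have "d1 c i j \<in> \<real>" "d2 c i j \<in> \<real>" unfolding d1_def d2_def using cr by auto
    then obtain a b where ab: "d1 c i j = of_real a" "d2 c i j = of_real b" by (auto elim!: Reals_cases)
    then have "Re (q i j) = a" "Im (q i j) = - b" unfolding q_def by auto
    then show ?thesis using ab that by auto
  qed
  have c0: "c i j = 0" if "\<And>i' j'. i' + j' < i + j \<Longrightarrow> q i' j' = 0" for i j
  proof (cases i)
    case (Suc i')
    then have "d1 c i' j = 0" using that[of i' j] q0 by simp
    then show ?thesis unfolding d1_def Suc by (simp del: of_nat_Suc)
  next
    case i: 0
    show ?thesis
    proof (cases j)
      case (Suc j')
      then have "d2 c i j' = 0" using that[of i j'] q0 by simp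
      then show ?thesis unfolding d2_def Suc by (simp del: of_nat_Suc)
    qed (simp add: i c00)
  qed
  \<comment> \<open>If all \<open>q i j\<close> vanished, so would all coefficients of positive
    degree of \<open>u\<close>, and \<open>c 0 0 = u p = 0\<close>; then \<open>u\<close> would
    vanish near \<open>p\<close>.\<close>
  have ex: "\<exists>m i j. i + j = m \<and> q i j \<noteq> 0"
  proof (rule ccontr)
    assume "\<not> ?thesis"
    then have "c i j = 0" for i j using c0 by blast
    then have "c = (\<lambda>i j. 0)" by (simp add: fun_eq_iff)
    then have "dps c z w = 0" for z w unfolding dps_def by (simp add: case_prod_unfold)
    then have "u y = 0" if "y \<in> ball p R" for y using u that unfolding has_dps_def by simp
    then show False using nz R by (metis (mono_tags) centre_in_ball eventually_nhds open_ball)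
  qed
  define m where "m = (LEAST m. \<exists>i j. i + j = m \<and> q i j \<noteq> 0)"
  have least: "\<not> (\<exists>i j. i + j = m' \<and> q i j \<noteq> 0)" if "m' < m" for m'
    using not_less_Least that unfolding m_def by blast
  have "\<exists>i j. i + j = m \<and> q i j \<noteq> 0"
    unfolding m_def by (rule LeastI_ex[OF ex])
  then obtain i0 j0 where ij0: "i0 + j0 = m" "q i0 j0 \<noteq> 0" by blast
  have low: "q i j = 0" if "i + j < m" for i j using least that by blast
  have low_c: "c i j = 0" if "i + j \<le> m" for i j using c0 low that by simp
  have CR: "of_nat (Suc i) * q (Suc i) j = - \<i> * of_nat (Suc j) * q i (Suc j)" if "Suc (i + j) = m" for i j
  proof -
    have "of_nat (Suc i) * q (Suc i) j + \<i> * of_nat (Suc j) * q i (Suc j) = d1 (d1 c) i j + d2 (d2 c) i j"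
      unfolding q_def d1_def d2_def by (simp add: algebra_simps)
    also have "\<dots> = 0" using rec[of i j] low_c[of i j] that by simp
    finally show ?thesis by (simp add: eq_neg_iff_add_eq_0)
  qed
  define \<kappa> where "\<kappa> = q m 0"
  note qm = cauchy_riemann_coefficients[of m q, OF CR, folded \<kappa>_def]
  have \<kappa>: "\<kappa> \<noteq> 0" using qm[of j0] ij0 by auto
  have conv: "dps_converges (d1 c) (R / 2)" "dps_converges (d2 c) (R / 2)"
    using u1 u2 unfolding has_dps_def by auto
  obtain K1 where K1: "K1 \<ge> 0" "\<And>z w \<rho>. norm z \<le> \<rho> \<Longrightarrow> norm w \<le> \<rho> \<Longrightarrow> \<rho> \<le> R / 2 \<Longrightarrow>
    norm (dps (d1 c) z w - (\<Sum>k\<le>m. d1 c (m - k) k * z ^ (m - k) * w ^ k)) \<le> K1 * \<rho> ^ Suc m"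
    using dps_leading_terms[OF conv(1), of m] low q0 by blast
  obtain K2 where K2: "K2 \<ge> 0" "\<And>z w \<rho>. norm z \<le> \<rho> \<Longrightarrow> norm w \<le> \<rho> \<Longrightarrow> \<rho> \<le> R / 2 \<Longrightarrow>
    norm (dps (d2 c) z w - (\<Sum>k\<le>m. d2 c (m - k) k * z ^ (m - k) * w ^ k)) \<le> K2 * \<rho> ^ Suc m"
    using dps_leading_terms[OF conv(2), of m] low q0 by blast
  \<comment> \<open>For \<open>\<rho> < d\<close> the remainder bound
    \<open>(K1 + K2) * \<rho> ^ Suc m\<close> stays below \<open>norm \<kappa> * \<rho> ^ m\<close>;
    the added 1 avoids division by 0.\<close>
  define d where "d = min (R / 2) (norm \<kappa> / (K1 + K2 + 1))"
  have d: "d > 0" "d \<le> R / 2" "d \<le> norm \<kappa> / (K1 + K2 + 1)"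
  proof -
    show "d > 0" unfolding d_def using R K1(1) K2(1) \<kappa> by auto
    show "d \<le> R / 2" "d \<le> norm \<kappa> / (K1 + K2 + 1)"
      unfolding d_def by (rule min.cobounded1, rule min.cobounded2)
  qed
  have "\<not> (pd 1 u y = 0 \<and> pd 2 u y = 0)" if y: "y \<noteq> p" "dist y p < d" for y
  proof
    assume crit: "pd 1 u y = 0 \<and> pd 2 u y = 0"
    let ?s = "y$1 - p$1" and ?t = "y$2 - p$2"
    let ?z = "complex_of_real ?s" and ?w = "complex_of_real ?t"
    define \<rho> where "\<rho> = max \<bar>?s\<bar> \<bar>?t\<bar>"
    have zw: "norm ?z \<le> \<rho>" "norm ?w \<le> \<rho>" unfolding \<rho>_def norm_of_real by auto
    have "\<rho> \<noteq> 0"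
    proof
      assume "\<rho> = 0"
      then have "y$1 = p$1" "y$2 = p$2" unfolding \<rho>_def by (auto simp: max_def split: if_splits)
      then show False using y(1) by (simp add: vec_eq_iff forall_2)
    qed
    then have \<rho>0: "\<rho> > 0" unfolding \<rho>_def by auto
    have "\<bar>(y - p)$1\<bar> \<le> norm (y - p)" "\<bar>(y - p)$2\<bar> \<le> norm (y - p)" by (rule component_le_norm_cart)+
    then have \<rho>d: "\<rho> < d" using y(2) unfolding \<rho>_def by (simp add: dist_norm)
    have yb: "y \<in> ball p (R / 2)" using y(2) d(2) by (simp add: dist_commute)
    have F: "dps (d1 c) ?z ?w = 0" "dps (d2 c) ?z ?w = 0"
      using u1 u2 yb crit unfolding has_dps_def by (metis of_real_0)+
    let ?A = "\<Sum>k\<le>m. d1 c (m - k) k * ?z ^ (m - k) * ?w ^ k"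
    let ?B = "\<Sum>k\<le>m. d2 c (m - k) k * ?z ^ (m - k) * ?w ^ k"
    have \<rho>R: "\<rho> \<le> R / 2" using \<rho>d d(2) by linarith
    have "norm ?A \<le> K1 * \<rho> ^ Suc m" "norm ?B \<le> K2 * \<rho> ^ Suc m"
      using K1(2)[OF zw \<rho>R] K2(2)[OF zw \<rho>R] unfolding F by (simp_all only: diff_0 norm_minus_cancel)
    then have AB: "norm (?A - \<i> * ?B) \<le> (K1 + K2) * \<rho> ^ Suc m"
      using norm_triangle_ineq4[of ?A "\<i> * ?B"] by (simp only: norm_mult norm_ii mult_1 distrib_right)
    have "?A - \<i> * ?B = (\<Sum>k\<le>m. q (m - k) k * ?z ^ (m - k) * ?w ^ k)"
      unfolding q_def sum_distrib_left sum_subtractf[symmetric] by (simp only: left_diff_distrib mult.assoc)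
    also have "\<dots> = (\<Sum>k\<le>m. \<kappa> * (of_nat (m choose k) * (\<i> * ?w) ^ k * ?z ^ (m - k)))"
      by (rule sum.cong[OF refl]) (use qm in \<open>simp add: power_mult_distrib mult_ac del: of_real_diff\<close>)
    also have "\<dots> = \<kappa> * (\<i> * ?w + ?z) ^ m"
      by (simp only: binomial_ring sum_distrib_left)
    finally have "norm \<kappa> * norm (\<i> * ?w + ?z) ^ m \<le> (K1 + K2) * \<rho> ^ Suc m"
      using AB by (simp only: norm_mult norm_power)
    \<comment> \<open>The offsets are real, so \<open>\<i> * ?w + ?z\<close> has them as its real
      and imaginary parts; its modulus dominates their maximum \<open>\<rho>\<close>.\<close>
    moreover have "\<rho> \<le> norm (\<i> * ?w + ?z)"
      using abs_Re_le_cmod[of "\<i> * ?w + ?z"] abs_Im_le_cmod[of "\<i> * ?w + ?z"] unfolding \<rho>_def by simp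
    then have "norm \<kappa> * \<rho> ^ m \<le> norm \<kappa> * norm (\<i> * ?w + ?z) ^ m"
      using \<rho>0 by (intro mult_left_mono power_mono) auto
    ultimately have "norm \<kappa> * \<rho> ^ m \<le> ((K1 + K2) * \<rho>) * \<rho> ^ m" by (simp add: mult_ac)
    then have "norm \<kappa> \<le> (K1 + K2) * \<rho>" using \<rho>0 by simp
    also have "\<dots> < (K1 + K2 + 1) * d"
      using \<rho>d \<rho>0 K1(1) K2(1) by (intro mult_strict_mono') auto
    also have "\<dots> \<le> norm \<kappa>" using d(3) K1(1) K2(1) by (simp add: field_simps)
    finally show False by simp
  qed
  then show ?thesis unfolding eventually_at using d(1) by blast
qed

section \<open>Arcs of critical points\<close>

lemma has_dps_grad:
  assumes "has_dps f p c R" "x \<in> ball p R"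
  shows "(f has_derivative (\<lambda>h. pd 1 f x * h$1 + pd 2 f x * h$2)) (at x)"
  using has_dps_has_derivative[OF assms] unfolding has_dps_pd[OF assms] .

lemma dps_continuous_on:
  assumes c: "dps_converges c R"
  shows "continuous_on (ball 0 R \<times> ball 0 R) (\<lambda>x. dps c (fst x) (snd x))"
proof (intro continuous_at_imp_continuous_on ballI)
  fix x :: "complex \<times> complex" assume x: "x \<in> ball 0 R \<times> ball 0 R"
  obtain z w where zw: "x = (z, w)" by (cases x)
  have "isCont (\<lambda>(z, w). dps c z w) (z, w)"
    using dps_has_derivative[OF c, of z w] x zw by (auto intro: has_derivative_continuous)
  then show "isCont (\<lambda>x. dps c (fst x) (snd x)) x" unfolding zw by (simp add: case_prod_unfold)
qed

text \<open>The inverse function theorem is applied to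
  \<open>(z, w) \<mapsto> (z, dps c z w)\<close>; the second component of the inverse at
  \<open>(z, 0)\<close> is the solution \<open>h z\<close>.\<close>

lemma dps_implicit_function:
  assumes c: "dps_converges c R" and c0: "c 0 0 = 0" "c 0 1 \<noteq> 0" and e: "0 < e"
  obtains \<delta> \<rho> h where "0 < \<delta>" "\<delta> \<le> e" "0 < \<rho>" "\<rho> \<le> e" "\<delta> < R" "\<rho> < R"
    "h holomorphic_on ball 0 \<delta>" "h ` ball 0 \<delta> \<subseteq> ball 0 \<rho>"
    "\<And>z w. z \<in> ball 0 \<delta> \<Longrightarrow> w \<in> ball 0 \<rho> \<Longrightarrow> dps c z w = 0 \<longleftrightarrow> w = h z"
proof -
  have R: "R > 0" using c unfolding dps_converges_def by blast
  define r where "r = R / 2"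
  have r: "0 < r" "r < R" unfolding r_def using R by auto
  define A where "A x = dps (d1 c) (fst x) (snd x)" for x
  define B where "B x = dps (d2 c) (fst x) (snd x)" for x
  define U where "U = ball (0::complex) r \<times> ball (0::complex) r"
  define f where "f x = (fst x, dps c (fst x) (snd x))" for x
  define f' where "f' x = Blinfun (\<lambda>h. (fst h, A x * fst h + B x * snd h))" for x
  have app: "blinfun_apply (f' x) = (\<lambda>h. (fst h, A x * fst h + B x * snd h))" for x
  proof -
    have "bounded_linear (\<lambda>h :: complex \<times> complex. (fst h, A x * fst h + B x * snd h))"
      by (intro bounded_linear_Pair bounded_linear_fst bounded_linear_add bounded_linear_mult_const
          bounded_linear_const_mult bounded_linear_snd)
    then show ?thesis unfolding f'_def by (rule bounded_linear_Blinfun_apply)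
  qed
  have "open U" unfolding U_def by (intro open_Times open_ball)
  have Un: "norm (fst x) < r" "norm (snd x) < r" if "x \<in> U" for x
    using that unfolding U_def by (auto simp: mem_Times_iff)
  have fder: "(f has_derivative blinfun_apply (f' x)) (at x)" if "x \<in> U" for x
  proof -
    obtain z w where zw: "x = (z, w)" by (cases x)
    have "((\<lambda>(z, w). dps c z w) has_derivative (\<lambda>(h, k). dps (d1 c) z w * h + dps (d2 c) z w * k)) (at (z, w))"
      by (rule dps_has_derivative[OF c]) (use Un[OF that] r zw in auto)
    then have "((\<lambda>x. (fst x, (\<lambda>(z, w). dps c z w) x)) has_derivative
        (\<lambda>h. (fst h, (\<lambda>(h, k). dps (d1 c) z w * h + dps (d2 c) z w * k) h))) (at x)"
      unfolding zw by (intro has_derivative_Pair has_derivative_fst has_derivative_ident)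
    then show ?thesis unfolding app f_def[abs_def] A_def B_def zw by (simp add: case_prod_unfold)
  qed
  have Acont: "continuous_on U A"
    unfolding A_def U_def by (rule dps_continuous_on[OF dps_converges_d1[OF c r]])
  have Bcont: "continuous_on U B"
    unfolding B_def U_def by (rule dps_continuous_on[OF dps_converges_d2[OF c r]])
  have f'cont: "continuous_on U f'"
    by (rule continuous_on_blinfun_componentwise)
      (simp only: app, intro continuous_intros Acont Bcont)
  have "(0, 0) \<in> U" unfolding U_def using r by simp
  have B0: "B (0, 0) \<noteq> 0" unfolding B_def using c0 by (simp add: d2_def)
  \<comment> \<open>The inverse of the derivative at the origin, which exists because the
    \<open>w\<close>-derivative there, \<open>c 0 1\<close>, is nonzero.\<close>
  define g0 where "g0 = Blinfun (\<lambda>h :: complex \<times> complex. (fst h, (snd h - A (0, 0) * fst h) / B (0, 0)))"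
  have "bounded_linear (\<lambda>h :: complex \<times> complex. (fst h, (snd h - A (0, 0) * fst h) / B (0, 0)))"
    unfolding divide_inverse
    by (intro bounded_linear_Pair bounded_linear_fst bounded_linear_sub bounded_linear_mult_const
        bounded_linear_const_mult bounded_linear_snd)
  then have g0: "blinfun_apply g0 = (\<lambda>h. (fst h, (snd h - A (0, 0) * fst h) / B (0, 0)))"
    unfolding g0_def by (rule bounded_linear_Blinfun_apply)
  have inv: "g0 o\<^sub>L f' (0, 0) = id_blinfun"
    by (rule blinfun_eqI) (simp add: g0 app B0 prod_eq_iff)
  obtain U' V g g' where g: "open U'" "U' \<subseteq> U" "(0, 0) \<in> U'" "open V" "f (0, 0) \<in> V" "homeomorphism U' V f g"
    and g': "\<And>y. y \<in> V \<Longrightarrow> (g has_derivative (g' y)) (at y)"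
    "\<And>y. y \<in> V \<Longrightarrow> g' y = inv (blinfun_apply (f' (g y)))"
    "\<And>y. y \<in> V \<Longrightarrow> bij (blinfun_apply (f' (g y)))"
    by (rule inverse_function_theorem[OF \<open>open U\<close> fder f'cont \<open>(0, 0) \<in> U\<close> inv]) blast+
  have f0: "f (0, 0) = (0, 0)" unfolding f_def using c0 by simp
  have gf: "g (f x) = x" if "x \<in> U'" for x using homeomorphism_apply1[OF g(6) that] .
  have fg: "f (g y) = y" if "y \<in> V" for y using homeomorphism_apply2[OF g(6) that] .
  define h where "h z = snd (g (z, 0))" for z
  have gh: "g (z, 0) = (z, h z)" if "(z, 0) \<in> V" for z
  proof -
    have "fst (g (z, 0)) = z" using fg[OF that] unfolding f_def by simp
    then show ?thesis unfolding h_def by (simp add: prod_eq_iff)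
  qed
  have h0: "h 0 = 0" unfolding h_def using gf[OF g(3)] f0 by simp
  \<comment> \<open>The inverse function theorem is a statement over the reals. Computing the
    inverse of the derivative shows that it acts on the \<open>z\<close>-direction as multiplication
    by \<open>- A / B\<close>, so \<open>h\<close> is holomorphic. Bijectivity of the derivative
    forces \<open>B\<close> to be nonzero.\<close>
  have hder: "(h has_field_derivative (- A (g (z, 0)) / B (g (z, 0)))) (at z)" if zV: "(z, 0) \<in> V" for z
  proof -
    let ?F = "blinfun_apply (f' (g (z, 0)))"
    have bij: "bij ?F" using g'(3)[OF zV] .
    have Bnz: "B (g (z, 0)) \<noteq> 0"
    proof
      assume "B (g (z, 0)) = 0"
      then have "?F (0, 1) = ?F (0, 0)" by (simp add: app)
      then have "(0 :: complex, 1 :: complex) = (0, 0)" by (rule injD[OF bij_is_inj[OF bij]])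
      then show False by simp
    qed
    have "inv ?F (v, 0) = (v, - A (g (z, 0)) / B (g (z, 0)) * v)" for v
      by (rule inv_f_eq) (use bij bij_is_inj Bnz in \<open>auto simp: app field_simps\<close>)
    then have g'v: "g' (z, 0) (v, 0) = (v, - A (g (z, 0)) / B (g (z, 0)) * v)" for v
      using g'(2)[OF zV] by simp
    have lin: "((\<lambda>z. (z, 0 :: complex)) has_derivative (\<lambda>v. (v, 0))) (at z)"
      by (intro has_derivative_Pair has_derivative_ident has_derivative_const)
    have "((g \<circ> (\<lambda>z. (z, 0))) has_derivative (g' (z, 0) \<circ> (\<lambda>v. (v, 0)))) (at z)"
      by (rule diff_chain_at[OF lin]) (use g'(1)[OF zV] in simp)
    then have "((\<lambda>z. snd ((g \<circ> (\<lambda>z. (z, 0))) z)) has_derivative (\<lambda>v. snd ((g' (z, 0) \<circ> (\<lambda>v. (v, 0))) v))) (at z)"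
      by (rule has_derivative_snd)
    then show ?thesis unfolding has_field_derivative_def h_def o_def
      by (rule has_derivative_eq_rhs) (simp add: g'v fun_eq_iff)
  qed
  obtain \<rho>0 where \<rho>0: "\<rho>0 > 0" "ball 0 \<rho>0 \<times> ball 0 \<rho>0 \<subseteq> U'"
  proof -
    obtain X Y where XY: "open X" "open Y" "(0, 0) \<in> X \<times> Y" "X \<times> Y \<subseteq> U'"
      using open_prod_elim[OF g(1,3)] by blast
    obtain a b where "a > 0" "ball 0 a \<subseteq> X" "b > 0" "ball 0 b \<subseteq> Y"
      using XY openE by (metis mem_Sigma_iff)
    then have "min a b > 0" "ball 0 (min a b) \<times> ball 0 (min a b) \<subseteq> U'"
      using XY(4) by (auto simp: subset_iff)
    then show ?thesis using that by blast
  qed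
  define \<rho> where "\<rho> = min (min \<rho>0 e) r"
  have \<rho>: "\<rho> > 0" "\<rho> \<le> \<rho>0" "\<rho> \<le> e" "\<rho> < R" unfolding \<rho>_def using \<rho>0 e r by auto
  have "(\<lambda>z::complex. (z, 0 :: complex)) -` V \<inter> UNIV = {z. (z, 0) \<in> V}" by auto
  moreover have "open ((\<lambda>z::complex. (z, 0 :: complex)) -` V)"
    by (intro open_vimage g(4) continuous_intros)
  ultimately have "open {z. (z, 0) \<in> V}" by simp
  then obtain \<delta>0 where \<delta>0: "\<delta>0 > 0" "ball 0 \<delta>0 \<subseteq> {z. (z, 0) \<in> V}"
    using g(5) f0 openE[of "{z. (z, 0) \<in> V}" 0] by auto
  have "isCont h 0" using hder[of 0] g(5) f0 by (auto intro: DERIV_isCont)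
  then obtain \<delta>1 where \<delta>1: "\<delta>1 > 0" "\<And>z. dist z 0 < \<delta>1 \<Longrightarrow> dist (h z) (h 0) < \<rho>"
    using \<rho>(1) unfolding continuous_at_eps_delta by blast
  define \<delta> where "\<delta> = min (min \<delta>0 \<delta>1) \<rho>"
  have \<delta>: "\<delta> > 0" "\<delta> \<le> \<delta>0" "\<delta> \<le> \<delta>1" "\<delta> \<le> \<rho>" unfolding \<delta>_def using \<delta>0 \<delta>1 \<rho> by auto
  have V: "(z, 0) \<in> V" if "z \<in> ball 0 \<delta>" for z
  proof -
    have "z \<in> ball 0 \<delta>0" using that \<delta>(2) by simp
    then show ?thesis using \<delta>0(2) by blast
  qed
  show thesis
  proof (rule that[of \<delta> \<rho> h])
    show "h holomorphic_on ball 0 \<delta>"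
      using hder V by (meson field_differentiable_at_within field_differentiable_def holomorphic_onI)
    show "h ` ball 0 \<delta> \<subseteq> ball 0 \<rho>"
      using \<delta>1(2) \<delta>(3) h0 by (auto simp: dist_commute)
    fix z w :: complex assume z: "z \<in> ball 0 \<delta>" and w: "w \<in> ball 0 \<rho>"
    show "dps c z w = 0 \<longleftrightarrow> w = h z"
    proof
      assume "dps c z w = 0"
      moreover have "(z, w) \<in> U'" using z w \<rho> \<delta> \<rho>0(2) by auto
      ultimately have "g (z, 0) = (z, w)" using gf[of "(z, w)"] unfolding f_def by simp
      then show "w = h z" unfolding h_def by simp
    next
      assume "w = h z"
      then show "dps c z w = 0" using fg[OF V[OF z]] gh[OF V[OF z]] unfolding f_def by simp
    qed
  qed (use \<rho> \<delta> in auto)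
qed

text \<open>The mean value theorem, applied first to \<open>f\<close> and then to \<open>f'\<close>.
  It is used on segments parallel to an axis, with \<open>m\<close> the point where the segment
  meets an arc of critical points.\<close>

lemma second_derivative_nonpos_max:
  fixes f :: "real \<Rightarrow> real"
  assumes f: "\<And>s. s \<in> {a<..<b} \<Longrightarrow> (f has_real_derivative f' s) (at s)"
    and f': "\<And>s. s \<in> {a<..<b} \<Longrightarrow> (f' has_real_derivative f'' s) (at s)"
    and f'': "\<And>s. s \<in> {a<..<b} \<Longrightarrow> f'' s \<le> 0"
    and m: "m \<in> {a<..<b}" "f' m = 0" and t: "t \<in> {a<..<b}"
  shows "f t \<le> f m"
proof (rule linorder_cases[of t m])
  assume tm: "t < m"
  then obtain z where z: "z > t" "z < m" "f m - f t = (m - t) * f' z"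
    using MVT2[OF tm, of f f'] f m t by auto
  moreover obtain y where "y > z" "y < m" "f' m - f' z = (m - z) * f'' y"
    using MVT2[OF z(2), of f' f''] f' m t z by auto
  moreover have "(m - z) * f'' y \<le> 0"
    using calculation f''[of y] m t by (intro mult_nonneg_nonpos) auto
  ultimately show ?thesis using tm m(2) by (smt (verit) mult_nonneg_nonneg)
next
  assume mt: "m < t"
  then obtain z where z: "z > m" "z < t" "f t - f m = (t - m) * f' z"
    using MVT2[OF mt, of f f'] f m t by auto
  moreover obtain y where "y > m" "y < z" "f' z - f' m = (z - m) * f'' y"
    using MVT2[OF z(1), of f' f''] f' m t z by auto
  moreover have "(z - m) * f'' y \<le> 0"
    using calculation f''[of y] m t by (intro mult_nonneg_nonpos) auto
  ultimately show ?thesis using mt m(2) by (smt (verit) mult_nonneg_nonpos)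
qed simp

definition critical :: "(real^2 \<Rightarrow> real) \<Rightarrow> real^2 \<Rightarrow> bool" where
  "critical u x \<longleftrightarrow> pd 1 u x = 0 \<and> pd 2 u x = 0"

lemma pd_line:
  assumes "has_dps f p c R" "x + t *\<^sub>R axis k 1 \<in> ball p R"
  shows "((\<lambda>t. f (x + t *\<^sub>R axis k 1)) has_real_derivative pd k f (x + t *\<^sub>R axis k 1)) (at t)"
proof -
  let ?y = "x + t *\<^sub>R axis k 1"
  have lin: "((\<lambda>t. x + t *\<^sub>R axis k 1) has_derivative (\<lambda>h. h *\<^sub>R axis k 1)) (at t)"
    by (auto intro!: derivative_eq_intros)
  have "((f \<circ> (\<lambda>t. x + t *\<^sub>R axis k 1)) has_derivative
      ((\<lambda>h. pd 1 f ?y * h$1 + pd 2 f ?y * h$2) \<circ> (\<lambda>h. h *\<^sub>R axis k 1))) (at t)"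
    by (rule diff_chain_at[OF lin has_dps_grad[OF assms]])
  then show ?thesis unfolding has_field_derivative_def o_def
    by (rule has_derivative_eq_rhs) (use exhaust_2[of k] in \<open>auto simp: fun_eq_iff\<close>)
qed

text \<open>The equation \<open>pd 2 u = 0\<close> is solved over the complex numbers by a holomorphic curve. On it \<open>pd 1 u\<close>
  has zeros accumulating at \<open>p\<close> and hence vanishes.\<close>

lemma critical_arc_2:
  assumes u: "has_dps u p c R" and p: "critical u p"
    and nondeg: "pd 2 (pd 2 u) p \<noteq> 0" and lim: "p islimpt {x. critical u x}"
    and W: "open W" "p \<in> W"
  shows "\<exists>N. open N \<and> p \<in> N \<and> N \<subseteq> W \<and> {x\<in>N. critical u x} homeomorphic (UNIV :: real set) \<and>
    (\<forall>x\<in>N. critical u x \<longrightarrow> u x = u p) \<and> ((\<forall>x\<in>N. u x \<le> u p) \<or> (\<forall>x\<in>N. u p \<le> u x))"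
proof -
  have R: "R > 0" using has_dps_pos[OF u] .
  define R1 where "R1 = R / 2"
  have R1: "0 < R1" "R1 < R" "0 < R1 / 2" "R1 / 2 < R1" unfolding R1_def using R by auto
  note u1 = has_dps_pd1[OF u R1(1,2)] and u2 = has_dps_pd2[OF u R1(1,2)]
  note u22 = has_dps_pd2[OF u2 R1(3,4)]
  have conv: "dps_converges c R" "dps_converges (d1 c) R1" "dps_converges (d2 c) R1"
    using u u1 u2 unfolding has_dps_def by auto
  have at_p: "complex_of_real (f p) = b 0 0" if "has_dps f p b r" for f b r
  proof -
    have "complex_of_real (f p) = dps b (of_real (p$1 - p$1)) (of_real (p$2 - p$2))"
      using that has_dps_pos[OF that] unfolding has_dps_def by auto
    then show ?thesis by simp
  qed
  have "d2 c 0 0 = 0" using at_p[OF u2] p unfolding critical_def by simp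
  moreover have "d2 c 0 1 \<noteq> 0" using at_p[OF u22] nondeg by (auto simp: d2_def)
  moreover
  have "isCont (pd 2 (pd 2 u)) p"
    using has_dps_has_derivative[OF u22, of p] R1(3) by (auto intro: has_derivative_continuous)
  then obtain e0 where e0: "e0 > 0" "\<And>x. dist x p < e0 \<Longrightarrow> dist (pd 2 (pd 2 u) x) (pd 2 (pd 2 u) p) < \<bar>pd 2 (pd 2 u) p\<bar>"
    using nondeg unfolding continuous_at_eps_delta by (metis zero_less_abs_iff)
  obtain e1 where e1: "e1 > 0" "ball p e1 \<subseteq> W" using W openE by blast
  \<comment> \<open>Points of the box \<open>N\<close> lie within
    \<open>\<delta> + \<rho> < 3 * e\<close> of \<open>p\<close>. This keeps \<open>N\<close> inside
    \<open>W\<close> and the discs of expansion, and inside the region where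
    \<open>pd 2 (pd 2 u)\<close> has the sign it has at \<open>p\<close>.\<close>
  define e where "e = min (min e0 e1) (R1 / 2) / 3"
  have e: "0 < e" "3 * e \<le> e0" "3 * e \<le> e1" "3 * e \<le> R1 / 2"
    unfolding e_def using e0(1) e1(1) R1 by auto
  ultimately obtain \<delta> \<rho> h where \<delta>\<rho>: "0 < \<delta>" "\<delta> \<le> e" "0 < \<rho>" "\<rho> \<le> e" "\<delta> < R1" "\<rho> < R1"
    and h: "h holomorphic_on ball 0 \<delta>" "h ` ball 0 \<delta> \<subseteq> ball 0 \<rho>"
    and hz: "\<And>z w. z \<in> ball 0 \<delta> \<Longrightarrow> w \<in> ball 0 \<rho> \<Longrightarrow> dps (d2 c) z w = 0 \<longleftrightarrow> w = h z"
    using dps_implicit_function[OF conv(3), of e] by metis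
  define N where "N = {x::real^2. \<bar>x$1 - p$1\<bar> < \<delta> \<and> \<bar>x$2 - p$2\<bar> < \<rho>}"
  have "open N" unfolding N_def
    by (intro open_Collect_conj open_Collect_less continuous_intros)
  have "p \<in> N" unfolding N_def using \<delta>\<rho> by simp
  have N3: "dist x p < 3 * e" if "x \<in> N" for x
  proof -
    have "norm (x - p) \<le> (\<Sum>i\<in>UNIV. \<bar>(x - p)$i\<bar>)" by (rule norm_le_l1_cart)
    then show ?thesis using that \<delta>\<rho> e(1) unfolding N_def by (simp add: sum_2 dist_norm)
  qed
  have NW: "N \<subseteq> W" using N3 e(3) e1(2) by (force simp: dist_commute)
  have NR1: "x \<in> ball p R1" and NR: "x \<in> ball p R" if "x \<in> N" for x
    using N3[OF that] e(4) R1 by (auto simp: dist_commute)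
  have Nz: "complex_of_real (x$1 - p$1) \<in> ball 0 \<delta>" "complex_of_real (x$2 - p$2) \<in> ball 0 \<rho>" if "x \<in> N" for x
    using that unfolding N_def mem_ball_0 norm_of_real by auto
  have pd1N: "complex_of_real (pd 1 u x) = dps (d1 c) (of_real (x$1 - p$1)) (of_real (x$2 - p$2))" if "x \<in> N" for x
    using u1 NR1[OF that] unfolding has_dps_def by blast
  have pd2N: "complex_of_real (pd 2 u x) = dps (d2 c) (of_real (x$1 - p$1)) (of_real (x$2 - p$2))" if "x \<in> N" for x
    using u2 NR1[OF that] unfolding has_dps_def by blast
  have pd2_iff: "pd 2 u x = 0 \<longleftrightarrow> complex_of_real (x$2 - p$2) = h (of_real (x$1 - p$1))" if "x \<in> N" for x
    using hz[OF Nz[OF that]] pd2N[OF that] by (metis of_real_eq_0_iff)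
  have h0: "h 0 = 0" using pd2_iff[OF \<open>p \<in> N\<close>] p unfolding critical_def by simp
  have hb: "norm (h z) < \<rho>" if "z \<in> ball 0 \<delta>" for z
  proof -
    have "h z \<in> ball 0 \<rho>" using h(2) that by blast
    then show ?thesis by simp
  qed
  have hd: "(h has_field_derivative deriv h z) (at z)" if "z \<in> ball 0 \<delta>" for z
    using h(1) that by (simp add: holomorphic_derivI)
  define G where "G z = dps (d1 c) z (h z)" for z
  have G_hol: "G holomorphic_on ball 0 \<delta>"
  proof -
    have "(G has_field_derivative (dps (d1 (d1 c)) z (h z) * 1 + dps (d2 (d1 c)) z (h z) * deriv h z)) (at z)"
      if z: "z \<in> ball 0 \<delta>" for z
      unfolding G_def
      by (rule dps_compose_has_field_derivative[OF conv(2) _ _ DERIV_ident hd[OF z]])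
        (use z hb[OF z] \<delta>\<rho> in auto)
    then show ?thesis
      by (meson field_differentiable_at_within field_differentiable_def holomorphic_onI)
  qed
  \<comment> \<open>Critical points near \<open>p\<close> lie on the graph of \<open>h\<close>.
    Their first offset is nonzero, since offset 0 would give the second offset
    \<open>h 0 = 0\<close> and hence the point \<open>p\<close>.\<close>
  have lim0: "0 islimpt {z \<in> ball 0 \<delta>. G z = 0}"
    unfolding islimpt_approachable
  proof (intro allI impI)
    fix \<epsilon> :: real assume "\<epsilon> > 0"
    have "p \<in> N \<inter> ball p \<epsilon>" "open (N \<inter> ball p \<epsilon>)" using \<open>p \<in> N\<close> \<open>open N\<close> \<open>\<epsilon> > 0\<close> by auto
    then obtain x where x: "critical u x" "x \<in> N" "dist p x < \<epsilon>" "x \<noteq> p"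
      using lim unfolding islimpt_def by (metis IntE mem_Collect_eq mem_ball)
    let ?z = "complex_of_real (x$1 - p$1)"
    have hx: "complex_of_real (x$2 - p$2) = h ?z" using pd2_iff[OF x(2)] x(1) unfolding critical_def by blast
    have "?z \<noteq> 0"
    proof
      assume z0: "?z = 0"
      then have "complex_of_real (x$2 - p$2) = 0" using hx h0 by simp
      then have "x$1 = p$1" "x$2 = p$2" using z0 by simp_all
      then show False using x(4) by (simp add: vec_eq_iff forall_2)
    qed
    moreover have "G ?z = 0" unfolding G_def hx[symmetric] using pd1N[OF x(2)] x(1) unfolding critical_def by simp
    moreover have "dist ?z 0 < \<epsilon>"
      using component_le_norm_cart[of "x - p" 1] x(3) unfolding dist_norm[of ?z] diff_0_right norm_of_real
      by (simp add: dist_norm norm_minus_commute)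
    ultimately show "\<exists>z\<in>{z \<in> ball 0 \<delta>. G z = 0}. z \<noteq> 0 \<and> dist z 0 < \<epsilon>" using Nz(1)[OF x(2)] by blast
  qed
  have G0: "G z = 0" if "z \<in> ball 0 \<delta>" for z
    by (rule analytic_continuation[OF G_hol open_ball connected_ball _ _ lim0])
      (use that \<delta>\<rho>(1) in auto)
  define \<eta> where "\<eta> s = Re (h (of_real s))" for s
  \<comment> \<open>The equation has real coefficients, so for real \<open>s\<close> the conjugate
    of \<open>h s\<close> is again a solution in the disc; uniqueness makes \<open>h s\<close>
    real.\<close>
  have real: "complex_of_real (\<eta> s) = h (of_real s)" if "\<bar>s\<bar> < \<delta>" for s
  proof -
    have s: "complex_of_real s \<in> ball 0 \<delta>" using that by simp
    have hs: "h (of_real s) \<in> ball 0 \<rho>" "cnj (h (of_real s)) \<in> ball 0 \<rho>" using hb[OF s] by simp_all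
    have "d2 c i j \<in> \<real>" for i j using has_dps_real_coeffs[OF u2] .
    then have "dps (d2 c) (of_real s) (cnj (h (of_real s))) = cnj (dps (d2 c) (of_real s) (h (of_real s)))"
      using cnj_dps[of "d2 c" "of_real s" "h (of_real s)"] by simp
    also have "\<dots> = 0" using hz[OF s hs(1)] by simp
    finally have "cnj (h (of_real s)) = h (of_real s)" using hz[OF s hs(2)] by simp
    then show ?thesis unfolding \<eta>_def by (simp add: complex_eq_iff)
  qed
  have \<eta>b: "\<bar>\<eta> s\<bar> < \<rho>" if "\<bar>s\<bar> < \<delta>" for s
    using hb[of "of_real s"] that unfolding real[OF that, symmetric] by simp
  define \<gamma> :: "real \<Rightarrow> real^2" where "\<gamma> s = (\<chi> i. if i = 1 then p$1 + s else p$2 + \<eta> s)" for s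
  have \<gamma>nth: "\<gamma> s $ 1 = p$1 + s" "\<gamma> s $ 2 = p$2 + \<eta> s" for s unfolding \<gamma>_def by simp_all
  have \<gamma>N: "\<gamma> s \<in> N" if "\<bar>s\<bar> < \<delta>" for s using that \<eta>b[OF that] unfolding N_def by (simp add: \<gamma>nth)
  have pd2\<gamma>: "pd 2 u (\<gamma> s) = 0" if "\<bar>s\<bar> < \<delta>" for s
    using pd2_iff[OF \<gamma>N[OF that]] real[OF that] by (simp add: \<gamma>nth)
  have pd1\<gamma>: "pd 1 u (\<gamma> s) = 0" if "\<bar>s\<bar> < \<delta>" for s
    using pd1N[OF \<gamma>N[OF that]] G0[of "of_real s"] that real[OF that] by (simp add: \<gamma>nth G_def)
  have on_curve: "x = \<gamma> (x$1 - p$1) \<and> \<bar>x$1 - p$1\<bar> < \<delta>" if "x \<in> N" "pd 2 u x = 0" for x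
  proof -
    have s: "\<bar>x$1 - p$1\<bar> < \<delta>" using that unfolding N_def by simp
    then have "complex_of_real (x$2 - p$2) = complex_of_real (\<eta> (x$1 - p$1))"
      using pd2_iff[OF that(1)] that(2) real by simp
    then have "x$2 - p$2 = \<eta> (x$1 - p$1)" using of_real_eq_iff by blast
    then have "x = \<gamma> (x$1 - p$1)" by (simp add: vec_eq_iff forall_2 \<gamma>nth)
    then show ?thesis using s by simp
  qed
  have \<Gamma>: "{x\<in>N. critical u x} = \<gamma> ` {-\<delta><..<\<delta>}"
  proof (intro equalityI subsetI)
    fix x assume "x \<in> {x\<in>N. critical u x}"
    then show "x \<in> \<gamma> ` {-\<delta><..<\<delta>}" using on_curve[of x] unfolding critical_def
      by (metis (mono_tags, lifting) abs_less_iff greaterThanLessThan_iff image_eqI mem_Collect_eq minus_less_iff)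
  qed (use \<gamma>N pd1\<gamma> pd2\<gamma> in \<open>auto simp: critical_def abs_less_iff\<close>)
  have \<eta>cont: "continuous_on {-\<delta><..<\<delta>} \<eta>"
    unfolding \<eta>_def
    by (intro continuous_intros continuous_on_compose2[OF holomorphic_on_imp_continuous_on[OF h(1)]])
      (auto simp: abs_less_iff)
  have \<gamma>cont: "continuous_on {-\<delta><..<\<delta>} \<gamma>"
    unfolding \<gamma>_def
  proof (rule continuous_on_vec_lambda)
    show "continuous_on {-\<delta><..<\<delta>} (\<lambda>s. if i = 1 then p$1 + s else p$2 + \<eta> s)" for i :: 2
      by (cases "i = 1") (auto intro!: continuous_intros \<eta>cont)
  qed
  have "homeomorphism {-\<delta><..<\<delta>} {x\<in>N. critical u x} \<gamma> (\<lambda>x. x$1 - p$1)"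
    unfolding \<Gamma> by (rule homeomorphismI[OF \<gamma>cont]) (auto intro!: continuous_intros simp: \<gamma>nth)
  then have "{x\<in>N. critical u x} homeomorphic {-\<delta><..<\<delta>}"
    using homeomorphic_def homeomorphic_sym by blast
  then have homeo: "{x\<in>N. critical u x} homeomorphic (UNIV :: real set)"
    using homeomorphic_open_interval_UNIV[of "-\<delta>" \<delta>] \<delta>\<rho>(1) homeomorphic_trans by auto
  \<comment> \<open>Both partial derivatives of \<open>u\<close> vanish along the curve, hence so
    does the derivative of \<open>u\<close> along it.\<close>
  have "\<exists>k. \<forall>z\<in>ball 0 \<delta>. dps c z (h z) = k"
  proof (rule has_field_derivative_zero_constant[OF convex_ball])
    fix z :: complex assume z: "z \<in> ball 0 \<delta>"
    have "((\<lambda>z. dps c z (h z)) has_field_derivative (dps (d1 c) z (h z) * 1 + dps (d2 c) z (h z) * deriv h z)) (at z)"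
      by (rule dps_compose_has_field_derivative[OF conv(1) _ _ DERIV_ident hd[OF z]])
        (use z hb[OF z] \<delta>\<rho> R1 in auto)
    moreover have "dps (d1 c) z (h z) = 0" using G0[OF z] unfolding G_def .
    moreover have "dps (d2 c) z (h z) = 0" using hz[OF z, of "h z"] hb[OF z] by simp
    ultimately show "((\<lambda>z. dps c z (h z)) has_field_derivative 0) (at z within ball 0 \<delta>)"
      by (simp add: has_field_derivative_at_within)
  qed
  then obtain k where k: "\<And>z. z \<in> ball 0 \<delta> \<Longrightarrow> dps c z (h z) = k" by blast
  have u\<gamma>': "complex_of_real (u (\<gamma> s)) = k" if "\<bar>s\<bar> < \<delta>" for s
  proof -
    have "complex_of_real (u (\<gamma> s)) = dps c (of_real s) (h (of_real s))"
      using u NR[OF \<gamma>N[OF that]] unfolding has_dps_def by (simp add: \<gamma>nth real[OF that])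
    then show ?thesis using k[of "of_real s"] that by simp
  qed
  have "\<gamma> 0 = p" using h0 by (simp add: vec_eq_iff forall_2 \<gamma>nth \<eta>_def)
  then have u\<gamma>: "u (\<gamma> s) = u p" if "\<bar>s\<bar> < \<delta>" for s
    using u\<gamma>'[OF that] u\<gamma>'[of 0] \<delta>\<rho>(1) by (metis abs_zero of_real_eq_iff)
  have uconst: "\<forall>x\<in>N. critical u x \<longrightarrow> u x = u p"
    using on_curve u\<gamma> unfolding critical_def by metis
  have vert: "x + (t - x$2) *\<^sub>R axis 2 1 \<in> N" if "x \<in> N" "\<bar>t - p$2\<bar> < \<rho>" for x t
    using that unfolding N_def by simp
  \<comment> \<open>On the vertical segment of \<open>N\<close> through \<open>x\<close>, the
    function is concave and has a zero derivative where the segment meets the curve. Stated for a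
    general \<open>f\<close>, to be applied to \<open>u\<close> and to \<open>- u\<close>.\<close>
  have max: "f x \<le> f (\<gamma> (x$1 - p$1))" if x: "x \<in> N"
    and f: "has_dps f p c' R" "has_dps (pd 2 f) p c'' R1"
    and le: "\<And>y. y \<in> N \<Longrightarrow> pd 2 (pd 2 f) y \<le> 0" and z: "\<And>s. \<bar>s\<bar> < \<delta> \<Longrightarrow> pd 2 f (\<gamma> s) = 0" for f c' c'' x
  proof -
    let ?x0 = "x - (x$2) *\<^sub>R axis 2 1"
    have line: "?x0 + t *\<^sub>R axis 2 1 \<in> N" if "t \<in> {p$2 - \<rho><..<p$2 + \<rho>}" for t
      using vert[OF x, of t] that by (simp add: algebra_simps abs_less_iff)
    have s: "\<bar>x$1 - p$1\<bar> < \<delta>" using x unfolding N_def by simp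
    define m where "m = p$2 + \<eta> (x$1 - p$1)"
    have xm: "?x0 + m *\<^sub>R axis 2 1 = \<gamma> (x$1 - p$1)"
      unfolding m_def by (simp add: vec_eq_iff forall_2 \<gamma>nth)
    have "f (?x0 + (x$2) *\<^sub>R axis 2 1) \<le> f (?x0 + m *\<^sub>R axis 2 1)"
    proof (rule second_derivative_nonpos_max[of "p$2 - \<rho>" "p$2 + \<rho>" "\<lambda>t. f (?x0 + t *\<^sub>R axis 2 1)"
          "\<lambda>t. pd 2 f (?x0 + t *\<^sub>R axis 2 1)" "\<lambda>t. pd 2 (pd 2 f) (?x0 + t *\<^sub>R axis 2 1)"])
      show "m \<in> {p$2 - \<rho><..<p$2 + \<rho>}" unfolding m_def using \<eta>b[OF s] by (auto simp: abs_less_iff)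
      show "x$2 \<in> {p$2 - \<rho><..<p$2 + \<rho>}" using x unfolding N_def by (auto simp: abs_less_iff)
      show "pd 2 f (?x0 + m *\<^sub>R axis 2 1) = 0" unfolding xm using z[OF s] .
    qed (use pd_line[OF f(1)] pd_line[OF f(2)] le line NR NR1 in blast)+
    then show ?thesis unfolding xm by simp
  qed
  have ext: "(\<forall>x\<in>N. u x \<le> u p) \<or> (\<forall>x\<in>N. u p \<le> u x)"
  proof (cases "pd 2 (pd 2 u) p < 0")
    case True
    have "pd 2 (pd 2 u) y \<le> 0" if "y \<in> N" for y
      using e0(2)[of y] N3[OF that] e(2) True by (auto simp: dist_real_def)
    then have "u x \<le> u p" if "x \<in> N" for x
      using max[OF that u u2 _ pd2\<gamma>] u\<gamma>[of "x$1 - p$1"] that unfolding N_def by auto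
    then show ?thesis by blast
  next
    case False
    \<comment> \<open>Here \<open>pd 2 (pd 2 u) p > 0\<close>. The negative of \<open>u\<close> is
      written as a multiple so that \<open>has_dps_cmult\<close> provides its expansion.\<close>
    let ?v = "\<lambda>x. (-1) * u x"
    note v = has_dps_cmult[OF u, of "-1"]
    have pdv: "pd 2 ?v y = - pd 2 u y" if "y \<in> ball p R" for y
    proof -
      have "(?v has_derivative (\<lambda>h. (-1) * (pd 1 u y * h$1 + pd 2 u y * h$2))) (at y)"
        by (intro has_derivative_mult_right has_dps_grad[OF u that])
      from frechet_derivative_at[OF this, symmetric] show ?thesis unfolding pd_def by simp
    qed
    have pdv2: "pd 2 (pd 2 ?v) y = - pd 2 (pd 2 u) y" if "y \<in> N" for y
    proof -
      have "((\<lambda>y. - pd 2 u y) has_derivative (\<lambda>h. - (pd 1 (pd 2 u) y * h$1 + pd 2 (pd 2 u) y * h$2))) (at y)"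
        by (intro has_derivative_minus has_dps_grad[OF u2 NR1[OF that]])
      then have "(pd 2 ?v has_derivative (\<lambda>h. - (pd 1 (pd 2 u) y * h$1 + pd 2 (pd 2 u) y * h$2))) (at y)"
        by (rule has_derivative_transform_within_open[OF _ open_ball NR[OF that]]) (rule pdv[symmetric])
      from frechet_derivative_at[OF this, symmetric] show ?thesis unfolding pd_def by simp
    qed
    have "pd 2 (pd 2 ?v) y \<le> 0" if "y \<in> N" for y
      using e0(2)[of y] N3[OF that] e(2) False pdv2[OF that] by (auto simp: dist_real_def)
    moreover have "pd 2 ?v (\<gamma> s) = 0" if "\<bar>s\<bar> < \<delta>" for s
      using pdv[OF NR[OF \<gamma>N[OF that]]] pd2\<gamma>[OF that] by simp
    ultimately have "?v x \<le> ?v (\<gamma> (x$1 - p$1))" if "x \<in> N" for x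
      by (intro max[OF that v has_dps_pd2[OF v R1(1,2)]])
    then have "u p \<le> u x" if "x \<in> N" for x
      using u\<gamma>[of "x$1 - p$1"] that unfolding N_def by fastforce
    then show ?thesis by blast
  qed
  show ?thesis using \<open>open N\<close> \<open>p \<in> N\<close> NW homeo uconst ext by blast
qed

section \<open>Exchange of the coordinates\<close>

definition swap2 :: "real^2 \<Rightarrow> real^2" where
  "swap2 x = (\<chi> i. if i = 1 then x$2 else x$1)"

lemma swap2_nth [simp]: "swap2 x $ 1 = x$2" "swap2 x $ 2 = x$1"
  and swap2_swap2 [simp]: "swap2 (swap2 x) = x"
  by (simp_all add: swap2_def vec_eq_iff forall_2)

lemma bounded_linear_swap2: "bounded_linear swap2"
proof -
  have "linear swap2" by (rule linearI) (simp_all add: vec_eq_iff forall_2)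
  then show ?thesis by (rule linear_conv_bounded_linear[THEN iffD1])
qed

lemma dist_swap2 [simp]: "dist (swap2 x) (swap2 y) = dist x y"
  unfolding dist_norm norm_vec_def L2_set_def by (simp add: sum_2 add.commute)

lemma swap2_in_ball_iff: "swap2 x \<in> ball p r \<longleftrightarrow> x \<in> ball (swap2 p) r"
  using dist_swap2[of p "swap2 x"] by simp

lemma continuous_on_swap2: "continuous_on S swap2"
  using bounded_linear_swap2 by (rule linear_continuous_on)

lemma has_dps_swap2:
  assumes "has_dps f p c R"
  shows "has_dps (\<lambda>x. f (swap2 x)) (swap2 p) (dps_swap c) R"
proof -
  have "complex_of_real (f (swap2 x)) = dps (dps_swap c) (of_real (x$1 - swap2 p$1)) (of_real (x$2 - swap2 p$2))"
    if "x \<in> ball (swap2 p) R" for x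
  proof -
    have "swap2 x \<in> ball p R" using that swap2_in_ball_iff by blast
    then have "complex_of_real (f (swap2 x)) = dps c (of_real (x$2 - p$1)) (of_real (x$1 - p$2))"
      using assms unfolding has_dps_def by (metis swap2_nth)
    then show ?thesis by (simp add: dps_dps_swap)
  qed
  then show ?thesis using assms unfolding has_dps_def by (simp add: dps_swap_def[of c] del: of_real_diff)
qed

lemma pd_swap2:
  assumes f: "(f has_derivative (\<lambda>h. pd 1 f (swap2 x) * h$1 + pd 2 f (swap2 x) * h$2)) (at (swap2 x))"
    and g: "open S" "x \<in> S" "\<And>y. y \<in> S \<Longrightarrow> g y = f (swap2 y)"
  shows "pd 1 g x = pd 2 f (swap2 x)" and "pd 2 g x = pd 1 f (swap2 x)"
proof -
  have "((f \<circ> swap2) has_derivative ((\<lambda>h. pd 1 f (swap2 x) * h$1 + pd 2 f (swap2 x) * h$2) \<circ> swap2)) (at x)"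
    by (rule diff_chain_at[OF bounded_linear_imp_has_derivative[OF bounded_linear_swap2] f])
  then have "(g has_derivative ((\<lambda>h. pd 1 f (swap2 x) * h$1 + pd 2 f (swap2 x) * h$2) \<circ> swap2)) (at x)"
    by (rule has_derivative_transform_within_open[OF _ g(1,2)]) (simp add: g(3))
  from frechet_derivative_at[OF this, symmetric]
  show "pd 1 g x = pd 2 f (swap2 x)" "pd 2 g x = pd 1 f (swap2 x)" unfolding pd_def by simp_all
qed

text \<open>Reflection in the diagonal carries this to \<open>critical_arc_2\<close>: it permutes
  the partial derivatives and preserves distances, hence also the discs of expansion.\<close>

lemma critical_arc_1:
  assumes u: "has_dps u p c R" and p: "critical u p"
    and nondeg: "pd 1 (pd 1 u) p \<noteq> 0" and lim: "p islimpt {x. critical u x}"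
    and W: "open W" "p \<in> W"
  shows "\<exists>N. open N \<and> p \<in> N \<and> N \<subseteq> W \<and> {x\<in>N. critical u x} homeomorphic (UNIV :: real set) \<and>
    (\<forall>x\<in>N. critical u x \<longrightarrow> u x = u p) \<and> ((\<forall>x\<in>N. u x \<le> u p) \<or> (\<forall>x\<in>N. u p \<le> u x))"
proof -
  have R: "R > 0" using has_dps_pos[OF u] .
  define v where "v x = u (swap2 x)" for x
  define q where "q = swap2 p"
  have v: "has_dps v q (dps_swap c) R" unfolding v_def q_def by (rule has_dps_swap2[OF u])
  have pdv: "pd 1 v x = pd 2 u (swap2 x)" "pd 2 v x = pd 1 u (swap2 x)" if "x \<in> ball q R" for x
    by (rule pd_swap2[OF has_dps_grad[OF u], of x UNIV]; use that swap2_in_ball_iff in \<open>auto simp: v_def q_def\<close>)+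
  have crit: "critical v x \<longleftrightarrow> critical u (swap2 x)" if "x \<in> ball q R" for x
    using pdv[OF that] unfolding critical_def by auto
  have qb: "q \<in> ball q R" using R by simp
  have R2: "0 < R / 2" "R / 2 < R" using R by auto
  have "pd 2 (pd 2 v) q = pd 1 (pd 1 u) (swap2 q)"
  proof (rule pd_swap2(2)[OF has_dps_grad[OF has_dps_pd1[OF u R2]] open_ball qb])
    show "swap2 q \<in> ball p (R / 2)" unfolding q_def using R2 by simp
  qed (rule pdv(2))
  then have nd: "pd 2 (pd 2 v) q \<noteq> 0" using nondeg unfolding q_def by simp
  have lim': "q islimpt {x. critical v x}"
    unfolding islimpt_approachable
  proof (intro allI impI)
    fix e :: real assume "e > 0"
    then obtain x where x: "critical u x" "x \<noteq> p" "dist x p < min e R"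
      using lim R unfolding islimpt_approachable by (metis mem_Collect_eq min_less_iff_conj)
    then have "dist (swap2 x) q < min e R" unfolding q_def by simp
    moreover have "swap2 x \<noteq> q" using x(2) unfolding q_def by (metis swap2_swap2)
    moreover have "critical v (swap2 x)"
      using crit[of "swap2 x"] x(1) calculation(1) by (simp add: dist_commute)
    ultimately show "\<exists>y\<in>{x. critical v x}. y \<noteq> q \<and> dist y q < e" by auto
  qed
  define W' where "W' = swap2 -` W \<inter> ball q R"
  have "open W'" unfolding W'_def
    using W(1) continuous_on_swap2[of UNIV] by (intro open_Int open_vimage open_ball) auto
  moreover have "q \<in> W'" unfolding W'_def q_def using W(2) R by simp
  moreover have "critical v q" using crit[OF qb] p unfolding q_def by simp
  ultimately obtain N where N: "open N" "q \<in> N" "N \<subseteq> W'" "{x\<in>N. critical v x} homeomorphic (UNIV :: real set)"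
    "\<forall>x\<in>N. critical v x \<longrightarrow> v x = v q" "(\<forall>x\<in>N. v x \<le> v q) \<or> (\<forall>x\<in>N. v q \<le> v x)"
    using critical_arc_2[OF v _ nd lim', of W'] by blast
  have crN: "critical v x \<longleftrightarrow> critical u (swap2 x)" if "x \<in> N" for x using crit N(3) that unfolding W'_def by blast
  have im: "swap2 ` N = swap2 -` N" by (force intro: image_eqI[of _ swap2 "swap2 _"])
  have "homeomorphism {x\<in>N. critical v x} {x\<in>swap2 ` N. critical u x} swap2 swap2"
    by (rule homeomorphismI[OF continuous_on_swap2 continuous_on_swap2]) (use crN in auto)
  then have "{x\<in>swap2 ` N. critical u x} homeomorphic {x\<in>N. critical v x}"
    using homeomorphic_def homeomorphic_sym by blast
  then have "{x\<in>swap2 ` N. critical u x} homeomorphic (UNIV :: real set)"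
    using N(4) homeomorphic_trans by blast
  moreover have "open (swap2 ` N)" unfolding im
    using N(1) continuous_on_swap2[of UNIV] by (intro open_vimage) auto
  moreover have "p \<in> swap2 ` N" using N(2) unfolding im q_def by simp
  moreover have "swap2 ` N \<subseteq> W" using N(3) unfolding W'_def by auto
  moreover have "\<forall>x\<in>swap2 ` N. critical u x \<longrightarrow> u x = u p" using N(5) crN unfolding v_def q_def by auto
  moreover have "(\<forall>x\<in>swap2 ` N. u x \<le> u p) \<or> (\<forall>x\<in>swap2 ` N. u p \<le> u x)"
    using N(6) unfolding v_def q_def by auto
  ultimately show ?thesis by blast
qed

section \<open>Constants and the second derivative test\<close>

lemma dps_const:
  "((\<lambda>(i, j). (if i = 0 \<and> j = 0 then k else 0) * z ^ i * w ^ j) has_sum (k :: complex)) UNIV"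
  by (rule has_sum_finite_neutralI[of "{(0, 0)}"]) (auto split: if_splits)

lemma has_dps_const: "R > 0 \<Longrightarrow> has_dps (\<lambda>_. k) p (\<lambda>i j. if i = 0 \<and> j = 0 then of_real k else 0) R"
proof -
  assume R: "R > 0"
  have "((\<lambda>(i, j). norm (if i = 0 \<and> j = 0 then complex_of_real k else 0) * R ^ i * R ^ j) has_sum \<bar>k\<bar>) UNIV"
    by (rule has_sum_finite_neutralI[of "{(0, 0)}"]) (auto split: if_splits)
  then have "dps_converges (\<lambda>i j. if i = 0 \<and> j = 0 then of_real k else 0) R"
    unfolding dps_converges_def using R by (auto simp: summable_on_def)
  moreover have "complex_of_real k = dps (\<lambda>i j. if i = 0 \<and> j = 0 then of_real k else 0) z w" for z w
    unfolding dps_def using infsumI[OF dps_const[of "complex_of_real k" z w]] by simp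
  ultimately show ?thesis unfolding has_dps_def by simp
qed

lemma has_dps_identity_const:
  assumes f: "has_dps f p c R" and S: "open S" "S \<noteq> {}" "S \<subseteq> ball p R" "\<And>y. y \<in> S \<Longrightarrow> f y = k"
    and x: "x \<in> ball p R"
  shows "f x = k"
proof -
  obtain q where "q \<in> S" using S by blast
  have "has_dps (\<lambda>x. f x + - k) p (\<lambda>i j. c i j + (if i = 0 \<and> j = 0 then of_real (- k) else 0)) (min R R)"
    by (rule has_dps_add[OF f has_dps_const[OF has_dps_pos[OF f]]])
  then have "f x + - k = 0"
    by (rule has_dps_identity[OF _ S(1) \<open>q \<in> S\<close>]) (use S x in auto)
  then show ?thesis by simp
qed

text \<open>The quadratic term makes the weak maximum principle strict.\<close>

lemma perturbed_local_max_pd_pd: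
  assumes u: "has_dps u p c R"
    and m: "\<forall>\<^sub>F y in nhds p. u y + e * (norm (y - a))\<^sup>2 \<le> u p + e * (norm (p - a))\<^sup>2"
  shows "pd k (pd k u) p + 2 * e \<le> 0"
proof (rule ccontr)
  assume pos: "\<not> pd k (pd k u) p + 2 * e \<le> 0"
  have R: "R > 0" using has_dps_pos[OF u] .
  define r where "r = R / 2"
  have r: "0 < r" "r < R" unfolding r_def using R by auto
  have uk: "\<exists>c'. has_dps (pd k u) p c' r"
    using exhaust_2[of k] has_dps_pd1[OF u r] has_dps_pd2[OF u r] by metis
  then obtain c' where c': "has_dps (pd k u) p c' r" by blast
  let ?l = "\<lambda>t::real. p + t *\<^sub>R axis k (1::real)"
  define F where "F t = u (?l t) + e * ((norm (p - a))\<^sup>2 + 2 * t * (p - a)$k + t\<^sup>2)" for t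
  define F' where "F' t = pd k u (?l t) + e * (2 * (p - a)$k + 2 * t)" for t
  have nrm: "(norm (?l t - a))\<^sup>2 = (norm (p - a))\<^sup>2 + 2 * t * (p - a)$k + t\<^sup>2" for t
  proof -
    have "?l t - a = (p - a) + t *\<^sub>R axis k 1" by simp
    then show ?thesis
      by (simp only: power2_norm_eq_inner)
        (simp add: inner_add_left inner_add_right inner_axis inner_axis' inner_axis_axis power2_eq_square algebra_simps)
  qed
  have F: "F t = u (?l t) + e * (norm (?l t - a))\<^sup>2" for t unfolding F_def nrm ..
  have inb: "?l t \<in> ball p r" if "\<bar>t\<bar> < r" for t using that by (simp add: dist_norm norm_axis_1)
  have D1: "(F has_real_derivative F' t) (at t)" if "\<bar>t\<bar> < r" for t
  proof -
    have "?l t \<in> ball p R" using inb[OF that] r by auto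
    from pd_line[OF u this] show ?thesis
      unfolding F_def F'_def by (auto intro!: derivative_eq_intros)
  qed
  have D2: "(F' has_real_derivative (pd k (pd k u) p + 2 * e)) (at 0)"
  proof -
    have "((\<lambda>t. pd k u (?l t)) has_real_derivative pd k (pd k u) p) (at 0)"
      using pd_line[OF c', of p 0 k] inb[of 0] r by simp
    then show ?thesis unfolding F'_def by (auto intro!: derivative_eq_intros)
  qed
  have "\<forall>\<^sub>F t in nhds 0. F t \<le> F 0"
  proof -
    have "filterlim ?l (nhds p) (nhds 0)"
      using tendsto_add[OF tendsto_const[of p] tendsto_scaleR[OF filterlim_ident[of "nhds (0::real)"] tendsto_const[of "axis k 1"]]]
      by simp
    then have "\<forall>\<^sub>F t in nhds 0. u (?l t) + e * (norm (?l t - a))\<^sup>2 \<le> u p + e * (norm (p - a))\<^sup>2"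
      using m by (rule eventually_compose_filterlim[rotated])
    then show ?thesis unfolding F by simp
  qed
  then obtain d2 where d2: "d2 > 0" "\<And>t. \<bar>t\<bar> < d2 \<Longrightarrow> F t \<le> F 0"
    unfolding eventually_nhds_metric by auto
  have "F' 0 = 0"
    by (rule DERIV_local_max[OF D1 d2(1)]) (use d2(2) r in auto)
  \<comment> \<open>Since \<open>F' 0 = 0\<close> and the derivative of \<open>F'\<close> at 0 is
    positive, \<open>F\<close> rises just to the right of 0, against its local maximum.\<close>
  obtain d1 where d1: "d1 > 0" "\<And>t. t > 0 \<Longrightarrow> t < d1 \<Longrightarrow> F' 0 < F' (0 + t)"
    using DERIV_pos_inc_right[OF D2] pos by (auto simp: not_le)
  define t where "t = min (min d1 d2) r / 2"
  have t: "0 < t" "t < d1" "t < d2" "t < r" unfolding t_def using d1(1) d2(1) r by auto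
  obtain z where z: "z > 0" "z < t" "F t - F 0 = (t - 0) * F' z"
    using MVT2[OF t(1), of F F'] D1 t by auto
  have "F' z > 0" using d1(2)[of z] z t \<open>F' 0 = 0\<close> by simp
  then have "0 < t * F' z" using t(1) by simp
  then show False using z(3) d2(2)[of t] t by simp
qed

lemma pd_cmult:
  assumes f: "has_dps f p c R" and x: "x \<in> ball p R"
  shows "pd k (\<lambda>x. a * f x) x = a * pd k f x" and "pd k (pd k (\<lambda>x. a * f x)) x = a * pd k (pd k f) x"
proof -
  have scale: "pd k (\<lambda>x. a * g x) y = a * pd k g y" if "has_dps g q b S" "y \<in> ball q S" for g q b S y and k
  proof -
    have "((\<lambda>x. a * g x) has_derivative (\<lambda>h. a * (pd 1 g y * h$1 + pd 2 g y * h$2))) (at y)"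
      by (intro has_derivative_mult_right has_dps_grad[OF that])
    from frechet_derivative_at[OF this, symmetric] show ?thesis
      unfolding pd_def[of k "\<lambda>x. a * g x"] using exhaust_2[of k] by auto
  qed
  show "pd k (\<lambda>x. a * f x) x = a * pd k f x" by (rule scale[OF f x])
  define r where "r = (dist p x + R) / 2"
  have r: "0 < r" "r < R" "x \<in> ball p r"
    using x has_dps_pos[OF f] zero_le_dist[of p x] unfolding r_def by (auto simp del: zero_le_dist)
  obtain c' where c': "has_dps (pd k f) p c' r"
    using exhaust_2[of k] has_dps_pd1[OF f r(1,2)] has_dps_pd2[OF f r(1,2)] by metis
  have "((\<lambda>x. a * pd k f x) has_derivative (\<lambda>h. a * (pd 1 (pd k f) x * h$1 + pd 2 (pd k f) x * h$2))) (at x)"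
    by (intro has_derivative_mult_right has_dps_grad[OF c' r(3)])
  then have "(pd k (\<lambda>x. a * f x) has_derivative (\<lambda>h. a * (pd 1 (pd k f) x * h$1 + pd 2 (pd k f) x * h$2))) (at x)"
    by (rule has_derivative_transform_within_open[OF _ open_ball x]) (rule scale[OF f, symmetric])
  from frechet_derivative_at[OF this, symmetric] show "pd k (pd k (\<lambda>x. a * f x)) x = a * pd k (pd k f) x"
    unfolding pd_def[of k "pd k (\<lambda>x. a * f x)"] using exhaust_2[of k] by auto
qed

section \<open>Dirichlet eigenfunctions\<close>

locale analytic_eigenfunction =
  fixes \<Omega> U :: "(real^2) set" and u :: "real^2 \<Rightarrow> real" and lam :: real
  assumes open_\<Omega>: "open \<Omega>" and connected_\<Omega>: "connected \<Omega>" and bounded_\<Omega>: "bounded \<Omega>"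
    and open_U: "open U" and closure_subset_U: "closure \<Omega> \<subseteq> U" and analytic: "u real_analytic_on U"
    and eigen: "\<forall>x\<in>\<Omega>. - laplacian u x = lam * u x"
    and boundary: "\<forall>x\<in>frontier \<Omega>. u x = 0"
    and nonzero: "\<exists>x\<in>\<Omega>. u x \<noteq> 0"
begin

lemma \<Omega>_subset_U: "\<Omega> \<subseteq> U"
  using closure_subset closure_subset_U by blast

lemma compact_closure_\<Omega>: "compact (closure \<Omega>)"
  using bounded_\<Omega> by simp

lemma u_dps:
  assumes "p \<in> U"
  obtains c R where "has_dps u p c R" "ball p R \<subseteq> U"
proof -
  obtain c R where c: "has_dps u p c R" using real_analytic_on_has_dps[OF analytic assms] by blast
  obtain e where e: "e > 0" "ball p e \<subseteq> U" using open_U assms openE by blast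
  have "has_dps u p c (min R e)"
    by (rule has_dps_mono[OF c]) (use has_dps_pos[OF c] e in auto)
  then show thesis using that e(2) by (meson min.cobounded2 order_trans subset_ball)
qed

lemma u_analytic2_on: "u analytic2_on U"
  unfolding analytic2_on_def using u_dps by blast

lemma pd_analytic2_on: "pd k u analytic2_on U" "pd k (pd l u) analytic2_on U"
  by (intro analytic2_on_pd u_analytic2_on)+

lemma u_has_derivative: "x \<in> U \<Longrightarrow> (u has_derivative (\<lambda>h. pd 1 u x * h$1 + pd 2 u x * h$2)) (at x)"
  by (rule analytic2_on_has_derivative[OF u_analytic2_on])

lemma GDERIV_u: "x \<in> U \<Longrightarrow> GDERIV u x :> (\<chi> i. pd i u x)"
  using u_has_derivative unfolding gderiv_def by (simp add: inner_vec_def sum_2 mult.commute)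

lemma grad_eq:
  assumes "x \<in> U"
  shows "grad u x = (\<chi> i. pd i u x)"
  unfolding grad_def
proof (rule the_equality)
  show "GDERIV u x :> (\<chi> i. pd i u x)" by (rule GDERIV_u[OF assms])
next
  fix D assume "GDERIV u x :> D"
  then have "(\<lambda>h. h \<bullet> D) = (\<lambda>h. h \<bullet> (\<chi> i. pd i u x))"
    using GDERIV_u[OF assms] has_derivative_unique unfolding gderiv_def by blast
  then show "D = (\<chi> i. pd i u x)" by (metis vector_eq_ldot)
qed

lemma grad_eq_0_iff: "x \<in> U \<Longrightarrow> grad u x = 0 \<longleftrightarrow> critical u x"
  by (simp add: grad_eq critical_def vec_eq_iff forall_2)

lemma critical_set_eq: "critical_set \<Omega> u = {x \<in> closure \<Omega>. critical u x}"
  unfolding critical_set_def using grad_eq_0_iff closure_subset_U by blast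

lemma laplacian_eq:
  assumes "x \<in> U"
  shows "laplacian u x = pd 1 (pd 1 u) x + pd 2 (pd 2 u) x"
proof -
  obtain c R where c: "has_dps u x c R" "ball x R \<subseteq> U" using u_dps[OF assms] .
  have R: "R > 0" using has_dps_pos[OF c(1)] .
  have "(deriv ^^ 2) (\<lambda>t. u (x + t *\<^sub>R axis k 1)) 0 = pd k (pd k u) x" for k
  proof -
    let ?l = "\<lambda>t::real. x + t *\<^sub>R axis k (1::real)"
    have D: "deriv (\<lambda>t. u (?l t)) t = pd k u (?l t)" if "dist t 0 < R" for t
      by (rule DERIV_imp_deriv[OF pd_line[OF c(1)]]) (use that in \<open>simp add: dist_norm norm_axis_1\<close>)
    have "\<forall>\<^sub>F t in nhds 0. deriv (\<lambda>t. u (?l t)) t = pd k u (?l t)"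
      unfolding eventually_nhds_metric using R D by blast
    then have "deriv (deriv (\<lambda>t. u (?l t))) 0 = deriv (\<lambda>t. pd k u (?l t)) 0"
      by (rule deriv_cong_ev) simp
    also have "\<dots> = pd k (pd k u) x"
    proof (rule DERIV_imp_deriv)
      have R2: "0 < R / 2" "R / 2 < R" using R by auto
      obtain c' where c': "has_dps (pd k u) x c' (R / 2)"
        using exhaust_2[of k] has_dps_pd1[OF c(1) R2] has_dps_pd2[OF c(1) R2] by metis
      show "((\<lambda>t. pd k u (?l t)) has_real_derivative pd k (pd k u) x) (at 0)"
        using pd_line[OF c', of x 0 k] R2 by simp
    qed
    finally show ?thesis by (simp add: numeral_2_eq_2)
  qed
  then show ?thesis unfolding laplacian_def by (simp add: sum_2)
qed

section \<open>The equation up to the frontier\<close>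

text \<open>A disc around a point of the closure meets \<open>\<Omega>\<close> in a nonempty open
  set. There the equation holds, and the identity theorem carries it to the whole disc, so maxima
  and critical points on the frontier can be treated like interior ones.\<close>

lemma helmholtz_eventually:
  assumes "p \<in> closure \<Omega>"
  shows "\<forall>\<^sub>F y in nhds p. pd 1 (pd 1 u) y + pd 2 (pd 2 u) y + lam * u y = 0"
proof -
  have "p \<in> U" using assms closure_subset_U by blast
  then obtain c R where c: "has_dps u p c R" "ball p R \<subseteq> U" by (rule u_dps)
  have R: "R > 0" using has_dps_pos[OF c(1)] .
  then have R': "0 < R / 2" "R / 2 < R" "0 < R / 4" "R / 4 < R / 2" by auto
  let ?W = "\<lambda>y. (pd 1 (pd 1 u) y + pd 2 (pd 2 u) y) + lam * u y"
  define r where "r = min (min (R / 4) (R / 4)) R"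
  have W: "has_dps ?W p (\<lambda>i j. (d1 (d1 c) i j + d2 (d2 c) i j) + of_real lam * c i j) r"
    unfolding r_def
    by (intro has_dps_add has_dps_cmult c(1) has_dps_pd1[OF has_dps_pd1[OF c(1) R'(1,2)] R'(3,4)]
        has_dps_pd2[OF has_dps_pd2[OF c(1) R'(1,2)] R'(3,4)])
  have r: "r > 0" using has_dps_pos[OF W] .
  obtain q where q: "q \<in> \<Omega>" "dist q p < r" using assms r closure_approachable by blast
  have W0: "?W y = 0" if "y \<in> \<Omega>" for y
  proof -
    have "y \<in> U" using that \<Omega>_subset_U by blast
    from laplacian_eq[OF this] show ?thesis using eigen that by fastforce
  qed
  have "?W y = 0" if "y \<in> ball p r" for y
    by (rule has_dps_identity[OF W _ _ _ _ that, of "\<Omega> \<inter> ball p r" q])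
      (use q open_\<Omega> in \<open>auto simp: dist_commute intro: W0\<close>)
  then show ?thesis unfolding eventually_nhds_metric using r by (auto simp: dist_commute)
qed

lemma helmholtz:
  assumes "p \<in> closure \<Omega>"
  shows "pd 1 (pd 1 u) p + pd 2 (pd 2 u) p = - lam * u p"
  using eventually_nhds_x_imp_x[OF helmholtz_eventually[OF assms]] by simp

lemma frontier_nonempty: "frontier \<Omega> \<noteq> {}"
proof
  assume "frontier \<Omega> = {}"
  then have "\<Omega> = UNIV" using nonzero frontier_eq_empty by blast
  then show False using bounded_\<Omega> by simp
qed

text \<open>By the identity theorem the set where \<open>u\<close> is locally equal to
  \<open>k\<close> is closed relative to \<open>U\<close>. Connectedness spreads it over
  \<open>\<Omega>\<close>, then closure reaches the frontier, and the boundary condition gives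
  \<open>k = 0\<close>, which contradicts \<open>nonzero\<close>.\<close>

lemma not_locally_constant:
  assumes p: "p \<in> closure \<Omega>"
  shows "\<not> (\<forall>\<^sub>F y in nhds p. u y = k)"
proof
  assume loc: "\<forall>\<^sub>F y in nhds p. u y = k"
  define Z where "Z = {x. \<forall>\<^sub>F y in nhds x. u y = k}"
  have Zk: "u x = k" if "x \<in> Z" for x using that eventually_nhds_x_imp_x unfolding Z_def by blast
  have "open Z"
    unfolding open_subopen[of Z]
  proof
    fix x assume "x \<in> Z"
    then obtain S where S: "open S" "x \<in> S" "\<forall>y\<in>S. u y = k" unfolding Z_def eventually_nhds by blast
    then have "S \<subseteq> Z" unfolding Z_def eventually_nhds by blast
    then show "\<exists>T. open T \<and> x \<in> T \<and> T \<subseteq> Z" using S by blast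
  qed
  have pZ: "p \<in> Z" using loc unfolding Z_def by blast
  have lim: "x \<in> Z" if x: "x \<in> U" "x \<in> closure Z" for x
  proof -
    obtain c R where c: "has_dps u x c R" "ball x R \<subseteq> U" using u_dps[OF x(1)] .
    have R: "R > 0" using has_dps_pos[OF c(1)] .
    then obtain q where "q \<in> Z" "dist q x < R" using x(2) closure_approachable by blast
    then have "Z \<inter> ball x R \<noteq> {}" by (auto simp: dist_commute)
    then have "u y = k" if "y \<in> ball x R" for y
      using has_dps_identity_const[OF c(1), of "Z \<inter> ball x R" k y] \<open>open Z\<close> Zk that by auto
    then show "x \<in> Z" unfolding Z_def eventually_nhds_metric using R by (auto simp: dist_commute)
  qed
  have "\<Omega> \<inter> Z \<noteq> {}"
    using p pZ \<open>open Z\<close> by (metis closure_iff_nhds_not_empty inf_commute order_refl)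
  moreover have "openin (top_of_set \<Omega>) (\<Omega> \<inter> Z)" using \<open>open Z\<close> by (simp add: openin_open_Int)
  moreover have "closedin (top_of_set \<Omega>) (\<Omega> \<inter> Z)"
  proof -
    have "\<Omega> \<inter> Z = \<Omega> \<inter> closure Z" using lim \<Omega>_subset_U closure_subset[of Z] by blast
    then show ?thesis by (simp add: closedin_closed_Int)
  qed
  ultimately have "\<Omega> \<inter> Z = \<Omega>" using connected_\<Omega> connected_clopen by blast
  then have "\<Omega> \<subseteq> Z" by blast
  then have "closure \<Omega> \<subseteq> closure Z" by (rule closure_mono)
  then have "closure \<Omega> \<subseteq> Z" using lim closure_subset_U by blast
  moreover obtain y where "y \<in> frontier \<Omega>" using frontier_nonempty by blast
  ultimately have "k = 0" using Zk[of y] boundary unfolding frontier_def by auto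
  then show False using nonzero \<open>\<Omega> \<subseteq> Z\<close> Zk by blast
qed

text \<open>If \<open>lam \<le> 0\<close>, a positive interior maximum of
  \<open>\<sigma> * u\<close> would have nonnegative Laplacian. A small quadratic term turns this
  into a contradiction with the second derivative test.\<close>

lemma lam_pos: "lam > 0"
proof (rule ccontr)
  assume "\<not> lam > 0"
  then have lam: "lam \<le> 0" by simp
  obtain x0 where x0: "x0 \<in> \<Omega>" "u x0 \<noteq> 0" using nonzero by blast
  define \<sigma> where "\<sigma> = sgn (u x0)"
  define v where "v x = \<sigma> * u x" for x
  have v0: "v x0 > 0" unfolding v_def \<sigma>_def using x0 by (simp add: sgn_if)
  obtain B where B: "\<And>x. x \<in> closure \<Omega> \<Longrightarrow> norm (x - x0) \<le> B"
    using compact_closure_\<Omega> compact_imp_bounded bounded_any_center[of "closure \<Omega>" x0]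
    by (metis dist_commute dist_norm)
  \<comment> \<open>So small that the quadratic term stays below \<open>v x0\<close> on the closure.
    The maximum \<open>q\<close> of \<open>w\<close> then has \<open>v q > 0\<close>, hence is not
    on the frontier.\<close>
  define e where "e = v x0 / (2 * (B\<^sup>2 + 1))"
  have B1: "B\<^sup>2 + 1 > 0" by (simp add: add_nonneg_pos)
  have e: "e > 0" unfolding e_def using v0 B1 by simp
  have "e * (2 * (B\<^sup>2 + 1)) = v x0" unfolding e_def using B1 by simp
  then have eB: "e * B\<^sup>2 < v x0" using e v0 by (simp add: algebra_simps)
  define w where "w x = v x + e * (norm (x - x0))\<^sup>2" for x
  have "continuous_on (closure \<Omega>) w" unfolding w_def v_def
    using continuous_on_subset[OF analytic2_on_continuous_on[OF u_analytic2_on] closure_subset_U]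
    by (intro continuous_intros)
  moreover have x0c: "x0 \<in> closure \<Omega>" using x0(1) closure_subset by blast
  ultimately obtain q where q: "q \<in> closure \<Omega>" "\<And>y. y \<in> closure \<Omega> \<Longrightarrow> w y \<le> w q"
    using continuous_attains_sup[OF compact_closure_\<Omega>] by (metis empty_iff)
  have wB: "e * (norm (q - x0))\<^sup>2 \<le> e * B\<^sup>2"
    using B[OF q(1)] e by (intro mult_left_mono power_mono) auto
  have "w x0 \<le> w q" using q(2) x0c by blast
  then have vq: "v q > 0" using eB wB unfolding w_def by simp
  then have "q \<notin> frontier \<Omega>" using boundary unfolding v_def by auto
  then have q\<Omega>: "q \<in> \<Omega>" using q(1) open_\<Omega> unfolding frontier_def by (simp add: interior_open)
  then have "q \<in> U" using \<Omega>_subset_U by blast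
  then obtain c R where c: "has_dps u q c R" "ball q R \<subseteq> U" by (rule u_dps)
  have "\<forall>\<^sub>F y in nhds q. y \<in> \<Omega>" using open_\<Omega> q\<Omega> by (rule eventually_nhds_in_open)
  then have "\<forall>\<^sub>F y in nhds q. v y + e * (norm (y - x0))\<^sup>2 \<le> v q + e * (norm (q - x0))\<^sup>2"
    by (rule eventually_mono) (use q(2) closure_subset in \<open>auto simp: w_def\<close>)
  then have "pd k (pd k v) q + 2 * e \<le> 0" for k
    unfolding v_def by (rule perturbed_local_max_pd_pd[OF has_dps_cmult[OF c(1)]])
  from this[of 1] this[of 2] have "pd 1 (pd 1 v) q + pd 2 (pd 2 v) q < 0" using e by linarith
  moreover have "pd k (pd k v) q = \<sigma> * pd k (pd k u) q" for k
    unfolding v_def by (rule pd_cmult(2)[OF c(1)]) (use has_dps_pos[OF c(1)] in simp)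
  ultimately have "\<sigma> * (pd 1 (pd 1 u) q + pd 2 (pd 2 u) q) < 0" by (simp add: distrib_left)
  then have "- lam * v q < 0" using helmholtz[OF q(1)] unfolding v_def by (simp add: algebra_simps)
  then show False using mult_nonpos_nonneg[OF lam, of "v q"] vq by simp
qed

section \<open>Sign of the eigenfunction at local maxima\<close>

lemma local_max_critical:
  assumes "x \<in> U" "local_max u x"
  shows "critical u x"
proof -
  have "eventually (\<lambda>y. u y \<le> u x) (at x)"
    using assms(2) unfolding local_max_def by (rule filter_leD[rotated]) (simp add: at_within_le_nhds)
  from has_derivative_local_max[OF u_has_derivative[OF assms(1)] this]
  have "(\<lambda>h::real^2. pd 1 u x * h$1 + pd 2 u x * h$2) = (\<lambda>h. 0)" .
  from fun_cong[OF this, of "axis 1 1"] fun_cong[OF this, of "axis 2 1"]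
  show ?thesis unfolding critical_def by simp
qed

lemma local_max_eventually:
  assumes "local_max f x"
  shows "\<forall>\<^sub>F y in nhds x. f y = f x \<longrightarrow> local_max f y"
proof -
  have "\<forall>\<^sub>F y in nhds x. \<forall>\<^sub>F z in nhds y. f z \<le> f x"
    using assms unfolding local_max_def eventually_eventually .
  then show ?thesis by (rule eventually_mono) (simp add: local_max_def)
qed

lemma critical_zeros_isolated:
  assumes p: "p \<in> closure \<Omega>" "critical u p" "u p = 0"
  shows "\<forall>\<^sub>F y in at p. \<not> critical u y"
proof -
  have "p \<in> U" using p closure_subset_U by blast
  then obtain c R where c: "has_dps u p c R" "ball p R \<subseteq> U" by (rule u_dps)
  show ?thesis unfolding critical_def
    by (rule critical_zero_isolated[OF c(1) helmholtz_eventually[OF p(1)] p(3) _ _ not_locally_constant[OF p(1)]])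
      (use p(2) in \<open>auto simp: critical_def\<close>)
qed

text \<open>The second derivative test with \<open>e = 0\<close> gives \<open>u p \<ge> 0\<close>,
  so only \<open>u p = 0\<close> has to be excluded. Then \<open>p\<close> is an isolated critical
  point and a strict maximum, while \<open>u \<le> 0\<close> nearby makes \<open>u\<close>
  subharmonic there; this contradicts the maximum principle.\<close>

lemma local_max_pos:
  assumes p: "p \<in> closure \<Omega>" and m: "local_max u p"
  shows "u p > 0"
proof (rule ccontr)
  assume "\<not> u p > 0"
  then have np: "u p \<le> 0" by simp
  have pU: "p \<in> U" using p closure_subset_U by blast
  obtain c R where c: "has_dps u p c R" "ball p R \<subseteq> U" using u_dps[OF pU] .
  have "\<forall>\<^sub>F y in nhds p. u y + 0 * (norm (y - p))\<^sup>2 \<le> u p + 0 * (norm (p - p))\<^sup>2"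
    using m unfolding local_max_def by simp
  from perturbed_local_max_pd_pd[OF c(1) this, of 1] perturbed_local_max_pd_pd[OF c(1) this, of 2]
  have "- lam * u p \<le> 0" using helmholtz[OF p] by simp
  then have u0: "u p = 0" using lam_pos np by (simp add: zero_le_mult_iff)
  have "\<forall>\<^sub>F y in at p. \<not> critical u y"
    by (rule critical_zeros_isolated[OF p local_max_critical[OF pU m] u0])
  then have "\<forall>\<^sub>F y in nhds p. y \<noteq> p \<longrightarrow> \<not> critical u y" by (simp add: eventually_at_filter)
  moreover have "\<forall>\<^sub>F y in nhds p. u y \<le> 0" using m u0 unfolding local_max_def by simp
  moreover have "\<forall>\<^sub>F y in nhds p. y \<in> U" using open_U pU by (rule eventually_nhds_in_open)
  \<comment> \<open>A zero of \<open>u\<close> near \<open>p\<close> attains the value of the local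
    maximum, so it is a local maximum too and hence critical; it must be \<open>p\<close>.\<close>
  ultimately have "\<forall>\<^sub>F y in nhds p. (y \<noteq> p \<longrightarrow> u y < 0) \<and> u y \<le> 0 \<and> y \<in> U
      \<and> pd 1 (pd 1 u) y + pd 2 (pd 2 u) y + lam * u y = 0"
    using local_max_eventually[OF m] helmholtz_eventually[OF p]
    by eventually_elim (use local_max_critical u0 in force)
  then obtain d where d: "d > 0" "\<And>y. dist y p < d \<Longrightarrow> (y \<noteq> p \<longrightarrow> u y < 0) \<and> u y \<le> 0 \<and> y \<in> U
      \<and> pd 1 (pd 1 u) y + pd 2 (pd 2 u) y + lam * u y = 0"
    unfolding eventually_nhds_metric by blast
  define r where "r = d / 2"
  have r: "r > 0" "r < d" unfolding r_def using d(1) by auto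
  have cbU: "cball p r \<subseteq> U" using d(2) r by (auto simp: dist_commute)
  have uc: "continuous_on S u" if "S \<subseteq> U" for S
    using continuous_on_subset[OF analytic2_on_continuous_on[OF u_analytic2_on] that] .
  have "sphere p r \<noteq> {}" using r(1) by simp
  then obtain s where s: "s \<in> sphere p r" "\<And>y. y \<in> sphere p r \<Longrightarrow> u y \<le> u s"
    using continuous_attains_sup[OF compact_sphere _ uc] cbU sphere_cball by (metis subset_trans)
  have us: "u s < 0" using d(2)[of s] s(1) r by (auto simp: dist_commute)
  \<comment> \<open>On the circle \<open>w\<close> is then at most \<open>u s / 2 < 0 = w p\<close>,
    so \<open>w\<close> takes its maximum over the disc at an interior point.\<close>
  define e where "e = - u s / (2 * r\<^sup>2)"
  have e: "e > 0" "e * r\<^sup>2 = - u s / 2"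
  proof -
    show "e > 0" unfolding e_def using us r(1) by (intro divide_pos_pos) simp_all
    show "e * r\<^sup>2 = - u s / 2" unfolding e_def using r(1) by simp
  qed
  define w where "w y = u y + e * (norm (y - p))\<^sup>2" for y
  have "continuous_on (cball p r) w" unfolding w_def using uc[OF cbU] by (intro continuous_intros)
  then obtain q where q: "q \<in> cball p r" "\<And>y. y \<in> cball p r \<Longrightarrow> w y \<le> w q"
    using continuous_attains_sup[OF compact_cball, of p r w] r(1) by (metis cball_eq_empty not_less_iff_gr_or_eq)
  have wp: "w p = 0" unfolding w_def using u0 by simp
  have "q \<notin> sphere p r"
  proof
    assume qs: "q \<in> sphere p r"
    then have "w q = u q + e * r\<^sup>2" unfolding w_def by (simp add: dist_norm norm_minus_commute)
    also have "\<dots> < 0" using s(2)[OF qs] us e(2) by simp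
    finally show False using q(2)[of p] wp r(1) by simp
  qed
  then have qb: "q \<in> ball p r" using q(1) by auto
  then have qd: "dist q p < d" using r by (simp add: dist_commute)
  have qU: "q \<in> U" using d(2)[OF qd] by blast
  obtain c' R' where c': "has_dps u q c' R'" "ball q R' \<subseteq> U" using u_dps[OF qU] .
  have "\<forall>\<^sub>F y in nhds q. y \<in> ball p r" using open_ball qb by (rule eventually_nhds_in_open)
  then have "\<forall>\<^sub>F y in nhds q. u y + e * (norm (y - p))\<^sup>2 \<le> u q + e * (norm (q - p))\<^sup>2"
    by (rule eventually_mono) (use q(2) in \<open>auto simp: w_def\<close>)
  from perturbed_local_max_pd_pd[OF c'(1) this, of 1] perturbed_local_max_pd_pd[OF c'(1) this, of 2]
  have "pd 1 (pd 1 u) q + pd 2 (pd 2 u) q < 0" using e(1) by linarith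
  moreover have "lam * u q \<le> 0" using d(2)[OF qd] lam_pos by (simp add: mult_le_0_iff)
  ultimately show False using d(2)[OF qd] by linarith
qed

text \<open>Critical zeros are isolated, so \<open>u p \<noteq> 0\<close>, and the equation leaves a
  pure second derivative nonzero at \<open>p\<close>. Which one it is decides the variable to solve
  for. The last clause makes every such point a local extremum.\<close>

lemma nonisolated_critical_arc:
  assumes p: "p \<in> closure \<Omega>" "critical u p" "p islimpt {x. critical u x}" and W: "open W" "p \<in> W"
  shows "\<exists>N. open N \<and> p \<in> N \<and> N \<subseteq> W \<and> {x\<in>N. critical u x} homeomorphic (UNIV :: real set) \<and>
    (\<forall>x\<in>N. critical u x \<longrightarrow> u x = u p) \<and> ((\<forall>x\<in>N. u x \<le> u p) \<or> (\<forall>x\<in>N. u p \<le> u x))"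
proof -
  have "p \<in> U" using p closure_subset_U by blast
  then obtain c R where c: "has_dps u p c R" "ball p R \<subseteq> U" by (rule u_dps)
  have "u p \<noteq> 0"
    using critical_zeros_isolated[OF p(1,2)] p(3) unfolding islimpt_conv_frequently_at frequently_def by auto
  then have "pd 1 (pd 1 u) p \<noteq> 0 \<or> pd 2 (pd 2 u) p \<noteq> 0" using helmholtz[OF p(1)] lam_pos by auto
  then show ?thesis
  proof
    assume "pd 1 (pd 1 u) p \<noteq> 0"
    then show ?thesis by (rule critical_arc_1[OF c(1) p(2) _ p(3) W])
  next
    assume "pd 2 (pd 2 u) p \<noteq> 0"
    then show ?thesis by (rule critical_arc_2[OF c(1) p(2) _ p(3) W])
  qed
qed

end

section \<open>The gradient flow\<close>

text \<open>A locally Lipschitz map is Lipschitz on a compact set even if that set is not convex,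
  where a bound on the derivative alone would not suffice.\<close>

lemma C1_lipschitz_on_compact:
  fixes f :: "'a::euclidean_space \<Rightarrow> 'a"
  assumes K: "compact K" "K \<subseteq> S" "open S"
    and f: "\<And>x. x \<in> S \<Longrightarrow> (f has_derivative f' x) (at x)"
    and f': "\<And>h. continuous_on S (\<lambda>x. f' x h)"
  shows "\<exists>L. L-lipschitz_on K f"
proof -
  \<comment> \<open>\<open>local_lipschitz\<close> speaks of time-dependent fields; the time
    variable is a dummy.\<close>
  define F where "F = (\<lambda>(t :: real, x). Blinfun (f' x))"
  have app: "blinfun_apply (F (t, x)) = f' x" if "x \<in> S" for t x
    unfolding F_def using f[OF that] by (simp add: bounded_linear_Blinfun_apply has_derivative_bounded_linear)
  have "local_lipschitz UNIV S (\<lambda>t :: real. f)"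
  proof (rule c1_implies_local_lipschitz[where f' = F])
    show "(f has_derivative blinfun_apply (F (t, x))) (at x)" if "x \<in> S" for t x
      unfolding app[OF that] by (rule f[OF that])
    show "continuous_on (UNIV \<times> S) F"
    proof (rule continuous_on_blinfun_componentwise)
      fix i :: 'a
      have "continuous_on (UNIV \<times> S) (\<lambda>p. f' (snd p) i)"
        by (rule continuous_on_compose2[OF f'[of i]]) (auto intro!: continuous_intros)
      then show "continuous_on (UNIV \<times> S) (\<lambda>p. blinfun_apply (F p) i)"
        by (rule continuous_on_eq) (auto simp: app)
    qed
  qed (use K in auto)
  then have "local_lipschitz {0} K (\<lambda>t :: real. f)"
    by (rule local_lipschitz_subset) (use K in auto)
  then obtain L where "\<And>t. t \<in> {0 :: real} \<Longrightarrow> L-lipschitz_on K f"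
    by (rule local_lipschitz_compact_implies_lipschitz) (use K(1) in auto)
  then show ?thesis by blast
qed

context analytic_eigenfunction
begin

text \<open>The gradient in coordinates, free of the description operator in \<open>grad\<close>;
  the two agree on \<open>U\<close>.\<close>

definition nabla :: "real^2 \<Rightarrow> real^2" where
  "nabla x = (\<chi> i. pd i u x)"

lemma nabla_eq_0_iff: "nabla x = 0 \<longleftrightarrow> critical u x"
  by (simp add: nabla_def critical_def vec_eq_iff forall_2)

lemma pd_continuous_on: "S \<subseteq> U \<Longrightarrow> continuous_on S (pd k u)"
  using continuous_on_subset analytic2_on_continuous_on pd_analytic2_on(1) by blast

lemma u_continuous_on: "S \<subseteq> U \<Longrightarrow> continuous_on S u"
  using continuous_on_subset analytic2_on_continuous_on u_analytic2_on by blast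

lemma nabla_continuous_on: "S \<subseteq> U \<Longrightarrow> continuous_on S nabla"
  unfolding nabla_def by (rule continuous_on_vec_lambda) (rule pd_continuous_on)

lemma nabla_lipschitz:
  assumes "compact K" "K \<subseteq> U"
  shows "\<exists>L. L-lipschitz_on K nabla"
proof (rule C1_lipschitz_on_compact[OF assms open_U])
  let ?D = "\<lambda>x h. \<chi> i. pd 1 (pd i u) x * h$1 + pd 2 (pd i u) x * h$2"
  show "(nabla has_derivative ?D x) (at x)" if "x \<in> U" for x
    unfolding has_derivative_componentwise_within[of nabla]
  proof
    fix b :: "real^2" assume "b \<in> Basis"
    then obtain i where b: "b = axis i 1" by (auto simp: Basis_vec_def)
    have "(pd i u has_derivative (\<lambda>h. pd 1 (pd i u) x * h$1 + pd 2 (pd i u) x * h$2)) (at x)"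
      by (rule analytic2_on_has_derivative[OF pd_analytic2_on(1) that])
    then show "((\<lambda>x. nabla x \<bullet> b) has_derivative (\<lambda>h. ?D x h \<bullet> b)) (at x)"
      unfolding b nabla_def by (simp add: inner_axis)
  qed
  show "continuous_on U (\<lambda>x. ?D x h)" for h
    by (intro continuous_on_vec_lambda continuous_intros analytic2_on_continuous_on pd_analytic2_on)
qed

text \<open>With the cutoff \<open>m\<close> the flow is global, and \<open>u\<close> still increases along it because \<open>m \<ge> 0\<close>.\<close>

lemma ex_cutoff_field:
  "\<exists>V L m. lipschitz_flow V L \<and> (\<forall>x. V x = m x *\<^sub>R nabla x) \<and> (\<forall>x. 0 \<le> m x) \<and>
     (\<forall>x\<in>closure \<Omega>. m x = (1 :: real)) \<and> (\<forall>x. x \<notin> U \<longrightarrow> m x = 0)"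
proof -
  let ?K = "closure \<Omega>"
  have K0: "?K \<noteq> {}" using nonzero by auto
  obtain \<delta> where \<delta>: "\<delta> > 0" "(\<Union>x\<in>?K. cball x \<delta>) \<subseteq> U"
    using compact_subset_open_imp_cball_epsilon_subset[OF compact_closure_\<Omega> open_U closure_subset_U] by blast
  \<comment> \<open>A compact neighbourhood of the closure inside \<open>U\<close>, on which
    \<open>nabla\<close> is bounded and Lipschitz. The cutoff falls linearly with the distance, from
    1 on the closure to 0 at the edge of \<open>K'\<close>.\<close>
  define K' where "K' = {x. infdist x ?K \<le> \<delta>}"
  have "K' = (\<Union>x\<in>?K. cball x \<delta>)"
  proof (intro equalityI subsetI)
    fix x assume "x \<in> K'"
    moreover obtain y where "y \<in> ?K" "infdist x ?K = dist x y"
      using infdist_attains_inf[OF closed_closure K0] by blast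
    ultimately show "x \<in> (\<Union>x\<in>?K. cball x \<delta>)" unfolding K'_def by (auto simp: dist_commute)
  next
    fix x assume "x \<in> (\<Union>x\<in>?K. cball x \<delta>)"
    then show "x \<in> K'" unfolding K'_def using infdist_le2 by (auto simp: dist_commute)
  qed
  then have K'U: "K' \<subseteq> U" using \<delta>(2) by simp
  have K'c: "compact K'"
    unfolding K'_def using compact_infdist_le[OF K0 compact_closure_\<Omega> \<delta>(1)] .
  obtain L1 where L1: "L1-lipschitz_on K' nabla" using nabla_lipschitz[OF K'c K'U] by blast
  have "bounded (nabla ` K')"
    using compact_continuous_image[OF nabla_continuous_on[OF K'U] K'c] compact_imp_bounded by blast
  then obtain M where M: "M > 0" "\<And>x. x \<in> K' \<Longrightarrow> norm (nabla x) \<le> M"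
    unfolding bounded_pos by blast
  define m where "m x = max 0 (1 - infdist x ?K / \<delta>)" for x
  define V where "V x = m x *\<^sub>R nabla x" for x
  have m0: "m x = 0" if "x \<notin> K'" for x using that \<delta>(1) unfolding m_def K'_def by (simp add: field_simps)
  have m: "0 \<le> m x" "m x \<le> 1" for x
    using infdist_nonneg[of x ?K] \<delta>(1) unfolding m_def by auto
  have m_lip: "\<bar>m x - m y\<bar> \<le> dist x y / \<delta>" for x y
  proof -
    have "\<bar>m x - m y\<bar> \<le> \<bar>(1 - infdist x ?K / \<delta>) - (1 - infdist y ?K / \<delta>)\<bar>"
      unfolding m_def by (simp add: max_def abs_if split: if_splits)
    also have "\<dots> = \<bar>infdist x ?K - infdist y ?K\<bar> / \<delta>" using \<delta>(1) by (simp add: abs_minus_commute flip: diff_divide_distrib)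
    also have "\<dots> \<le> dist x y / \<delta>"
      using infdist_triangle_abs[of x ?K y] \<delta>(1) by (intro divide_right_mono) auto
    finally show ?thesis .
  qed
  have L10: "L1 \<ge> 0" using L1 lipschitz_on_nonneg by blast
  \<comment> \<open>Inside \<open>K'\<close> this is the product estimate for bounded Lipschitz
    maps. If \<open>y\<close> lies outside, then \<open>m y = 0\<close> and the size of
    \<open>V x\<close> is controlled by \<open>m x - m y\<close>.\<close>
  have one: "dist (V x) (V y) \<le> (L1 + M / \<delta>) * dist x y" if x: "x \<in> K'" for x y
  proof (cases "y \<in> K'")
    case True
    have "V x - V y = m y *\<^sub>R (nabla x - nabla y) + (m x - m y) *\<^sub>R nabla x"
      unfolding V_def by (simp add: algebra_simps)
    then have "norm (V x - V y) \<le> m y * norm (nabla x - nabla y) + \<bar>m x - m y\<bar> * norm (nabla x)"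
      using norm_triangle_ineq[of "m y *\<^sub>R (nabla x - nabla y)" "(m x - m y) *\<^sub>R nabla x"] m by simp
    also have "\<dots> \<le> 1 * (L1 * dist x y) + (dist x y / \<delta>) * M"
      using m m_lip M(2)[OF x] lipschitz_onD[OF L1 x True] \<delta>(1)
      by (intro add_mono mult_mono) (auto simp: dist_norm)
    finally show ?thesis by (simp add: dist_norm algebra_simps)
  next
    case False
    have "norm (V x) \<le> \<bar>m x - m y\<bar> * M"
      unfolding V_def using m0[OF False] M(2)[OF x] m by (simp add: mult_left_mono)
    also have "\<dots> \<le> (dist x y / \<delta>) * M" using m_lip M(1) by (intro mult_right_mono) auto
    also have "\<dots> \<le> (L1 + M / \<delta>) * dist x y" using L10 by (simp add: algebra_simps)
    finally show ?thesis unfolding V_def using m0[OF False] by (simp add: dist_norm)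
  qed
  have "(L1 + M / \<delta>)-lipschitz_on UNIV V"
  proof (rule lipschitz_onI)
    fix x y
    show "dist (V x) (V y) \<le> (L1 + M / \<delta>) * dist x y"
    proof (cases "x \<in> K' \<or> y \<in> K'")
      case True
      then show ?thesis using one[of x y] one[of y x] by (auto simp: dist_commute)
    next
      case False
      then show ?thesis unfolding V_def using m0 L10 M(1) \<delta>(1) by simp
    qed
  qed (use L10 M(1) \<delta>(1) in simp)
  then have "lipschitz_flow V (L1 + M / \<delta>)" by (rule lipschitz_flow.intro)
  moreover have "\<forall>x\<in>?K. m x = 1" unfolding m_def by simp
  moreover have "\<forall>x. x \<notin> U \<longrightarrow> m x = 0" using m0 K'U by blast
  ultimately show ?thesis using V_def m(1) by blast
qed

end

locale eigenfunction_flow = analytic_eigenfunction + lipschitz_flow V L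
  for V :: "real^2 \<Rightarrow> real^2" and L +
  fixes m :: "real^2 \<Rightarrow> real"
  assumes V_eq: "V x = m x *\<^sub>R nabla x" and m_nonneg: "0 \<le> m x"
    and m_closure: "x \<in> closure \<Omega> \<Longrightarrow> m x = 1" and m_outside: "x \<notin> U \<Longrightarrow> m x = 0"
begin

abbreviation "\<Phi> \<equiv> flow V"

lemma V_closure: "x \<in> closure \<Omega> \<Longrightarrow> V x = nabla x"
  by (simp add: V_eq m_closure)

lemma V_eq_grad: "x \<in> closure \<Omega> \<Longrightarrow> V x = grad u x"
  using V_closure grad_eq closure_subset_U unfolding nabla_def by (metis subsetD)

lemma V_eq_0_iff: "x \<in> closure \<Omega> \<Longrightarrow> V x = 0 \<longleftrightarrow> critical u x"
  by (simp add: V_closure nabla_eq_0_iff)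

section \<open>Growth of \<open>u\<close> along trajectories\<close>

text \<open>The lower Gronwall bound, applied to \<open>x\<close> and the stationary point, shows
  that a zero of the field is not reached in finite time.\<close>

lemma flow_not_stationary:
  assumes "V x \<noteq> 0" "0 \<le> t"
  shows "V (\<Phi> x t) \<noteq> 0"
proof
  assume "V (\<Phi> x t) = 0"
  then have "\<Phi> (\<Phi> x t) t = \<Phi> x t" by (rule flow_stationary[OF _ assms(2)])
  then have "exp (- L * t) * dist x (\<Phi> x t) \<le> 0"
    using flow_dist_ge[OF assms(2), of x "\<Phi> x t"] by simp
  then have "x = \<Phi> x t" by (simp add: mult_le_0_iff)
  then show False using \<open>V (\<Phi> x t) = 0\<close> assms(1) by simp
qed

text \<open>Outside \<open>U\<close> the field vanishes, so to leave \<open>U\<close> a trajectory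
  would have to arrive at a zero of the field.\<close>

lemma flow_in_U:
  assumes "x \<in> U" "0 \<le> t"
  shows "\<Phi> x t \<in> U"
proof (cases "V x = 0")
  case True
  then show ?thesis using flow_stationary[OF True assms(2)] assms(1) by simp
next
  case False
  then show ?thesis using flow_not_stationary[OF False assms(2)] m_outside V_eq by fastforce
qed

lemma u_flow_derivative:
  assumes "x \<in> U" "0 < t"
  shows "((\<lambda>t. u (\<Phi> x t)) has_real_derivative m (\<Phi> x t) * (norm (nabla (\<Phi> x t)))\<^sup>2) (at t)"
proof -
  let ?y = "\<Phi> x t"
  have "?y \<in> U" using flow_in_U assms by simp
  have "(\<Phi> x has_derivative (\<lambda>h. h *\<^sub>R V ?y)) (at t)"
    using forward_solution_at[OF flow_solution assms(2)] unfolding has_vector_derivative_def .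
  then have "((u \<circ> \<Phi> x) has_derivative ((\<lambda>h. pd 1 u ?y * h$1 + pd 2 u ?y * h$2) \<circ> (\<lambda>h. h *\<^sub>R V ?y))) (at t)"
    by (rule diff_chain_at) (rule u_has_derivative[OF \<open>?y \<in> U\<close>])
  then show ?thesis unfolding has_field_derivative_def o_def
    by (rule has_derivative_eq_rhs)
      (simp add: fun_eq_iff V_eq nabla_def power2_norm_eq_inner inner_vec_def sum_2 algebra_simps)
qed

lemma u_flow_continuous:
  assumes "x \<in> U"
  shows "continuous_on {0..} (\<lambda>t. u (\<Phi> x t))"
  by (rule continuous_on_compose2[OF u_continuous_on[OF order_refl] flow_continuous_time])
    (use flow_in_U[OF assms] in auto)

lemma u_flow_mono:
  assumes x: "x \<in> U" and st: "0 \<le> s" "s \<le> t"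
  shows "u (\<Phi> x s) \<le> u (\<Phi> x t)"
proof (rule DERIV_nonneg_imp_increasing_open[OF st(2)])
  show "continuous_on {s..t} (\<lambda>t. u (\<Phi> x t))"
    by (rule continuous_on_subset[OF u_flow_continuous[OF x]]) (use st in auto)
  fix r assume "s < r" "r < t"
  then show "\<exists>y. ((\<lambda>t. u (\<Phi> x t)) has_real_derivative y) (at r) \<and> 0 \<le> y"
    using u_flow_derivative[OF x, of r] st m_nonneg by (metis le_less_trans mult_nonneg_nonneg zero_le_power2)
qed

lemma u_flow_strict_mono:
  assumes x: "x \<in> U" "V x \<noteq> 0" and st: "0 \<le> s" "s < t"
  shows "u (\<Phi> x s) < u (\<Phi> x t)"
proof (rule DERIV_pos_imp_increasing_open[OF st(2)])
  show "continuous_on {s..t} (\<lambda>t. u (\<Phi> x t))"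
    by (rule continuous_on_subset[OF u_flow_continuous[OF x(1)]]) (use st in auto)
  fix r assume r: "s < r" "r < t"
  then have "V (\<Phi> x r) \<noteq> 0" using flow_not_stationary[OF x(2)] st by simp
  then have "m (\<Phi> x r) \<noteq> 0" "nabla (\<Phi> x r) \<noteq> 0" unfolding V_eq by auto
  then have "0 < m (\<Phi> x r) * (norm (nabla (\<Phi> x r)))\<^sup>2"
    using m_nonneg[of "\<Phi> x r"] by simp
  then show "\<exists>y. ((\<lambda>t. u (\<Phi> x t)) has_real_derivative y) (at r) \<and> 0 < y"
    using u_flow_derivative[OF x(1), of r] r st by (metis le_less_trans)
qed

lemma flow_connected: "0 \<le> s \<Longrightarrow> connected (\<Phi> x ` {s..t})"
  by (intro connected_continuous_image continuous_on_subset[OF flow_continuous_time]) auto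

text \<open>On \<open>frontier \<Omega>\<close> we have \<open>u = 0\<close>, and \<open>u\<close> vanishes at most once along a trajectory, so a
  trajectory cannot leave \<open>closure \<Omega>\<close> and come back.\<close>

lemma flow_stays_in_closure:
  assumes x: "x \<in> \<Omega>" "\<Phi> x T \<in> \<Omega>" and t: "0 \<le> t" "t \<le> T"
  shows "\<Phi> x t \<in> closure \<Omega>"
proof (rule ccontr)
  assume out: "\<Phi> x t \<notin> closure \<Omega>"
  have xU: "x \<in> U" using x \<Omega>_subset_U by blast
  have V: "V x \<noteq> 0"
  proof
    assume "V x = 0"
    then have "\<Phi> x t = x" using flow_stationary t by blast
    then have "x \<notin> closure \<Omega>" using out by simp
    then show False using x(1) closure_subset by blast
  qed
  have notin: "\<Phi> x t \<notin> \<Omega>" "\<Phi> x t \<notin> frontier \<Omega>" using out closure_subset unfolding frontier_def by blast+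
  have img: "x \<in> \<Phi> x ` {0..t}" "\<Phi> x t \<in> \<Phi> x ` {0..t}" "\<Phi> x t \<in> \<Phi> x ` {t..T}" "\<Phi> x T \<in> \<Phi> x ` {t..T}"
    using t by (auto intro: image_eqI[of _ _ 0])
  have "\<Phi> x ` {0..t} \<inter> frontier \<Omega> \<noteq> {}"
    by (rule connected_Int_frontier[OF flow_connected[OF order_refl]]) (use x(1) notin img in blast)+
  then obtain a where a: "a \<in> {0..t}" "\<Phi> x a \<in> frontier \<Omega>" by blast
  have "\<Phi> x ` {t..T} \<inter> frontier \<Omega> \<noteq> {}"
    by (rule connected_Int_frontier[OF flow_connected[OF t(1)]]) (use x(2) notin img in blast)+
  then obtain b where b: "b \<in> {t..T}" "\<Phi> x b \<in> frontier \<Omega>" by blast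
  have "a \<noteq> t" using a notin by blast
  then have "u (\<Phi> x a) < u (\<Phi> x b)" using a b t by (intro u_flow_strict_mono[OF xU V]) auto
  then show False using a b boundary by auto
qed

section \<open>Stable and unstable sets in terms of the ascending flow\<close>

text \<open>Time reversal: a backward curve of \<open>- grad u\<close> is a forward curve of
  \<open>grad u\<close>, and this is \<open>V\<close> as long as the curve stays in the
  closure.\<close>

lemma unstable_setI:
  assumes x: "\<And>t. 0 \<le> t \<Longrightarrow> \<Phi> x t \<in> closure \<Omega>" and lim: "(\<Phi> x \<longlongrightarrow> q) at_top"
  shows "x \<in> unstable_set \<Omega> u q"
proof -
  define \<gamma> where "\<gamma> t = \<Phi> x (- t)" for t
  have "(\<gamma> has_vector_derivative - grad u (\<gamma> t)) (at t within {..0})" if t: "t \<le> 0" for t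
  proof -
    have "(\<Phi> x has_vector_derivative V (\<Phi> x (- t))) (at (- t) within uminus ` {..0})"
      using flow_solution[of x] t unfolding forward_solution_def by simp
    moreover have "(uminus has_vector_derivative - 1) (at t within {..0})"
      by (auto intro!: derivative_eq_intros)
    ultimately have "((\<Phi> x \<circ> uminus) has_vector_derivative (- 1) *\<^sub>R V (\<Phi> x (- t))) (at t within {..0})"
      by (rule vector_diff_chain_within[rotated])
    then show ?thesis using V_eq_grad[OF x[of "- t"]] t unfolding \<gamma>_def o_def by simp
  qed
  then have "integral_curve_in (closure \<Omega>) (\<lambda>y. - grad u y) {..0} \<gamma>"
    unfolding integral_curve_in_def using x unfolding \<gamma>_def by auto
  moreover have "(\<gamma> \<longlongrightarrow> q) at_bot"
    unfolding \<gamma>_def by (rule filterlim_compose[OF lim filterlim_uminus_at_top_at_bot])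
  moreover have "\<gamma> 0 = x" unfolding \<gamma>_def by simp
  moreover have "x \<in> closure \<Omega>" using x[of 0] by simp
  ultimately show ?thesis unfolding unstable_set_def by blast
qed

text \<open>Any witnessing curve, reversed in time, solves the equation of \<open>V\<close>; by
  uniqueness it is the trajectory of \<open>x\<close>.\<close>

lemma unstable_setD:
  assumes "x \<in> unstable_set \<Omega> u q"
  shows "(\<Phi> x \<longlongrightarrow> q) at_top"
proof -
  obtain \<gamma> where \<gamma>: "integral_curve_in (closure \<Omega>) (\<lambda>y. - grad u y) {..0} \<gamma>" "\<gamma> 0 = x" "(\<gamma> \<longlongrightarrow> q) at_bot"
    using assms unfolding unstable_set_def by blast
  define y where "y t = \<gamma> (- t)" for t
  have "forward_solution V y" unfolding forward_solution_def
  proof (intro allI impI)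
    fix t :: real assume t: "0 \<le> t"
    have g: "\<gamma> (- t) \<in> closure \<Omega>"
      "(\<gamma> has_vector_derivative - grad u (\<gamma> (- t))) (at (- t) within uminus ` {0..})"
      using \<gamma>(1) t unfolding integral_curve_in_def by auto
    have "(uminus has_vector_derivative - 1) (at t within {0..})"
      by (auto intro!: derivative_eq_intros)
    then have "((\<gamma> \<circ> uminus) has_vector_derivative (- 1) *\<^sub>R - grad u (\<gamma> (- t))) (at t within {0..})"
      by (rule vector_diff_chain_within) (use g(2) in simp)
    then show "(y has_vector_derivative V (y t)) (at t within {0..})"
      using V_eq_grad[OF g(1)] unfolding y_def o_def by simp
  qed
  from flow_unique[OF this] have eq: "y t = \<Phi> x t" if "0 \<le> t" for t
    using that \<gamma>(2) unfolding y_def by simp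
  have "(y \<longlongrightarrow> q) at_top"
    unfolding y_def by (rule filterlim_compose[OF \<gamma>(3) filterlim_uminus_at_bot_at_top])
  moreover have "\<forall>\<^sub>F t in at_top. y t = \<Phi> x t"
    using eventually_ge_at_top[of 0] by eventually_elim (rule eq)
  ultimately show ?thesis by (rule Lim_transform_eventually)
qed

text \<open>The witnessing curve descends towards \<open>q\<close>. That is backward time for
  \<open>V\<close>, which the forward semiflow does not cover, so the monotonicity of
  \<open>u\<close> is derived here directly.\<close>

lemma stable_set_u_le:
  assumes "x \<in> stable_set \<Omega> u q"
  shows "u q \<le> u x"
proof -
  obtain \<gamma> where \<gamma>: "integral_curve_in (closure \<Omega>) (\<lambda>y. - grad u y) {0..} \<gamma>" "\<gamma> 0 = x" "(\<gamma> \<longlongrightarrow> q) at_top"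
    using assms unfolding stable_set_def by blast
  have in_cl: "\<gamma> t \<in> closure \<Omega>" if "0 \<le> t" for t using \<gamma>(1) that unfolding integral_curve_in_def by simp
  have sol: "forward_solution (\<lambda>y. - grad u y) \<gamma>"
    using \<gamma>(1) unfolding integral_curve_in_def forward_solution_def by simp
  have ev: "\<forall>\<^sub>F t in at_top. \<gamma> t \<in> closure \<Omega>"
    using eventually_ge_at_top[of 0] by eventually_elim (rule in_cl)
  have q: "q \<in> closure \<Omega>"
    by (rule Lim_in_closed_set[OF closed_closure ev _ \<gamma>(3)]) simp
  have le: "u (\<gamma> t) \<le> u x" if t: "0 \<le> t" for t
  proof -
    have "u (\<gamma> t) \<le> u (\<gamma> 0)"
    proof (rule DERIV_nonpos_imp_decreasing_open[OF t])
      show "continuous_on {0..t} (\<lambda>t. u (\<gamma> t))"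
        by (rule continuous_on_compose2[OF u_continuous_on[OF closure_subset_U]
              continuous_on_subset[OF forward_solution_continuous[OF sol]]]) (use in_cl in auto)
      fix r assume r: "0 < r" "r < t"
      let ?y = "\<gamma> r"
      have "?y \<in> U" using in_cl[of r] r closure_subset_U by auto
      have "(\<gamma> has_derivative (\<lambda>h. h *\<^sub>R - grad u ?y)) (at r)"
        using forward_solution_at[OF sol r(1)] unfolding has_vector_derivative_def .
      then have "((u \<circ> \<gamma>) has_derivative ((\<lambda>h. pd 1 u ?y * h$1 + pd 2 u ?y * h$2) \<circ> (\<lambda>h. h *\<^sub>R - grad u ?y))) (at r)"
        by (rule diff_chain_at) (rule u_has_derivative[OF \<open>?y \<in> U\<close>])
      then have "((\<lambda>t. u (\<gamma> t)) has_real_derivative - ((pd 1 u ?y)\<^sup>2 + (pd 2 u ?y)\<^sup>2)) (at r)"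
        unfolding has_field_derivative_def o_def grad_eq[OF \<open>?y \<in> U\<close>]
        by (rule has_derivative_eq_rhs) (simp add: fun_eq_iff power2_eq_square algebra_simps)
      then show "\<exists>y. ((\<lambda>t. u (\<gamma> t)) has_real_derivative y) (at r) \<and> y \<le> 0"
        by (intro exI conjI) auto
    qed
    then show ?thesis using \<gamma>(2) by simp
  qed
  have "isCont u q" using u_continuous_on[OF order_refl] open_U q closure_subset_U
    by (auto simp: continuous_on_eq_continuous_at)
  then have "((\<lambda>t. u (\<gamma> t)) \<longlongrightarrow> u q) at_top" using \<gamma>(3) by (rule isCont_tendsto_compose)
  moreover have "\<forall>\<^sub>F t in at_top. u (\<gamma> t) \<le> u x"
    using eventually_ge_at_top[of 0] by eventually_elim (rule le)
  ultimately show ?thesis by (rule tendsto_upperbound) simp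
qed

section \<open>Limit points of trajectories\<close>

text \<open>The bound on \<open>u\<close> follows from monotonicity along the trajectory. If
  \<open>q\<close> were not critical, flowing from \<open>q\<close> for unit time would raise
  \<open>u\<close> above \<open>u q\<close>; but \<open>\<Phi> q 1\<close> is also a limit point,
  along the times \<open>s n + 1\<close>, and the same bound applies to it.\<close>

lemma limit_point_le:
  assumes x: "\<And>t. 0 \<le> t \<Longrightarrow> \<Phi> x t \<in> closure \<Omega>"
    and s: "filterlim s at_top sequentially" "(\<lambda>n. \<Phi> x (s n)) \<longlonglongrightarrow> q"
  shows "q \<in> closure \<Omega>" and "0 \<le> t \<Longrightarrow> u (\<Phi> x t) \<le> u q" and "critical u q"
proof -
  have ev: "\<forall>\<^sub>F n in sequentially. t \<le> s n" for t
    using s(1) unfolding filterlim_at_top by blast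
  have "\<forall>\<^sub>F n in sequentially. \<Phi> x (s n) \<in> closure \<Omega>"
    using ev[of 0] by eventually_elim (rule x)
  then show q: "q \<in> closure \<Omega>"
    by (rule Lim_in_closed_set[OF closed_closure _ _ s(2)]) simp
  have xU: "x \<in> U" using x[of 0] closure_subset_U by auto
  have uc: "isCont u y" if "y \<in> closure \<Omega>" for y
    using u_continuous_on[OF order_refl] open_U that closure_subset_U
    by (auto simp: continuous_on_eq_continuous_at)
  have ulim: "(\<lambda>n. u (\<Phi> x (s n))) \<longlonglongrightarrow> u q"
    by (rule isCont_tendsto_compose[OF uc[OF q] s(2)])
  have le: "u (\<Phi> x t) \<le> u q" if t: "0 \<le> t" for t
  proof (rule tendsto_lowerbound[OF ulim])
    show "\<forall>\<^sub>F n in sequentially. u (\<Phi> x t) \<le> u (\<Phi> x (s n))"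
      using ev[of t] by eventually_elim (rule u_flow_mono[OF xU t])
  qed simp
  then show "0 \<le> t \<Longrightarrow> u (\<Phi> x t) \<le> u q" .
  show "critical u q"
  proof (rule ccontr)
    assume "\<not> critical u q"
    then have Vq: "V q \<noteq> 0" using V_eq_0_iff[OF q] by simp
    have "(\<lambda>n. \<Phi> (\<Phi> x (s n)) 1) \<longlonglongrightarrow> \<Phi> q 1"
      by (rule isCont_tendsto_compose[OF _ s(2)])
        (use flow_continuous[of 1] in \<open>simp add: continuous_on_eq_continuous_at\<close>)
    moreover have "\<forall>\<^sub>F n in sequentially. \<Phi> (\<Phi> x (s n)) 1 = \<Phi> x (s n + 1)"
      using ev[of 0] by eventually_elim (simp add: flow_add)
    ultimately have lim1: "(\<lambda>n. \<Phi> x (s n + 1)) \<longlonglongrightarrow> \<Phi> q 1"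
      by (rule Lim_transform_eventually)
    have "\<forall>\<^sub>F n in sequentially. \<Phi> x (s n + 1) \<in> closure \<Omega>"
      using ev[of 0] by eventually_elim (simp add: x)
    then have q1: "\<Phi> q 1 \<in> closure \<Omega>"
      by (rule Lim_in_closed_set[OF closed_closure _ _ lim1]) simp
    have "(\<lambda>n. u (\<Phi> x (s n + 1))) \<longlonglongrightarrow> u (\<Phi> q 1)"
      by (rule isCont_tendsto_compose[OF uc[OF q1] lim1])
    moreover have "\<forall>\<^sub>F n in sequentially. u (\<Phi> x (s n + 1)) \<le> u q"
      using ev[of 0] by eventually_elim (simp add: le)
    ultimately have "u (\<Phi> q 1) \<le> u q" by (rule tendsto_upperbound) simp
    moreover have "u (\<Phi> q 0) < u (\<Phi> q 1)"
      by (rule u_flow_strict_mono) (use q closure_subset_U Vq in auto)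
    ultimately show False by simp
  qed
qed

text \<open>The inclusion of ranges lets a bound that holds at all times \<open>s n\<close> pass to
  the chosen subsequence.\<close>

lemma ex_limit_point:
  assumes K: "compact K" and s: "filterlim s at_top sequentially" and x: "\<And>n. \<Phi> x (s n) \<in> K"
  obtains q s' where "q \<in> K" "filterlim s' at_top sequentially" "(\<lambda>n. \<Phi> x (s' n)) \<longlonglongrightarrow> q"
    "range s' \<subseteq> range s"
proof -
  obtain q r where "q \<in> K" "strict_mono r" "((\<lambda>n. \<Phi> x (s n)) \<circ> r) \<longlonglongrightarrow> q"
    using K x unfolding compact_def by meson
  then show thesis
    using that[of q "s \<circ> r"] filterlim_compose[OF s filterlim_subseq[of r]] by (auto simp: o_def)
qed

text \<open>Otherwise the trajectory crosses a small sphere around \<open>q\<close> at arbitrarily late times and so has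
  a critical limit point on that sphere.\<close>

lemma isolated_limit_point_tendsto:
  assumes x: "\<And>t. 0 \<le> t \<Longrightarrow> \<Phi> x t \<in> closure \<Omega>"
    and s: "filterlim s at_top sequentially" "(\<lambda>n. \<Phi> x (s n)) \<longlonglongrightarrow> q"
    and iso: "\<forall>\<^sub>F y in at q. \<not> critical u y"
  shows "(\<Phi> x \<longlongrightarrow> q) at_top"
proof (rule tendstoI, rule ccontr)
  fix e :: real assume e: "e > 0" and neg: "\<not> (\<forall>\<^sub>F t in at_top. dist (\<Phi> x t) q < e)"
  obtain d where d: "d > 0" "\<And>y. y \<noteq> q \<Longrightarrow> dist y q < d \<Longrightarrow> \<not> critical u y"
    using iso unfolding eventually_at by blast
  define \<epsilon> where "\<epsilon> = min e (d / 2)"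
  have \<epsilon>: "0 < \<epsilon>" "\<epsilon> \<le> e" "\<epsilon> < d" unfolding \<epsilon>_def using e d by auto
  have cross: "\<exists>t\<ge>real n. dist (\<Phi> x t) q = \<epsilon>" for n
  proof -
    have "\<forall>\<^sub>F k in sequentially. real n \<le> s k \<and> dist (\<Phi> x (s k)) q < \<epsilon>"
      using s(1) tendstoD[OF s(2) \<epsilon>(1)] unfolding filterlim_at_top by (simp add: eventually_conj)
    then obtain k where k: "real n \<le> s k" "dist (\<Phi> x (s k)) q < \<epsilon>"
      using eventually_happens'[OF sequentially_bot] by blast
    obtain t where t: "s k \<le> t" "\<not> dist (\<Phi> x t) q < e"
      using neg unfolding eventually_at_top_linorder by blast
    have "\<exists>r\<ge>s k. r \<le> t \<and> dist (\<Phi> x r) q = \<epsilon>"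
    proof (rule IVT')
      show "continuous_on {s k..t} (\<lambda>r. dist (\<Phi> x r) q)"
        by (intro continuous_intros continuous_on_subset[OF flow_continuous_time]) (use k in auto)
    qed (use k t \<epsilon> in auto)
    then obtain r where "s k \<le> r" "dist (\<Phi> x r) q = \<epsilon>" by blast
    then show ?thesis using k(1) by (intro exI[of _ r]) simp
  qed
  then obtain t where t: "\<And>n. real n \<le> t n" "\<And>n. dist (\<Phi> x (t n)) q = \<epsilon>" by metis
  have t_lim: "filterlim t at_top sequentially"
    by (rule filterlim_at_top_mono[OF filterlim_real_sequentially]) (simp add: t(1))
  have "\<Phi> x (t n) \<in> closure \<Omega> \<inter> sphere q \<epsilon>" for n
    using x[of "t n"] t[of n] by (simp add: dist_commute order_trans[OF of_nat_0_le_iff])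
  from ex_limit_point[OF compact_Int[OF compact_closure_\<Omega> compact_sphere] t_lim this]
  obtain q' t' where q': "q' \<in> closure \<Omega> \<inter> sphere q \<epsilon>" "filterlim t' at_top sequentially"
    "(\<lambda>n. \<Phi> x (t' n)) \<longlonglongrightarrow> q'" by blast
  have "critical u q'" by (rule limit_point_le(3)[OF x q'(2,3)])
  moreover have "q' \<noteq> q" "dist q' q < d" using q'(1) \<epsilon> by (auto simp: dist_commute)
  ultimately show False using d(2) by blast
qed

end

section \<open>Components of maxima and their basins\<close>

context analytic_eigenfunction
begin

lemma maxima_eq: "maxima \<Omega> u = {x \<in> closure \<Omega>. local_max u x}"
  unfolding maxima_def critical_set_eq using local_max_critical closure_subset_U by blast

lemma maxima_critical: "x \<in> maxima \<Omega> u \<Longrightarrow> critical u x"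
  unfolding maxima_def critical_set_eq by blast

lemma maxima_pos: "x \<in> maxima \<Omega> u \<Longrightarrow> 0 < u x"
  unfolding maxima_eq using local_max_pos by blast

lemma in_\<Omega>_if_nonzero: "x \<in> closure \<Omega> \<Longrightarrow> u x \<noteq> 0 \<Longrightarrow> x \<in> \<Omega>"
  using boundary open_\<Omega> unfolding frontier_def by (auto simp: interior_open)

lemma maxima_subset: "maxima \<Omega> u \<subseteq> \<Omega>"
proof
  fix x assume x: "x \<in> maxima \<Omega> u"
  then show "x \<in> \<Omega>" using maxima_pos[OF x] in_\<Omega>_if_nonzero unfolding maxima_eq by simp
qed

lemma local_maxI_open: "open N \<Longrightarrow> x \<in> N \<Longrightarrow> (\<And>y. y \<in> N \<Longrightarrow> u y \<le> u x) \<Longrightarrow> local_max u x"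
  unfolding local_max_def eventually_nhds by blast

section \<open>Structure of the components of maxima\<close>

text \<open>\<open>N\<close> is taken where \<open>u p\<close> is the largest value. There a point
  with value \<open>u p\<close> is itself a local maximum, hence critical; conversely
  \<open>u\<close> is constant on the critical arc. Connectedness is what later puts all critical
  points of \<open>N\<close> into one component.\<close>

lemma maxima_local_structure:
  assumes p: "p \<in> maxima \<Omega> u"
  shows "\<exists>N. open N \<and> p \<in> N \<and> N \<subseteq> \<Omega> \<and> connected {x\<in>N. critical u x} \<and>
    {x\<in>N. critical u x} \<subseteq> maxima \<Omega> u \<and> (\<forall>x\<in>N. u x \<le> u p) \<and>
    (\<forall>x\<in>N. critical u x \<longleftrightarrow> u x = u p) \<and>
    ({x\<in>N. critical u x} = {p} \<or> {x\<in>N. critical u x} homeomorphic (UNIV :: real set))"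
proof -
  have p\<Omega>: "p \<in> \<Omega>" and pc: "critical u p" and pm: "local_max u p"
    using p maxima_subset maxima_critical unfolding maxima_def by blast+
  have p_cl: "p \<in> closure \<Omega>" using p\<Omega> closure_subset by blast
  obtain S where S: "open S" "p \<in> S" "\<forall>y\<in>S. u y \<le> u p"
    using pm unfolding local_max_def eventually_nhds by blast
  define W where "W = S \<inter> \<Omega>"
  have W: "open W" "p \<in> W" "W \<subseteq> \<Omega>" "\<And>y. y \<in> W \<Longrightarrow> u y \<le> u p"
    unfolding W_def using S p\<Omega> open_\<Omega> by auto
  have "\<exists>N. open N \<and> p \<in> N \<and> N \<subseteq> W \<and> (\<forall>x\<in>N. critical u x \<longrightarrow> u x = u p) \<and>
    ({x\<in>N. critical u x} = {p} \<or> {x\<in>N. critical u x} homeomorphic (UNIV :: real set))"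
  proof (cases "p islimpt {x. critical u x}")
    case True
    show ?thesis using nonisolated_critical_arc[OF p_cl pc True W(1,2)] by blast
  next
    case False
    then obtain T where T: "open T" "p \<in> T" "\<And>y. y \<in> T \<Longrightarrow> critical u y \<Longrightarrow> y = p"
      unfolding islimpt_def by blast
    have "{x\<in>W \<inter> T. critical u x} = {p}" using T W(2) pc by blast
    moreover have "open (W \<inter> T)" "p \<in> W \<inter> T" using T W by auto
    ultimately show ?thesis using T(3) by (intro exI[of _ "W \<inter> T"]) auto
  qed
  then obtain N where N: "open N" "p \<in> N" "N \<subseteq> W" "\<forall>x\<in>N. critical u x \<longrightarrow> u x = u p"
    "{x\<in>N. critical u x} = {p} \<or> {x\<in>N. critical u x} homeomorphic (UNIV :: real set)"
    by (elim exE conjE)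
  have lm: "local_max u x" if "x \<in> N" "u x = u p" for x
    by (rule local_maxI_open[OF N(1) that(1)]) (use N(3) W(4) that(2) in auto)
  show ?thesis
  proof (intro exI conjI ballI)
    show "open N" "p \<in> N" by (rule N(1), rule N(2))
    show N\<Omega>: "N \<subseteq> \<Omega>" using N(3) W(3) by (rule order_trans)
    show "connected {x\<in>N. critical u x}"
      using N(5) homeomorphic_connectedness[of "{x\<in>N. critical u x}" "UNIV :: real set"] by auto
    show "{x\<in>N. critical u x} \<subseteq> maxima \<Omega> u"
      unfolding maxima_eq using lm N(4) N\<Omega> closure_subset[of \<Omega>] by auto
    show "u x \<le> u p" if "x \<in> N" for x using that N(3) W(4) by auto
    show "critical u x \<longleftrightarrow> u x = u p" if "x \<in> N" for x
      using N(4) lm[OF that] local_max_critical that N\<Omega> \<Omega>_subset_U by auto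
    show "{x\<in>N. critical u x} = {p} \<or> {x\<in>N. critical u x} homeomorphic (UNIV :: real set)" by (rule N(5))
  qed
qed

text \<open>The critical points of \<open>N\<close> form a connected set of maxima through
  \<open>p\<close>, so \<open>C\<close> absorbs them all. In particular no other component of maxima
  enters \<open>N\<close>.\<close>

lemma component_local_structure:
  assumes C: "C \<in> components (maxima \<Omega> u)" and p: "p \<in> C"
  shows "\<exists>N. open N \<and> p \<in> N \<and> N \<subseteq> \<Omega> \<and> C \<inter> N = {x\<in>N. critical u x} \<and>
    (\<forall>x\<in>N. u x \<le> u p) \<and> (\<forall>x\<in>N. critical u x \<longleftrightarrow> u x = u p) \<and>
    (C \<inter> N = {p} \<or> (C \<inter> N) homeomorphic (UNIV :: real set))"
proof -
  have CM: "C \<subseteq> maxima \<Omega> u" using C in_components_subset by blast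
  then have "p \<in> maxima \<Omega> u" using p by blast
  from maxima_local_structure[OF this]
  obtain N where N: "open N" "p \<in> N" "N \<subseteq> \<Omega>" "connected {x\<in>N. critical u x}"
    "{x\<in>N. critical u x} \<subseteq> maxima \<Omega> u" "\<forall>x\<in>N. u x \<le> u p"
    "\<forall>x\<in>N. critical u x \<longleftrightarrow> u x = u p"
    "{x\<in>N. critical u x} = {p} \<or> {x\<in>N. critical u x} homeomorphic (UNIV :: real set)"
    by (elim exE conjE)
  have "p \<in> {x\<in>N. critical u x}" using N(2) maxima_critical CM p by blast
  then have "{x\<in>N. critical u x} \<subseteq> C"
    using components_maximal[OF C N(4,5)] p by blast
  moreover have "C \<inter> N \<subseteq> {x\<in>N. critical u x}" using maxima_critical CM by blast
  ultimately have eq: "C \<inter> N = {x\<in>N. critical u x}" by blast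
  show ?thesis
    by (intro exI[of _ N] conjI N(1-3) N(6,7)) (use N(8) eq in simp_all)
qed

text \<open>Locally constant on a connected set: the level set of \<open>u x\<close> in
  \<open>C\<close> is open by the local structure and closed by continuity.\<close>

lemma component_u_const:
  assumes C: "C \<in> components (maxima \<Omega> u)" and xy: "x \<in> C" "y \<in> C"
  shows "u x = u y"
proof -
  define A where "A = {z \<in> C. u z = u x}"
  have "openin (top_of_set C) A"
    unfolding openin_subopen[of _ A]
  proof
    fix z assume z: "z \<in> A"
    then have zC: "z \<in> C" "u z = u x" unfolding A_def by auto
    from component_local_structure[OF C zC(1)]
    obtain N where N: "open N" "z \<in> N" "C \<inter> N = {w\<in>N. critical u w}" "\<forall>w\<in>N. critical u w \<longleftrightarrow> u w = u z"
      by (elim exE conjE)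
    have "C \<inter> N \<subseteq> A" using N(3,4) zC unfolding A_def by auto
    then show "\<exists>T. openin (top_of_set C) T \<and> z \<in> T \<and> T \<subseteq> A"
      using openin_open_Int[OF N(1), of C] N(2) zC by blast
  qed
  moreover have "closedin (top_of_set C) A"
  proof -
    have "C \<subseteq> U" using C in_components_subset maxima_subset \<Omega>_subset_U by blast
    then have "continuous_on C u" by (rule u_continuous_on)
    then have "closedin (top_of_set C) (C \<inter> u -` {u x})" by (rule continuous_closedin_preimage) simp
    moreover have "C \<inter> u -` {u x} = A" unfolding A_def by auto
    ultimately show ?thesis by simp
  qed
  moreover have "x \<in> A" unfolding A_def using xy by simp
  ultimately have "A = C" using in_components_connected[OF C] connected_clopen by blast
  then have "y \<in> A" using xy(2) by simp
  then show ?thesis unfolding A_def by simp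
qed

text \<open>The point is that a limit \<open>q\<close> of \<open>C\<close> is still a maximum. It is
  a critical point that is not isolated, hence an extremum. Were it only a minimum, a point of
  \<open>C\<close> near it, with the same value, would be both a local maximum and a local minimum,
  and \<open>u\<close> would be locally constant. Maximality of the component then makes it
  closed.\<close>

lemma component_compact:
  assumes C: "C \<in> components (maxima \<Omega> u)"
  shows "compact C"
proof -
  have CM: "C \<subseteq> maxima \<Omega> u" using C in_components_subset by blast
  then have C\<Omega>: "C \<subseteq> \<Omega>" using maxima_subset by blast
  obtain p where p: "p \<in> C" using in_components_nonempty[OF C] by blast
  define Z where "Z = {x \<in> closure \<Omega>. nabla x = 0 \<and> u x = u p}"
  have "closed Z"
  proof -
    have "Z = (closure \<Omega> \<inter> nabla -` {0}) \<inter> (closure \<Omega> \<inter> u -` {u p})" unfolding Z_def by auto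
    then show ?thesis
      by (simp add: closed_Int continuous_closed_preimage nabla_continuous_on[OF closure_subset_U]
          u_continuous_on[OF closure_subset_U])
  qed
  moreover have "C \<subseteq> Z"
    unfolding Z_def using CM C\<Omega> closure_subset component_u_const[OF C _ p] maxima_critical nabla_eq_0_iff by auto
  ultimately have clZ: "closure C \<subseteq> Z" by (rule closure_minimal[rotated])
  have clM: "q \<in> maxima \<Omega> u" if q: "q \<in> closure C" for q
  proof (cases "q \<in> C")
    case True then show ?thesis using CM by blast
  next
    case False
    have qZ: "q \<in> closure \<Omega>" "critical u q" "u q = u p" using clZ q nabla_eq_0_iff unfolding Z_def by auto
    have "q islimpt C" using q False unfolding closure_def by blast
    then have lim: "q islimpt {x. critical u x}"
      by (rule islimpt_subset) (use CM maxima_critical in blast)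
    from nonisolated_critical_arc[OF qZ(1,2) lim open_UNIV UNIV_I]
    obtain N where N: "open N" "q \<in> N" "(\<forall>x\<in>N. u x \<le> u q) \<or> (\<forall>x\<in>N. u q \<le> u x)"
      by (elim exE conjE)
    show ?thesis
    proof (cases "\<forall>x\<in>N. u x \<le> u q")
      case True
      then have "local_max u q" using local_maxI_open[OF N(1,2)] by blast
      then show ?thesis unfolding maxima_eq using qZ by blast
    next
      case False
      then have ge: "\<forall>x\<in>N. u q \<le> u x" using N(3) by blast
      obtain x where x: "x \<in> C" "x \<in> N" using q N(1,2) by (meson closure_iff_nhds_not_empty disjoint_iff order_refl)
      then have ux: "u x = u q" using component_u_const[OF C _ p] qZ by metis
      have "\<forall>\<^sub>F y in nhds x. u y \<le> u x" using x CM unfolding maxima_eq local_max_def by blast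
      moreover have "\<forall>\<^sub>F y in nhds x. y \<in> N" using N(1) x(2) by (rule eventually_nhds_in_open)
      ultimately have "\<forall>\<^sub>F y in nhds x. u y = u q"
        by eventually_elim (use ge ux in force)
      moreover have "x \<in> closure \<Omega>" using x C\<Omega> closure_subset by blast
      ultimately show ?thesis using not_locally_constant by blast
    qed
  qed
  have "closure C \<subseteq> C"
    by (rule components_maximal[OF C])
      (use clM in_components_connected[OF C] in_components_nonempty[OF C] closure_subset[of C]
        connected_imp_connected_closure in auto)
  then have "closed C" by (simp add: closure_subset_eq)
  moreover have "bounded C" using bounded_subset[OF bounded_\<Omega> C\<Omega>] .
  ultimately show ?thesis by (simp add: compact_eq_bounded_closed)
qed

text \<open>The local neighbourhoods cover the compact set \<open>C\<close>, hence contain a uniform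
  neighbourhood of it.\<close>

lemma component_isolating:
  assumes C: "C \<in> components (maxima \<Omega> u)" and p: "p \<in> C"
  obtains e where "e > 0" "\<And>x. infdist x C \<le> e \<Longrightarrow>
    x \<in> \<Omega> \<and> (critical u x \<longrightarrow> x \<in> C) \<and> u x \<le> u p \<and> (u x = u p \<longrightarrow> x \<in> C)"
proof -
  have comp: "compact C" by (rule component_compact[OF C])
  have "\<forall>q\<in>C. \<exists>N. open N \<and> q \<in> N \<and> N \<subseteq> \<Omega> \<and> C \<inter> N = {x\<in>N. critical u x} \<and> (\<forall>x\<in>N. u x \<le> u q) \<and>
      (\<forall>x\<in>N. critical u x \<longleftrightarrow> u x = u q) \<and> (C \<inter> N = {q} \<or> (C \<inter> N) homeomorphic (UNIV :: real set))"
    using component_local_structure[OF C] by (rule ballI)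
  from bchoice[OF this] obtain N where N: "\<forall>q\<in>C. open (N q) \<and> q \<in> N q \<and> N q \<subseteq> \<Omega> \<and>
      C \<inter> N q = {x\<in>N q. critical u x} \<and> (\<forall>x\<in>N q. u x \<le> u q) \<and>
      (\<forall>x\<in>N q. critical u x \<longleftrightarrow> u x = u q) \<and> (C \<inter> N q = {q} \<or> (C \<inter> N q) homeomorphic (UNIV :: real set))"
    by (rule exE)
  define O' where "O' = (\<Union>q\<in>C. N q)"
  have "open O'" "C \<subseteq> O'" unfolding O'_def using N by auto
  then obtain e where e: "e > 0" "(\<Union>x\<in>C. cball x e) \<subseteq> O'"
    using compact_subset_open_imp_cball_epsilon_subset[OF comp] by blast
  show thesis
  proof (rule that[OF e(1)])
    fix x assume "infdist x C \<le> e"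
    moreover obtain y where "y \<in> C" "infdist x C = dist x y"
      using infdist_attains_inf[OF compact_imp_closed[OF comp]] p by blast
    ultimately have "x \<in> (\<Union>y\<in>C. cball y e)" by (auto simp: dist_commute)
    then have "x \<in> O'" using e(2) by blast
    then obtain q where q: "q \<in> C" "x \<in> N q" unfolding O'_def by blast
    have "u q = u p" by (rule component_u_const[OF C q(1) p])
    then show "x \<in> \<Omega> \<and> (critical u x \<longrightarrow> x \<in> C) \<and> u x \<le> u p \<and> (u x = u p \<longrightarrow> x \<in> C)"
      using bspec[OF N q(1)] q(2) by auto
  qed
qed

text \<open>The alternative of an isolated point is ruled out because \<open>{p}\<close> would be
  open and closed in the connected set \<open>C\<close>, so every point has a chart.\<close>

lemma nonsingleton_component_simple_closed_curve:
  assumes C: "C \<in> components (maxima \<Omega> u)" and xy: "x \<in> C" "y \<in> C" "x \<noteq> y"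
  shows "simple_closed_curve C"
  unfolding simple_closed_curve_def
proof (rule compact_connected_one_manifold_simple_closed_curve)
  show "compact C" by (rule component_compact[OF C])
  show "connected C" by (rule in_components_connected[OF C])
  show "C \<noteq> {}" using xy by blast
  fix p assume p: "p \<in> C"
  from component_local_structure[OF C p]
  obtain N where N: "open N" "p \<in> N" "C \<inter> N = {p} \<or> (C \<inter> N) homeomorphic (UNIV :: real set)"
    by (elim exE conjE)
  have op: "openin (top_of_set C) (C \<inter> N)" by (rule openin_open_Int[OF N(1)])
  have "C \<inter> N \<noteq> {p}"
  proof
    assume "C \<inter> N = {p}"
    moreover have "closedin (top_of_set C) {p}" using p by (simp add: closed_subset)
    ultimately have "{p} = C" using op in_components_connected[OF C] connected_clopen by (metis insert_not_empty)
    then show False using xy by blast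
  qed
  then show "\<exists>W. openin (top_of_set C) W \<and> p \<in> W \<and> W homeomorphic (UNIV :: real set)"
    using op N p by blast
qed

end

context eigenfunction_flow
begin

section \<open>Basins of attraction\<close>

text \<open>Only the distance to \<open>C\<close> has to tend to 0; no limit point on
  \<open>C\<close> is singled out. That the trajectory stays in the closure is part of the basin so
  that it can be passed on to boundary points by continuity.\<close>

definition basin :: "(real^2) set \<Rightarrow> (real^2) set" where
  "basin C = {x \<in> \<Omega>. (\<forall>t\<ge>0. \<Phi> x t \<in> closure \<Omega>) \<and> ((\<lambda>t. infdist (\<Phi> x t) C) \<longlongrightarrow> 0) at_top}"

text \<open>\<open>G\<close> is the part of the superlevel set \<open>u > b\<close> near
  \<open>C\<close>. Its trajectories cannot cross the set \<open>S\<close> at distance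
  \<open>\<epsilon>\<close> from \<open>C\<close>, since \<open>u \<le> b\<close> on
  \<open>S\<close> and \<open>u\<close> does not decrease. Their limit points are critical and
  within \<open>\<epsilon>\<close> of \<open>C\<close>, so they belong to \<open>C\<close>.\<close>

lemma ex_trapping_region:
  assumes C: "C \<in> components (maxima \<Omega> u)"
  obtains G e where "open G" "G \<subseteq> \<Omega>" "e > 0" "\<And>x. infdist x C < e \<Longrightarrow> x \<in> G"
    "\<And>x t. x \<in> G \<Longrightarrow> 0 \<le> t \<Longrightarrow> \<Phi> x t \<in> G"
    "\<And>x. x \<in> G \<Longrightarrow> ((\<lambda>t. infdist (\<Phi> x t) C) \<longlongrightarrow> 0) at_top"
proof -
  have comp: "compact C" by (rule component_compact[OF C])
  have C0: "C \<noteq> {}" using in_components_nonempty[OF C] .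
  then obtain p where p: "p \<in> C" by blast
  obtain \<epsilon> where \<epsilon>: "\<epsilon> > 0" and iso: "\<And>x. infdist x C \<le> \<epsilon> \<Longrightarrow>
      x \<in> \<Omega> \<and> (critical u x \<longrightarrow> x \<in> C) \<and> u x \<le> u p \<and> (u x = u p \<longrightarrow> x \<in> C)"
    using component_isolating[OF C p] by metis
  define K where "K = {x. infdist x C \<le> \<epsilon>}"
  have K: "compact K" unfolding K_def by (rule compact_infdist_le[OF C0 comp \<epsilon>])
  have K\<Omega>: "K \<subseteq> \<Omega>"
  proof
    fix x assume "x \<in> K"
    then have "infdist x C \<le> \<epsilon>" unfolding K_def by simp
    from iso[OF this] show "x \<in> \<Omega>" by (rule conjunct1)
  qed
  have KU: "K \<subseteq> U" using K\<Omega> \<Omega>_subset_U by blast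
  define S where "S = {x. infdist x C = \<epsilon>}"
  have "closed S" unfolding S_def
    using continuous_closed_vimage[of "{\<epsilon>}" "\<lambda>x. infdist x C"] by (auto simp: vimage_def continuous_infdist)
  moreover have "S \<subseteq> K" unfolding S_def K_def by auto
  ultimately have S: "compact S" "S \<subseteq> K"
    using compact_Int_closed[OF K, of S] by (simp_all add: inf.absorb2)
  have Slt: "u x < u p" if "x \<in> S" for x
  proof -
    have x: "infdist x C = \<epsilon>" using that unfolding S_def by simp
    then have "x \<notin> C" using \<epsilon> by auto
    moreover have "u x \<le> u p \<and> (u x = u p \<longrightarrow> x \<in> C)" using iso[of x] x by simp
    ultimately have "u x \<le> u p" "u x \<noteq> u p" by blast+
    then show ?thesis by simp
  qed
  \<comment> \<open>The maximum of \<open>u\<close> on the compact set \<open>S\<close>; if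
    \<open>S\<close> is empty, any value below \<open>u p\<close> will do.\<close>
  obtain b where b: "b < u p" "\<And>x. x \<in> S \<Longrightarrow> u x \<le> b"
  proof (cases "S = {}")
    case True
    then show thesis using that[of "u p - 1"] by auto
  next
    case False
    obtain s where "s \<in> S" "\<And>x. x \<in> S \<Longrightarrow> u x \<le> u s"
      using continuous_attains_sup[OF S(1) False u_continuous_on] S(2) KU by blast
    then show thesis using that[of "u s"] Slt by blast
  qed
  define G where "G = {x. infdist x C < \<epsilon>} \<inter> {x \<in> \<Omega>. b < u x}"
  have "open {x. infdist x C < \<epsilon>}" by (intro open_Collect_less continuous_intros)
  moreover have "open {x \<in> \<Omega>. b < u x}"
  proof -
    have "open (\<Omega> \<inter> u -` {b<..})"
      by (rule continuous_open_preimage[OF u_continuous_on[OF \<Omega>_subset_U] open_\<Omega>]) simp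
    moreover have "\<Omega> \<inter> u -` {b<..} = {x \<in> \<Omega>. b < u x}" by auto
    ultimately show ?thesis by simp
  qed
  ultimately have Gopen: "open G" unfolding G_def by (rule open_Int)
  have GU: "G \<subseteq> U" and G\<Omega>: "G \<subseteq> \<Omega>" unfolding G_def using \<Omega>_subset_U by auto
  have CG: "C \<subseteq> G"
  proof
    fix x assume x: "x \<in> C"
    then have "infdist x C < \<epsilon>" using \<epsilon> by simp
    moreover have "x \<in> \<Omega>" using x in_components_subset[OF C] maxima_subset by blast
    moreover have "b < u x" using component_u_const[OF C x p] b(1) by simp
    ultimately show "x \<in> G" unfolding G_def by simp
  qed
  have inv: "\<Phi> x t \<in> G" if x: "x \<in> G" and t: "0 \<le> t" for x t
  proof -
    have mono: "b < u (\<Phi> x s)" if "0 \<le> s" for s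
    proof -
      have "x \<in> U" using x GU by blast
      from u_flow_mono[OF this order_refl that] have "u x \<le> u (\<Phi> x s)" by simp
      moreover have "b < u x" using x unfolding G_def by simp
      ultimately show ?thesis by simp
    qed
    have lt: "infdist (\<Phi> x t) C < \<epsilon>"
    proof (rule ccontr)
      assume "\<not> infdist (\<Phi> x t) C < \<epsilon>"
      then have "\<exists>s\<ge>0. s \<le> t \<and> infdist (\<Phi> x s) C = \<epsilon>"
      proof (intro IVT')
        show "continuous_on {0..t} (\<lambda>s. infdist (\<Phi> x s) C)"
          by (intro continuous_on_infdist continuous_on_subset[OF flow_continuous_time]) simp
      qed (use x t in \<open>simp_all add: G_def\<close>)
      then obtain s where "0 \<le> s" "\<Phi> x s \<in> S" unfolding S_def by blast
      then show False using mono[of s] b(2)[of "\<Phi> x s"] by simp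
    qed
    then have "\<Phi> x t \<in> \<Omega>" using iso[OF less_imp_le] by blast
    then show ?thesis unfolding G_def using lt mono[OF t] by blast
  qed
  have lim: "((\<lambda>t. infdist (\<Phi> x t) C) \<longlongrightarrow> 0) at_top" if x: "x \<in> G" for x
  proof (rule tendstoI, rule ccontr)
    fix d :: real assume d: "d > 0" and neg: "\<not> (\<forall>\<^sub>F t in at_top. dist (infdist (\<Phi> x t) C) 0 < d)"
    have "\<forall>n. \<exists>t\<ge>real n. d \<le> infdist (\<Phi> x t) C"
    proof
      fix n
      obtain t where "real n \<le> t" "\<not> dist (infdist (\<Phi> x t) C) 0 < d"
        using neg unfolding eventually_at_top_linorder by blast
      then show "\<exists>t\<ge>real n. d \<le> infdist (\<Phi> x t) C"
        by (auto simp: infdist_nonneg not_less intro!: exI[of _ t])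
    qed
    then obtain s where s: "\<And>n. real n \<le> s n" "\<And>n. d \<le> infdist (\<Phi> x (s n)) C" by metis
    have s_lim: "filterlim s at_top sequentially"
      by (rule filterlim_at_top_mono[OF filterlim_real_sequentially]) (simp add: s(1))
    have inK: "\<Phi> x (s n) \<in> K" for n
      using inv[OF x, of "s n"] order_trans[OF of_nat_0_le_iff s(1)] unfolding G_def K_def by auto
    obtain q s' where q: "q \<in> K" "filterlim s' at_top sequentially" "(\<lambda>n. \<Phi> x (s' n)) \<longlonglongrightarrow> q" "range s' \<subseteq> range s"
      using ex_limit_point[OF K s_lim inK] by metis
    have x_cl: "\<Phi> x t \<in> closure \<Omega>" if "0 \<le> t" for t using inv[OF x that] G\<Omega> closure_subset by blast
    have "critical u q" by (rule limit_point_le(3)[OF x_cl q(2,3)])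
    then have "q \<in> C" using iso[of q] q(1) unfolding K_def by blast
    then have "infdist q C = 0" by simp
    moreover have "(\<lambda>n. infdist (\<Phi> x (s' n)) C) \<longlonglongrightarrow> infdist q C" using q(3) by (rule tendsto_infdist)
    moreover have "d \<le> infdist (\<Phi> x (s' n)) C" for n
    proof -
      have "s' n \<in> range s" using q(4) by blast
      then obtain k where "s' n = s k" by blast
      then show ?thesis using s(2)[of k] by simp
    qed
    ultimately have "d \<le> 0" using LIMSEQ_le_const by metis
    then show False using d by simp
  qed
  have "\<exists>e>0. \<forall>x. infdist x C < e \<longrightarrow> x \<in> G"
  proof -
    obtain e where e: "e > 0" "(\<Union>x\<in>C. cball x e) \<subseteq> G"
      using compact_subset_open_imp_cball_epsilon_subset[OF comp Gopen CG] by blast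
    have "x \<in> G" if "infdist x C < e" for x
    proof -
      obtain y where "y \<in> C" "infdist x C = dist x y"
        using infdist_attains_inf[OF compact_imp_closed[OF comp] C0] by blast
      then show ?thesis using e(2) that by (force simp: dist_commute)
    qed
    then show ?thesis using e(1) by blast
  qed
  then show thesis using that[OF Gopen G\<Omega> _ _ inv lim] by blast
qed

text \<open>Replaces the asymptotic condition by the arrival in the open set \<open>G\<close> at
  some finite time, from which openness of the basin follows. Before the arrival the trajectory is
  kept in the closure by \<open>flow_stays_in_closure\<close>, after it by invariance of
  \<open>G\<close>.\<close>

lemma basin_eq:
  assumes C: "C \<in> components (maxima \<Omega> u)"
  shows "\<exists>G. open G \<and> C \<subseteq> G \<and> G \<subseteq> basin C \<and> basin C = {x \<in> \<Omega>. \<exists>T\<ge>0. \<Phi> x T \<in> G}"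
proof -
  obtain G e where G: "open G" "G \<subseteq> \<Omega>" "e > 0" "\<And>x. infdist x C < e \<Longrightarrow> x \<in> G"
    "\<And>x t. x \<in> G \<Longrightarrow> 0 \<le> t \<Longrightarrow> \<Phi> x t \<in> G"
    "\<And>x. x \<in> G \<Longrightarrow> ((\<lambda>t. infdist (\<Phi> x t) C) \<longlongrightarrow> 0) at_top"
    using ex_trapping_region[OF C] by metis
  have eq: "basin C = {x \<in> \<Omega>. \<exists>T\<ge>0. \<Phi> x T \<in> G}"
  proof (intro equalityI subsetI)
    fix x assume x: "x \<in> basin C"
    then have "((\<lambda>t. infdist (\<Phi> x t) C) \<longlongrightarrow> 0) at_top" unfolding basin_def by blast
    then have "\<forall>\<^sub>F t in at_top. infdist (\<Phi> x t) C < e" using G(3) by (rule order_tendstoD(2))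
    then have "\<forall>\<^sub>F t in at_top. 0 \<le> t \<and> infdist (\<Phi> x t) C < e"
      using eventually_ge_at_top[of "0::real"] by eventually_elim simp
    then obtain T where "0 \<le> T" "infdist (\<Phi> x T) C < e"
      using eventually_happens'[OF trivial_limit_at_top_linorder] by blast
    then show "x \<in> {x \<in> \<Omega>. \<exists>T\<ge>0. \<Phi> x T \<in> G}" using G(4) x unfolding basin_def by blast
  next
    fix x assume "x \<in> {x \<in> \<Omega>. \<exists>T\<ge>0. \<Phi> x T \<in> G}"
    then obtain T where T: "x \<in> \<Omega>" "0 \<le> T" "\<Phi> x T \<in> G" by blast
    have shift: "\<Phi> x t = \<Phi> (\<Phi> x T) (t - T)" if "T \<le> t" for t
      using flow_add[of T "t - T" x] T(2) that by simp
    have "\<Phi> x t \<in> closure \<Omega>" if "0 \<le> t" for t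
    proof (cases "t \<le> T")
      case True
      then show ?thesis using flow_stays_in_closure[OF T(1) _ that] T(3) G(2) by blast
    next
      case False
      then show ?thesis using shift[of t] G(5)[OF T(3), of "t - T"] G(2) closure_subset by auto
    qed
    moreover have "((\<lambda>t. infdist (\<Phi> x t) C) \<longlongrightarrow> 0) at_top"
    proof -
      have "filterlim (\<lambda>t::real. t - T) at_top at_top"
        using filterlim_tendsto_add_at_top[OF tendsto_const[of "- T"] filterlim_ident] by simp
      from filterlim_compose[OF G(6)[OF T(3)] this]
      have "((\<lambda>t. infdist (\<Phi> (\<Phi> x T) (t - T)) C) \<longlongrightarrow> 0) at_top" .
      moreover have "\<forall>\<^sub>F t in at_top. infdist (\<Phi> (\<Phi> x T) (t - T)) C = infdist (\<Phi> x t) C"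
        using eventually_ge_at_top[of T] by eventually_elim (simp add: shift[symmetric])
      ultimately show ?thesis by (rule Lim_transform_eventually)
    qed
    ultimately show "x \<in> basin C" unfolding basin_def using T(1) by blast
  qed
  have "G \<subseteq> basin C" unfolding eq using G(2) by (auto intro!: exI[of _ "0::real"])
  moreover have "C \<subseteq> G" using G(3,4) by auto
  ultimately show ?thesis using G(1) eq by (intro exI[of _ G] conjI)
qed

lemma open_basin:
  assumes "C \<in> components (maxima \<Omega> u)"
  shows "open (basin C)"
proof -
  from basin_eq[OF assms]
  obtain G where G: "open G" "basin C = {x \<in> \<Omega>. \<exists>T\<ge>0. \<Phi> x T \<in> G}" by (elim exE conjE)
  have "basin C = \<Omega> \<inter> (\<Union>T\<in>{0..}. (\<lambda>x. \<Phi> x T) -` G)" unfolding G(2) by auto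
  moreover have "open ((\<lambda>x. \<Phi> x T) -` G)" if "T \<in> {0..}" for T
    using flow_continuous[of T] that G(1) by (simp add: open_vimage)
  ultimately show ?thesis using open_\<Omega> by (metis open_Int open_UN)
qed

text \<open>Distinct components are disjoint compact sets at some positive distance
  \<open>d\<close>, and no point is within \<open>d / 2\<close> of both.\<close>

lemma basin_disjoint:
  assumes C: "C \<in> components (maxima \<Omega> u)" "C' \<in> components (maxima \<Omega> u)"
    and x: "x \<in> basin C" "x \<in> basin C'"
  shows "C = C'"
proof (rule ccontr)
  assume "C \<noteq> C'"
  then have "C \<inter> C' = {}" using components_nonoverlap[OF C] by blast
  then obtain d where d: "d > 0" "\<And>y z. y \<in> C \<Longrightarrow> z \<in> C' \<Longrightarrow> d \<le> dist y z"
    using separate_compact_closed[OF component_compact[OF C(1)] compact_imp_closed[OF component_compact[OF C(2)]]]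
    by blast
  have "\<forall>\<^sub>F t in at_top. infdist (\<Phi> x t) C < d / 2 \<and> infdist (\<Phi> x t) C' < d / 2"
    using x d(1) unfolding basin_def by (auto intro!: eventually_conj dest: order_tendstoD(2)[of _ 0 _ "d / 2"])
  then obtain t where t: "infdist (\<Phi> x t) C < d / 2" "infdist (\<Phi> x t) C' < d / 2"
    using eventually_happens'[OF trivial_limit_at_top_linorder] by blast
  obtain y where y: "y \<in> C" "infdist (\<Phi> x t) C = dist (\<Phi> x t) y"
    using infdist_attains_inf[OF compact_imp_closed[OF component_compact[OF C(1)]] in_components_nonempty[OF C(1)]] by metis
  obtain z where z: "z \<in> C'" "infdist (\<Phi> x t) C' = dist (\<Phi> x t) z"
    using infdist_attains_inf[OF compact_imp_closed[OF component_compact[OF C(2)]] in_components_nonempty[OF C(2)]] by metis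
  have "dist y z \<le> dist (\<Phi> x t) y + dist (\<Phi> x t) z" by (rule dist_triangle3)
  then show False using d(2)[OF y(1) z(1)] t y(2) z(2) by simp
qed

lemma neumann_domain_subset_basin:
  assumes D: "D \<in> neumann_domains \<Omega> u" and C: "C \<in> components (maxima \<Omega> u)" and x1: "x1 \<in> C" "x1 \<in> closure D"
  shows "D \<subseteq> basin C"
proof (rule ccontr)
  assume not_sub: "\<not> D \<subseteq> basin C"
  have Dsub: "D \<subseteq> \<Omega> - neumann_line_set \<Omega> u" and Dcon: "connected D"
    using D in_components_subset in_components_connected unfolding neumann_domains_def by blast+
  from basin_eq[OF C] obtain G where G: "open G" "C \<subseteq> G" "G \<subseteq> basin C" by (elim exE conjE)
  have "D \<inter> G \<noteq> {}" using x1 G(1,2) by (meson closure_iff_nhds_not_empty order_refl subsetD)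
  then have "D \<inter> basin C \<noteq> {}" using G(3) by blast
  then have "D \<inter> frontier (basin C) \<noteq> {}"
    by (rule connected_Int_frontier[OF Dcon]) (use not_sub in blast)
  then obtain x where xD: "x \<in> D" and xf: "x \<in> frontier (basin C)" by blast
  have x_notin: "x \<notin> basin C" using xf open_basin[OF C] unfolding frontier_def by (simp add: interior_open)
  have meets: "\<exists>y\<in>W. y \<in> basin C" if "open W" "x \<in> W" for W
    using xf that unfolding frontier_def by (metis DiffD1 closure_iff_nhds_not_empty disjoint_iff order_refl)
  have x\<Omega>: "x \<in> \<Omega>" and xN: "x \<notin> neumann_line_set \<Omega> u" using xD Dsub by auto
  have x_cl: "x \<in> closure \<Omega>" using x\<Omega> closure_subset by blast
  have xU: "x \<in> U" using x\<Omega> \<Omega>_subset_U by blast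
  have "\<not> critical u x" using xN x_cl unfolding neumann_line_set_def critical_set_eq by blast
  then have Vx: "V x \<noteq> 0" using V_eq_0_iff[OF x_cl] by simp
  have stay: "\<Phi> x t \<in> closure \<Omega>" if t: "0 \<le> t" for t
  proof (rule ccontr)
    assume "\<Phi> x t \<notin> closure \<Omega>"
    moreover have "open ((\<lambda>y. \<Phi> y t) -` (- closure \<Omega>))"
      using flow_continuous[OF t] by (simp add: open_vimage open_Compl)
    ultimately obtain y where "y \<in> basin C" "\<Phi> y t \<notin> closure \<Omega>"
      using meets[of "(\<lambda>y. \<Phi> y t) -` (- closure \<Omega>)"] by auto
    then show False using t unfolding basin_def by blast
  qed
  obtain q s where s: "filterlim s at_top sequentially" "(\<lambda>n. \<Phi> x (s n)) \<longlonglongrightarrow> q"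
    using ex_limit_point[OF compact_closure_\<Omega> filterlim_real_sequentially, of x] stay by (metis of_nat_0_le_iff)
  have q_cl: "q \<in> closure \<Omega>" and q_crit: "critical u q" and le: "\<And>t. 0 \<le> t \<Longrightarrow> u (\<Phi> x t) \<le> u q"
    using limit_point_le[OF stay s] by blast+
  \<comment> \<open>Strict because \<open>x\<close> is not critical: at time \<open>t + 1\<close>
    the value is already larger than at \<open>t\<close>.\<close>
  have lt: "u (\<Phi> x t) < u q" if "0 \<le> t" for t
    using u_flow_strict_mono[OF xU Vx that, of "t + 1"] le[of "t + 1"] that by simp
  have s0: "\<forall>\<^sub>F n in sequentially. 0 \<le> s n" using s(1) unfolding filterlim_at_top by blast
  have q_not_max: "\<not> local_max u q"
  proof
    assume "local_max u q"
    then have "q \<in> maxima \<Omega> u" unfolding maxima_eq using q_cl by blast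
    then obtain C' where C': "C' \<in> components (maxima \<Omega> u)" "q \<in> C'"
      using Union_components by blast
    from basin_eq[OF C'(1)]
    obtain G' where G': "open G'" "C' \<subseteq> G'" "basin C' = {x \<in> \<Omega>. \<exists>T\<ge>0. \<Phi> x T \<in> G'}"
      by (elim exE conjE)
    have "\<forall>\<^sub>F n in sequentially. \<Phi> x (s n) \<in> G'"
      using s(2) G'(1) by (rule topological_tendstoD) (use G'(2) C'(2) in blast)
    with s0 have "\<forall>\<^sub>F n in sequentially. 0 \<le> s n \<and> \<Phi> x (s n) \<in> G'" by (rule eventually_conj)
    then obtain n where "0 \<le> s n" "\<Phi> x (s n) \<in> G'"
      using eventually_happens'[OF sequentially_bot] by blast
    then have x': "x \<in> basin C'" unfolding G'(3) using x\<Omega> by blast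
    then obtain y where "y \<in> basin C'" "y \<in> basin C" using meets[OF open_basin[OF C'(1)]] by blast
    then have "C' = C" using basin_disjoint[OF C'(1) C] by blast
    then show False using x' x_notin by blast
  qed
  \<comment> \<open>The trajectory approaches \<open>q\<close> through values strictly below
    \<open>u q\<close>.\<close>
  have q_not_min: "\<not> local_min u q"
  proof
    assume "local_min u q"
    then have "\<forall>\<^sub>F n in sequentially. u q \<le> u (\<Phi> x (s n))"
      unfolding local_min_def using s(2) by (rule eventually_compose_filterlim)
    with s0 have "\<forall>\<^sub>F n in sequentially. False"
      by eventually_elim (use lt in force)
    then show False by simp
  qed
  have q_saddle: "q \<in> saddles \<Omega> u"
    unfolding saddles_def maxima_def minima_def critical_set_eq using q_cl q_crit q_not_max q_not_min by blast
  have "\<not> q islimpt {y. critical u y}"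
  proof
    assume lim: "q islimpt {y. critical u y}"
    from nonisolated_critical_arc[OF q_cl q_crit lim open_UNIV UNIV_I]
    obtain N where N: "open N" "q \<in> N" "(\<forall>x\<in>N. u x \<le> u q) \<or> (\<forall>x\<in>N. u q \<le> u x)"
      by (elim exE conjE)
    then show False
      using q_not_max q_not_min unfolding local_max_def local_min_def eventually_nhds by blast
  qed
  then have iso: "\<forall>\<^sub>F y in at q. \<not> critical u y"
    unfolding islimpt_conv_frequently_at frequently_def by simp
  have "x \<in> unstable_set \<Omega> u q"
    by (rule unstable_setI[OF stay isolated_limit_point_tendsto[OF stay s iso]])
  then have "x \<in> flow_set \<Omega> u q" unfolding flow_set_def by blast
  moreover have "x \<notin> frontier (flow_set \<Omega> u q)"
  proof
    assume "x \<in> frontier (flow_set \<Omega> u q)"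
    moreover have "x \<notin> frontier \<Omega>" using x\<Omega> open_\<Omega> unfolding frontier_def by (simp add: interior_open)
    ultimately have "x \<in> (\<Union>r\<in>saddles \<Omega> u. frontier (flow_set \<Omega> u r) - frontier \<Omega>)" using q_saddle by blast
    then have "x \<in> closure (\<Union>r\<in>saddles \<Omega> u. frontier (flow_set \<Omega> u r) - frontier \<Omega>)"
      by (rule subsetD[OF closure_subset])
    then have "x \<in> neumann_line_set \<Omega> u" unfolding neumann_line_set_def by (rule UnI1)
    then show False using xN by contradiction
  qed
  ultimately have "x \<in> interior (flow_set \<Omega> u q)"
    using subsetD[OF closure_subset] unfolding frontier_def by blast
  moreover have "open (\<Omega> \<inter> u -` {..<u q})"
    by (rule continuous_open_preimage[OF u_continuous_on[OF \<Omega>_subset_U] open_\<Omega>]) simp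
  moreover have "x \<in> \<Omega> \<inter> u -` {..<u q}" using x\<Omega> lt[of 0] by simp
  ultimately obtain y where y: "y \<in> basin C" "y \<in> flow_set \<Omega> u q" "u y < u q"
    using meets[of "interior (flow_set \<Omega> u q) \<inter> (\<Omega> \<inter> u -` {..<u q})"] interior_subset by auto
  have "y \<notin> stable_set \<Omega> u q" using stable_set_u_le y(3) by force
  \<comment> \<open>The point \<open>y\<close> ascends to \<open>q\<close> and at the same time
    towards \<open>C\<close>, which is closed. So \<open>q\<close> would belong to \<open>C\<close>
    and be a maximum.\<close>
  then have "(\<Phi> y \<longlongrightarrow> q) at_top" using y(2) unstable_setD unfolding flow_set_def by blast
  then have "((\<lambda>t. infdist (\<Phi> y t) C) \<longlongrightarrow> infdist q C) at_top" by (rule tendsto_infdist)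
  moreover have "((\<lambda>t. infdist (\<Phi> y t) C) \<longlongrightarrow> 0) at_top" using y(1) unfolding basin_def by blast
  ultimately have "infdist q C = 0" by (rule tendsto_unique[OF trivial_limit_at_top_linorder])
  then have "q \<in> C"
    using in_closed_iff_infdist_zero[OF compact_imp_closed[OF component_compact[OF C]] in_components_nonempty[OF C]] by blast
  then show False using q_not_max in_components_subset[OF C] unfolding maxima_def by blast
qed

end

theorem theorem1p1:
  fixes \<Omega> U D :: "(real^2) set"
    and u :: "real^2 \<Rightarrow> real"
    and lam :: real
    and x1 x2 :: "real^2"
  assumes "open \<Omega>" and "connected \<Omega>" and "bounded \<Omega>"
    and "open U" and "closure \<Omega> \<subseteq> U" and "u real_analytic_on U"
    and "\<forall>x\<in>\<Omega>. - laplacian u x = lam * u x"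
    and "\<forall>x\<in>frontier \<Omega>. u x = 0"
    and "\<exists>x\<in>\<Omega>. u x \<noteq> 0"
    and "D \<in> neumann_domains \<Omega> u"
    and "x1 \<in> closure D" and "x2 \<in> closure D" and "x1 \<noteq> x2"
    and "local_max u x1" and "local_max u x2"
  shows "\<exists>\<theta>. curve_of_local_maxima \<Omega> u \<theta> \<and> x1 \<in> \<theta> \<and> x2 \<in> \<theta>"
proof -
  interpret analytic_eigenfunction \<Omega> U u lam
    by unfold_locales (use assms in auto)
  obtain V L m where Vm: "lipschitz_flow V L" "\<And>x. V x = m x *\<^sub>R nabla x" "\<And>x. 0 \<le> m x"
    "\<And>x. x \<in> closure \<Omega> \<Longrightarrow> m x = 1" "\<And>x. x \<notin> U \<Longrightarrow> m x = 0"
    using ex_cutoff_field by blast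
  interpret lipschitz_flow V L by (rule Vm(1))
  interpret eigenfunction_flow \<Omega> U u lam V L m
    by unfold_locales (use Vm in auto)
  have D: "D \<noteq> {}" "D \<subseteq> \<Omega>"
    using assms(10) in_components_nonempty in_components_subset unfolding neumann_domains_def by blast+
  then have "closure D \<subseteq> closure \<Omega>" by (intro closure_mono)
  then have "x1 \<in> maxima \<Omega> u" "x2 \<in> maxima \<Omega> u" using assms unfolding maxima_eq by auto
  then obtain C1 C2 where C1: "C1 \<in> components (maxima \<Omega> u)" "x1 \<in> C1"
    and C2: "C2 \<in> components (maxima \<Omega> u)" "x2 \<in> C2"
    using Union_components by (metis UnionE)
  have "D \<subseteq> basin C1" "D \<subseteq> basin C2"
    using neumann_domain_subset_basin assms C1 C2 by blast+
  then have "C1 = C2" using D basin_disjoint[OF C1(1) C2(1)] by blast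
  then show ?thesis
    using nonsingleton_component_simple_closed_curve[OF C1] C1 C2 assms(13)
    unfolding curve_of_local_maxima_def by blast
qed

end
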